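(* Let $T>0$, let $\sigma:\mathbb{R}\to\mathbb{R}$ be a Lipschitz continuous function with linear growth, let $x_0:[0,T]\to\mathbb{R}$ be a continuous function, and let $K_1,K_2\in L^\gamma([0,T];\mathbb{R})$ for some $\gamma>2$ be two kernels such that $K_2$ and $K_1-K_2$ (or $K_2-K_1$) are completely monotone. Let $X$ and $Y$ be the solutions of the stochastic Volterra equations $$X_t=x_0(t)+\int_0^tK_1(t-s)\sigma(X_s)\,\mathrm{d}W_s,\qquad Y_t=x_0(t)+\int_0^tK_2(t-s)\sigma(Y_s)\,\mathrm{d}W_s,\qquad t\in[0,T].$$ Then for all $p>0$, there is a constant $C>0$ depending on $p,\gamma,T$ such that $$\mathbb{E}\left[\sup_{t\in[0,T]}|X_t-Y_t|^p\right]\le C\,\|K_1-K_2\|_{L^\gamma_T}^p.$$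
   Context: Fix a filtered probability space $(\Omega,\mathcal{F},(\mathcal{F}_t)_{t\ge0},\mathbb{P})$ satisfying the usual conditions and equipped with a one-dimensional Brownian motion $W$. Write $\|K\|_{L^\gamma_T}:=\left(\int_0^T|K(s)|^\gamma\,\mathrm{d}s\right)^{1/\gamma}$ for the norm of $L^\gamma([0,T];\mathbb{R})$. A kernel $K:(0,\infty)\to\mathbb{R}$ is called completely monotone if there exists a non-negative measure $\mu$ on $[0,\infty)$ such that $K(t)=\int_0^\infty e^{-xt}\,\mu(\mathrm{d}x)$ for all $t>0$. By standard results both stochastic Volterra equations have a unique solution, and $\sup_{t\in[0,T]}\mathbb{E}[|X_t|^p+|Y_t|^p]<\infty$.
   Formalization: C may depend, besides p, γ, T, on the Lipschitz and growth constants of σ, a bound on |x_0| and a bound on the L^γ norms of K_1, K_2; with C depending on p, γ, T alone the claim fails (x_0=0, K_1=2, K_2=1, σ≡λ, λ→∞). *)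

theory Defs
  imports "HOL-Probability.Probability"
begin

section \<open>Filtered probability space and Brownian motion\<close>

text \<open>
  Time is of type \<^typ>\<open>real\<close>; only times \<open>t \<ge> 0\<close> are ever used, so a filtration indexed by
  \<open>[0, \<infinity>)\<close> is read as being extended by \<open>F 0\<close> to negative times.
  The usual conditions are completeness and right-continuity.
\<close>

locale usual_filtered_space =
  prob_space M + complete_measure M + filtration "space M" F
  for M :: "'a measure" and F :: "real \<Rightarrow> 'a measure" +
  assumes subalgebra_F: "\<And>t. subalgebra M (F t)"
    and null_sets_F: "null_sets M \<subseteq> sets (F 0)"
    and right_continuous_F: "\<And>t. 0 \<le> t \<Longrightarrow> sets (F t) = (\<Inter>s\<in>{t<..}. sets (F s))"

locale brownian_space = usual_filtered_space M F
  for M :: "'a measure" and F :: "real \<Rightarrow> 'a measure" +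
  fixes W :: "real \<Rightarrow> 'a \<Rightarrow> real"
  assumes W_adapted: "\<And>t. 0 \<le> t \<Longrightarrow> W t \<in> borel_measurable (F t)"
    and W_zero: "AE \<omega> in M. W 0 \<omega> = 0"
    and W_continuous: "AE \<omega> in M. continuous_on {0..} (\<lambda>t. W t \<omega>)"
    and W_normal: "\<And>s t. 0 \<le> s \<Longrightarrow> s < t \<Longrightarrow>
      distributed M lborel (\<lambda>\<omega>. W t \<omega> - W s \<omega>) (normal_density 0 (sqrt (t - s)))"
    and W_indep: "\<And>s t. 0 \<le> s \<Longrightarrow> s < t \<Longrightarrow>
      indep_set (sets (F s)) {(\<lambda>\<omega>. W t \<omega> - W s \<omega>) -` A \<inter> space M | A. A \<in> sets borel}"

section \<open>The Ito integral\<close>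

text \<open>
  A list \<open>[(a\<^sub>1, b\<^sub>1, \<xi>\<^sub>1), \<dots>]\<close> encodes the elementary process
  \<open>(s, \<omega>) \<mapsto> \<Sum>i. \<xi>\<^sub>i \<omega> \<cdot> 1\<^bsub>(a\<^sub>i, b\<^sub>i]\<^esub> s\<close>.
\<close>

type_synonym 'a elementary = "(real \<times> real \<times> ('a \<Rightarrow> real)) list"

definition elementary_process :: "(real \<Rightarrow> 'a measure) \<Rightarrow> 'a elementary \<Rightarrow> bool" where
  "elementary_process F H \<longleftrightarrow>
     (\<forall>(a, b, \<xi>) \<in> set H. 0 \<le> a \<and> a \<le> b \<and> \<xi> \<in> borel_measurable (F a) \<and>
        bounded (\<xi> ` space (F a)))"

definition elementary_value :: "'a elementary \<Rightarrow> real \<Rightarrow> 'a \<Rightarrow> real" where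
  "elementary_value H s \<omega> = (\<Sum>(a, b, \<xi>) \<leftarrow> H. \<xi> \<omega> * indicator {a<..b} s)"

definition elementary_integral ::
  "(real \<Rightarrow> 'a \<Rightarrow> real) \<Rightarrow> 'a elementary \<Rightarrow> real \<Rightarrow> 'a \<Rightarrow> real" where
  "elementary_integral W H t \<omega> = (\<Sum>(a, b, \<xi>) \<leftarrow> H. \<xi> \<omega> * (W (min b t) \<omega> - W (min a t) \<omega>))"

definition progressive :: "(real \<Rightarrow> 'a measure) \<Rightarrow> real \<Rightarrow> (real \<Rightarrow> 'a \<Rightarrow> real) \<Rightarrow> bool" where
  "progressive F T X \<longleftrightarrow>
     (\<forall>t\<in>{0..T}. (\<lambda>(s, \<omega>). X s \<omega>) \<in> borel_measurable (restrict_space borel {0..t} \<Otimes>\<^sub>M F t))"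

text \<open>
  \<open>has_ito_integral M F W H t I\<close> means \<open>I = \<integral>\<^sub>0\<^sup>t H\<^sub>s dW\<^sub>s\<close> almost surely, for progressively measurable
  \<open>H\<close> with \<open>\<integral>\<^sub>0\<^sup>t H\<^sub>s\<^sup>2 ds < \<infinity>\<close> almost surely: \<open>I\<close> is the limit in probability of the integrals of
  elementary processes \<open>H\<^sup>n\<close> with \<open>\<integral>\<^sub>0\<^sup>t (H\<^sup>n\<^sub>s - H\<^sub>s)\<^sup>2 ds \<rightarrow> 0\<close> in probability. It is a relation
  because the integral is only determined up to null sets.
\<close>

definition has_ito_integral ::
  "'a measure \<Rightarrow> (real \<Rightarrow> 'a measure) \<Rightarrow> (real \<Rightarrow> 'a \<Rightarrow> real) \<Rightarrow>
   (real \<Rightarrow> 'a \<Rightarrow> real) \<Rightarrow> real \<Rightarrow> ('a \<Rightarrow> real) \<Rightarrow> bool" where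
  "has_ito_integral M F W H t I \<longleftrightarrow>
     progressive F t H \<and>
     (AE \<omega> in M. (\<integral>\<^sup>+s\<in>{0..t}. ennreal ((H s \<omega>)\<^sup>2) \<partial>lborel) < \<infinity>) \<and>
     I \<in> borel_measurable M \<and>
     (\<exists>S. (\<forall>n. elementary_process F (S n)) \<and>
       (\<forall>\<epsilon>>0. (\<lambda>n. measure M {\<omega> \<in> space M.
            (\<integral>\<^sup>+s\<in>{0..t}. ennreal ((elementary_value (S n) s \<omega> - H s \<omega>)\<^sup>2) \<partial>lborel) > ennreal \<epsilon>})
          \<longlonglongrightarrow> 0) \<and>
       (\<forall>\<epsilon>>0. (\<lambda>n. measure M {\<omega> \<in> space M.
            \<bar>elementary_integral W (S n) t \<omega> - I \<omega>\<bar> > \<epsilon>}) \<longlonglongrightarrow> 0))"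

section \<open>Kernels and stochastic Volterra equations\<close>

definition in_L :: "real \<Rightarrow> real \<Rightarrow> (real \<Rightarrow> real) \<Rightarrow> bool" where
  "in_L \<gamma> T K \<longleftrightarrow> set_borel_measurable lborel {0..T} K \<and>
     set_integrable lborel {0..T} (\<lambda>s. \<bar>K s\<bar> powr \<gamma>)"

definition L_norm :: "real \<Rightarrow> real \<Rightarrow> (real \<Rightarrow> real) \<Rightarrow> real" where
  "L_norm \<gamma> T K = (LINT s:{0..T}|lborel. \<bar>K s\<bar> powr \<gamma>) powr (1 / \<gamma>)"

text \<open>Kernels live on \<open>(0, \<infinity>)\<close>; their values at other points are irrelevant.\<close>

definition completely_monotone :: "(real \<Rightarrow> real) \<Rightarrow> bool" where
  "completely_monotone K \<longleftrightarrow>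
     (\<exists>\<mu>. sets \<mu> = sets (restrict_space borel {0..}) \<and>
        (\<forall>t>0. integrable \<mu> (\<lambda>x. exp (- x * t)) \<and> K t = (\<integral>x. exp (- x * t) \<partial>\<mu>)))"

text \<open>
  A solution is a progressively measurable process, with almost surely continuous paths (so that the
  supremum over \<open>[0, T]\<close> of a solution does not depend on the choice of a modification),
  that satisfies the equation almost surely at each time of \<open>[0, T]\<close>.
\<close>

definition volterra_solution ::
  "'a measure \<Rightarrow> (real \<Rightarrow> 'a measure) \<Rightarrow> (real \<Rightarrow> 'a \<Rightarrow> real) \<Rightarrow> real \<Rightarrow>
   (real \<Rightarrow> real) \<Rightarrow> (real \<Rightarrow> real) \<Rightarrow> (real \<Rightarrow> real) \<Rightarrow> (real \<Rightarrow> 'a \<Rightarrow> real) \<Rightarrow> bool" where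
  "volterra_solution M F W T x0 K \<sigma> X \<longleftrightarrow>
     progressive F T X \<and>
     (AE \<omega> in M. continuous_on {0..T} (\<lambda>t. X t \<omega>)) \<and>
     (\<forall>t\<in>{0..T}. has_ito_integral M F W (\<lambda>s \<omega>. K (t - s) * \<sigma> (X s \<omega>)) t (\<lambda>\<omega>. X t \<omega> - x0 t))"

end

theory Submission
  imports Defs
begin

text \<open>
  A completely monotone kernel is non-negative and decreasing, and \<open>(a - b)\<^sup>2 \<le> a\<^sup>2 - b\<^sup>2\<close> for \<open>0 \<le> b \<le> a\<close>.
  Hence \<open>\<integral> (K (u + h) - K u)\<^sup>2 du \<le> \<integral>\<^sub>0\<^sup>h K\<^sup>2\<close>, which is at most a constant times \<open>\<parallel>K\<parallel>\<^sup>2 h powr (1 - 2/\<gamma>)\<close> by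
  Hoelder's inequality. With the moment inequality \<open>E \<bar>\<integral> H dW\<bar>\<^sup>q \<le> C E (\<integral> H\<^sup>2)\<^bsup>q/2\<^esup>\<close> and \<open>D = X - Y\<close>, a Gronwall
  argument gives \<open>E \<bar>D t\<bar>\<^sup>q \<le> C \<parallel>K1 - K2\<parallel>\<^sup>q\<close>, and then the kernel bound applied to \<open>K1 - K2\<close> and \<open>K2\<close> gives
  \<open>E \<bar>D t - D s\<bar>\<^sup>q \<le> C \<parallel>K1 - K2\<parallel>\<^sup>q \<bar>t - s\<bar> powr (q/2 - q/\<gamma>)\<close>. For large \<open>q\<close> the exponent of \<open>\<bar>t - s\<bar>\<close> is at
  least two, and Kolmogorov's chaining argument bounds the supremum over time.
\<close>

section \<open>Moments of step integrals\<close>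

text \<open>For fixed \<open>t\<close> a stochastic convolution is the value of a stochastic
  integral, but as a process in \<open>t\<close> it need not be a semimartingale, since the kernel
  moves with \<open>t\<close>. No maximal inequality for martingales applies, which is why the
  supremum is reached only through moments at fixed times and of increments. The Ito integral is a
  relation defined by limits in probability, so its moment inequality is proved for finite sums over
  a grid and carried to the limit by Fatou's lemma. The integrand of the difference is split as (K1
  - K2) \<sigma>(X) + K2 (\<sigma>(X) - \<sigma>(Y)): the small kernel meets a process with bounded
  moments, and the Lipschitz part feeds the Gronwall argument. Time increments of both summands
  occur, so the kernel estimate is applied to \<open>K2\<close> as well as to the difference. A
  solution carries no integrability by definition, so its moments are first bounded on events that
  decrease in time. The norm of \<open>K1 - K2\<close> is replaced by an arbitrary positive bound
  \<Lambda>, so that a vanishing difference is reached by letting \<Lambda> tend to zero.\<close>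

definition gauss_coeff :: "nat \<Rightarrow> real" where
  "gauss_coeff k = fact (2 * k) / (2 ^ k * fact k)"

lemma gauss_coeff_0 [simp]: "gauss_coeff 0 = 1"
  by (simp add: gauss_coeff_def)

lemma gauss_coeff_nonneg: "0 \<le> gauss_coeff k"
  by (simp add: gauss_coeff_def)

text \<open>This class is closed under sums and products, so the integrability conditions met in the
  moment expansions reduce to its generators: bounded coefficients and Gaussian increments.\<close>

definition all_moments :: "'a measure \<Rightarrow> ('a \<Rightarrow> real) \<Rightarrow> bool" where
  "all_moments M f \<longleftrightarrow> f \<in> borel_measurable M \<and> (\<forall>q::nat. integrable M (\<lambda>\<omega>. \<bar>f \<omega>\<bar> ^ q))"

lemma all_moments_integrable: "all_moments M f \<Longrightarrow> integrable M f"
  using integrable_abs_cancel[of M f] by (auto simp: all_moments_def dest: spec[of _ "1::nat"])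

lemma abs_add_power_le:
  fixes x y :: real
  assumes "0 \<le> x" "0 \<le> y"
  shows "(x + y) ^ q \<le> 2 ^ q * (x ^ q + y ^ q)"
proof -
  have "(x + y) ^ q \<le> (2 * max x y) ^ q" using assms by (intro power_mono) auto
  also have "\<dots> = 2 ^ q * max x y ^ q" by (rule power_mult_distrib)
  also have "\<dots> \<le> 2 ^ q * (x ^ q + y ^ q)"
    using assms by (intro mult_left_mono) (auto simp: max_def)
  finally show ?thesis .
qed

lemma all_moments_add:
  assumes "all_moments M f" "all_moments M g"
  shows "all_moments M (\<lambda>\<omega>. f \<omega> + g \<omega>)"
  unfolding all_moments_def
proof (intro conjI allI)
  have [measurable]: "f \<in> borel_measurable M" "g \<in> borel_measurable M"
    using assms by (auto simp: all_moments_def)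
  show "(\<lambda>\<omega>. f \<omega> + g \<omega>) \<in> borel_measurable M" by simp
  fix q :: nat
  show "integrable M (\<lambda>\<omega>. \<bar>f \<omega> + g \<omega>\<bar> ^ q)"
  proof (rule Bochner_Integration.integrable_bound)
    show "integrable M (\<lambda>\<omega>. 2 ^ q * (\<bar>f \<omega>\<bar> ^ q + \<bar>g \<omega>\<bar> ^ q))"
      using assms by (auto simp: all_moments_def)
    have "\<bar>x + y\<bar> ^ q \<le> 2 ^ q * (\<bar>x\<bar> ^ q + \<bar>y\<bar> ^ q)" for x y :: real
      by (rule order_trans[OF power_mono[OF abs_triangle_ineq] abs_add_power_le]) auto
    then show "AE \<omega> in M. norm (\<bar>f \<omega> + g \<omega>\<bar> ^ q) \<le> norm (2 ^ q * (\<bar>f \<omega>\<bar> ^ q + \<bar>g \<omega>\<bar> ^ q))"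
      by (intro AE_I2) (auto simp: abs_mult power_abs)
  qed measurable
qed

lemma all_moments_mult:
  assumes "all_moments M f" "all_moments M g"
  shows "all_moments M (\<lambda>\<omega>. f \<omega> * g \<omega>)"
  unfolding all_moments_def
proof (intro conjI allI)
  have [measurable]: "f \<in> borel_measurable M" "g \<in> borel_measurable M"
    using assms by (auto simp: all_moments_def)
  show "(\<lambda>\<omega>. f \<omega> * g \<omega>) \<in> borel_measurable M" by simp
  fix q :: nat
  show "integrable M (\<lambda>\<omega>. \<bar>f \<omega> * g \<omega>\<bar> ^ q)"
  proof (rule Bochner_Integration.integrable_bound)
    show "integrable M (\<lambda>\<omega>. \<bar>f \<omega>\<bar> ^ (2 * q) + \<bar>g \<omega>\<bar> ^ (2 * q))"
      using assms by (auto simp: all_moments_def)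
    have "\<bar>x * y\<bar> ^ q \<le> \<bar>x\<bar> ^ (2 * q) + \<bar>y\<bar> ^ (2 * q)" for x y :: real
    proof -
      have "2 * (\<bar>x\<bar>^q * \<bar>y\<bar>^q) \<le> (\<bar>x\<bar>^q)\<^sup>2 + (\<bar>y\<bar>^q)\<^sup>2"
        using sum_squares_bound[of "\<bar>x\<bar>^q" "\<bar>y\<bar>^q"] by simp
      moreover have "0 \<le> \<bar>x\<bar>^q * \<bar>y\<bar>^q" by simp
      ultimately have "\<bar>x\<bar>^q * \<bar>y\<bar>^q \<le> (\<bar>x\<bar>^q)\<^sup>2 + (\<bar>y\<bar>^q)\<^sup>2" by linarith
      then show ?thesis
        by (simp add: abs_mult power_mult_distrib power_mult[symmetric] mult.commute[of 2])
    qed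
    then show "AE \<omega> in M. norm (\<bar>f \<omega> * g \<omega>\<bar> ^ q) \<le> norm (\<bar>f \<omega>\<bar> ^ (2 * q) + \<bar>g \<omega>\<bar> ^ (2 * q))"
      by (intro AE_I2) (auto simp: power_abs)
  qed measurable
qed

lemma (in prob_space) all_moments_bounded:
  assumes "f \<in> borel_measurable M" "\<And>\<omega>. \<omega> \<in> space M \<Longrightarrow> \<bar>f \<omega>\<bar> \<le> B"
  shows "all_moments M f"
  unfolding all_moments_def
proof (intro conjI allI)
  fix q :: nat
  show "integrable M (\<lambda>\<omega>. \<bar>f \<omega>\<bar> ^ q)"
    by (rule integrable_const_bound[where B="B ^ q"])
       (use assms in \<open>auto intro!: AE_I2 power_mono simp: power_abs\<close>)
qed fact

lemma (in prob_space) all_moments_const: "all_moments M (\<lambda>_. c)"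
  by (rule all_moments_bounded[where B="\<bar>c\<bar>"]) auto

lemma (in prob_space) all_moments_power:
  "all_moments M f \<Longrightarrow> all_moments M (\<lambda>\<omega>. f \<omega> ^ n)"
  by (induction n) (auto intro: all_moments_mult all_moments_const)

lemma (in prob_space) all_moments_sum:
  "(\<And>i. i \<in> I \<Longrightarrow> all_moments M (f i)) \<Longrightarrow> all_moments M (\<lambda>\<omega>. \<Sum>i\<in>I. f i \<omega>)"
  by (induction I rule: infinite_finite_induct) (auto intro: all_moments_add all_moments_const)

section \<open>Gaussian increments and their independence of the past\<close>

context brownian_space
begin

lemma measurable_F_mono: "s \<le> t \<Longrightarrow> f \<in> measurable (F s) N \<Longrightarrow> f \<in> measurable (F t) N"
  using sets_F_mono[of s t] by (auto simp: measurable_def space_F)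

lemma measurable_F_M: "f \<in> measurable (F s) N \<Longrightarrow> f \<in> measurable M N"
  using subalgebra_F[of s] by (auto simp: measurable_def space_F subalgebra_def)

lemma sets_F_M: "A \<in> sets (F s) \<Longrightarrow> A \<in> sets M"
  using subalgebra_F[of s] by (auto simp: subalgebra_def)

lemma W_measurable: "0 \<le> t \<Longrightarrow> W t \<in> borel_measurable M"
  using W_adapted measurable_F_M by blast

lemma increment_power_distr:
  assumes "0 \<le> s" "s < t"
  shows "integrable M (\<lambda>\<omega>. \<bar>W t \<omega> - W s \<omega>\<bar> ^ k)"
    and "expectation (\<lambda>\<omega>. (W t \<omega> - W s \<omega>) ^ (2 * k)) = gauss_coeff k * (t - s) ^ k"
    and "expectation (\<lambda>\<omega>. (W t \<omega> - W s \<omega>) ^ (2 * k + 1)) = 0"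
proof -
  let ?\<sigma> = "sqrt (t - s)"
  note D = W_normal[OF assms]
  have pos: "0 < ?\<sigma>" using assms by simp
  show "integrable M (\<lambda>\<omega>. \<bar>W t \<omega> - W s \<omega>\<bar> ^ k)"
    using distributed_integrable[OF D, of "\<lambda>x. \<bar>x\<bar> ^ k"] integrable_normal_moment_abs[OF pos, of 0 k]
    by simp
  \<comment> \<open>\<open>gauss_coeff k\<close> is the double factorial (2k - 1)!!, the moment of
    order 2k of a standard normal variable.\<close>
  have "expectation (\<lambda>\<omega>. (W t \<omega> - W s \<omega>) ^ (2 * k)) = fact (2 * k) / ((2 / ?\<sigma>\<^sup>2)^k * fact k)"
    using distributed_integral[OF D, of "\<lambda>x. x ^ (2 * k)"] integral_normal_moment_even[OF pos, of 0 k]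
    by simp
  also have "\<dots> = gauss_coeff k * (t - s) ^ k"
    using assms by (simp add: gauss_coeff_def power_divide)
  finally show "expectation (\<lambda>\<omega>. (W t \<omega> - W s \<omega>) ^ (2 * k)) = gauss_coeff k * (t - s) ^ k" .
  show "expectation (\<lambda>\<omega>. (W t \<omega> - W s \<omega>) ^ (2 * k + 1)) = 0"
    using distributed_integral[OF D, of "\<lambda>x. x ^ (2 * k + 1)"] integral_normal_moment_odd[OF pos, of 0 k]
    by simp
qed

lemma all_moments_increment: "0 \<le> s \<Longrightarrow> s < t \<Longrightarrow> all_moments M (\<lambda>\<omega>. W t \<omega> - W s \<omega>)"
  using increment_power_distr(1) W_measurable by (auto simp: all_moments_def)

lemma indep_var_increment:
  assumes "0 \<le> s" "s < t" "U \<in> borel_measurable (F s)"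
  shows "indep_var borel U borel (\<lambda>\<omega>. W t \<omega> - W s \<omega>)"
  unfolding indep_var_eq
proof (intro conjI)
  show [measurable]: "random_variable borel U" using assms measurable_F_M by blast
  show [measurable]: "random_variable borel (\<lambda>\<omega>. W t \<omega> - W s \<omega>)"
    using W_measurable assms by auto
  let ?V = "\<lambda>\<omega>. W t \<omega> - W s \<omega>"
  have sub: "{U -` A \<inter> space M | A. A \<in> sets borel} \<subseteq> sets (F s)"
    using measurable_sets[OF assms(3)] by (auto simp: space_F)
  have ind: "indep_set {U -` A \<inter> space M | A. A \<in> sets borel} {?V -` A \<inter> space M | A. A \<in> sets borel}"
    using W_indep[OF assms(1,2)] sub unfolding indep_sets2_eq by blast
  show "indep_set (sigma_sets (space M) {U -` A \<inter> space M | A. A \<in> sets borel})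
     (sigma_sets (space M) {?V -` A \<inter> space M | A. A \<in> sets borel})"
  proof (rule indep_set_sigma_sets[OF ind])
    show "Int_stable {X -` A \<inter> space M | A. A \<in> sets borel}" for X :: "'a \<Rightarrow> real"
    proof (rule Int_stableI, safe)
      fix A B :: "real set" assume "A \<in> sets borel" "B \<in> sets borel"
      then show "\<exists>C. (X -` A \<inter> space M) \<inter> (X -` B \<inter> space M) = X -` C \<inter> space M \<and> C \<in> sets borel"
        by (intro exI[of _ "A \<inter> B"]) auto
    qed
    then show "Int_stable {?V -` A \<inter> space M | A. A \<in> sets borel}" .
  qed
qed

lemma expectation_mult_increment:
  assumes "0 \<le> s" "s < t" "U \<in> borel_measurable (F s)" "integrable M U"
  shows "expectation (\<lambda>\<omega>. U \<omega> * (W t \<omega> - W s \<omega>) ^ k)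
    = expectation U * expectation (\<lambda>\<omega>. (W t \<omega> - W s \<omega>) ^ k)"
proof -
  have "indep_var borel (id \<circ> U) borel ((\<lambda>x. x ^ k) \<circ> (\<lambda>\<omega>. W t \<omega> - W s \<omega>))"
    by (rule indep_var_compose[OF indep_var_increment]) (use assms in auto)
  then show ?thesis
    using indep_var_lebesgue_integral[of U "\<lambda>\<omega>. (W t \<omega> - W s \<omega>) ^ k"] assms
      all_moments_integrable[OF all_moments_power[OF all_moments_increment[OF assms(1,2)]]]
    by (simp add: comp_def)
qed

text \<open>Odd moments of the increment vanish, so only even powers survive in the binomial expansion.\<close>

lemma expectation_step:
  assumes st: "0 \<le> s" "s < t"
    and meas: "N \<in> borel_measurable (F s)" "c \<in> borel_measurable (F s)" "b \<in> borel_measurable (F s)"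
    and mom: "all_moments M N" "all_moments M c" "all_moments M b"
  shows "expectation (\<lambda>\<omega>. b \<omega> * (N \<omega> + c \<omega> * (W t \<omega> - W s \<omega>)) ^ (2 * m)) =
    (\<Sum>k\<le>m. real (2 * m choose (2 * k)) * gauss_coeff k *
       expectation (\<lambda>\<omega>. b \<omega> * (N \<omega> ^ (2 * m - 2 * k) * ((c \<omega>)\<^sup>2 * (t - s)) ^ k)))"
proof -
  let ?V = "\<lambda>\<omega>. W t \<omega> - W s \<omega>"
  define e where "e k = real (2 * m choose k) * expectation (\<lambda>\<omega>. b \<omega> * N \<omega> ^ (2 * m - k) * c \<omega> ^ k)
      * expectation (\<lambda>\<omega>. ?V \<omega> ^ k)" for k
  note momV = all_moments_increment[OF st]
  note [measurable] = meas
  note mom_intros = all_moments_mult all_moments_power all_moments_const mom momV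
  have "expectation (\<lambda>\<omega>. b \<omega> * (N \<omega> + c \<omega> * ?V \<omega>) ^ (2 * m))
      = expectation (\<lambda>\<omega>. \<Sum>k\<le>2 * m. real (2 * m choose k) * ((b \<omega> * N \<omega> ^ (2 * m - k) * c \<omega> ^ k) * ?V \<omega> ^ k))"
    by (subst add.commute, subst binomial_ring)
       (simp add: sum_distrib_left power_mult_distrib mult_ac)
  also have "\<dots> = (\<Sum>k\<le>2 * m. real (2 * m choose k) *
      expectation (\<lambda>\<omega>. (b \<omega> * N \<omega> ^ (2 * m - k) * c \<omega> ^ k) * ?V \<omega> ^ k))"
    by (subst Bochner_Integration.integral_sum)
       (auto intro!: all_moments_integrable mom_intros integral_mult_right_zero
          simp del: mult.assoc)
  also have "\<dots> = (\<Sum>k\<le>2 * m. e k)"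
    unfolding e_def
  proof (intro sum.cong refl)
    fix k
    have "expectation (\<lambda>\<omega>. (b \<omega> * N \<omega> ^ (2 * m - k) * c \<omega> ^ k) * ?V \<omega> ^ k) =
        expectation (\<lambda>\<omega>. b \<omega> * N \<omega> ^ (2 * m - k) * c \<omega> ^ k) * expectation (\<lambda>\<omega>. ?V \<omega> ^ k)"
      by (intro expectation_mult_increment st all_moments_integrable mom_intros) measurable
    then show "real (2 * m choose k) * expectation (\<lambda>\<omega>. (b \<omega> * N \<omega> ^ (2 * m - k) * c \<omega> ^ k) * ?V \<omega> ^ k)
       = real (2 * m choose k) * expectation (\<lambda>\<omega>. b \<omega> * N \<omega> ^ (2 * m - k) * c \<omega> ^ k) * expectation (\<lambda>\<omega>. ?V \<omega> ^ k)"
      by simp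
  qed
  also have "\<dots> = (\<Sum>k\<in>(\<lambda>k. 2 * k) ` {..m}. e k)"
  proof (rule sum.mono_neutral_right)
    show "\<forall>k\<in>{..2 * m} - (\<lambda>k. 2 * k) ` {..m}. e k = 0"
    proof
      fix k assume k: "k \<in> {..2 * m} - (\<lambda>k. 2 * k) ` {..m}"
      have "odd k"
      proof
        assume "even k"
        then obtain j where "k = 2 * j" by (elim evenE)
        with k show False by auto
      qed
      then obtain j where "k = 2 * j + 1" by (elim oddE)
      then show "e k = 0" using increment_power_distr(3)[OF st, of j] by (simp add: e_def)
    qed
  qed auto
  also have "\<dots> = (\<Sum>k\<le>m. e (2 * k))"
    by (subst sum.reindex) (auto simp: inj_on_def)
  also have "\<dots> = (\<Sum>k\<le>m. real (2 * m choose (2 * k)) * gauss_coeff k *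
       expectation (\<lambda>\<omega>. b \<omega> * (N \<omega> ^ (2 * m - 2 * k) * ((c \<omega>)\<^sup>2 * (t - s)) ^ k)))"
    unfolding e_def increment_power_distr(2)[OF st]
  proof (intro sum.cong refl)
    fix k
    have "expectation (\<lambda>\<omega>. b \<omega> * (N \<omega> ^ (2 * m - 2 * k) * ((c \<omega>)\<^sup>2 * (t - s)) ^ k))
      = expectation (\<lambda>\<omega>. (b \<omega> * N \<omega> ^ (2 * m - 2 * k) * c \<omega> ^ (2 * k)) * (t - s) ^ k)"
      by (simp add: power_mult_distrib power_mult[symmetric] mult_ac)
    then show "real (2 * m choose (2 * k)) * expectation (\<lambda>\<omega>. b \<omega> * N \<omega> ^ (2 * m - 2 * k) * c \<omega> ^ (2 * k)) *
         (gauss_coeff k * (t - s) ^ k) = real (2 * m choose (2 * k)) * gauss_coeff k *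
       expectation (\<lambda>\<omega>. b \<omega> * (N \<omega> ^ (2 * m - 2 * k) * ((c \<omega>)\<^sup>2 * (t - s)) ^ k))"
      by simp
  qed
  finally show ?thesis .
qed

end

section \<open>Even moments of step integrals\<close>

lemma sum_power_le_power_sum:
  fixes b :: "'i \<Rightarrow> real"
  assumes "finite I" "\<And>i. i \<in> I \<Longrightarrow> 0 \<le> b i" "1 \<le> k"
  shows "(\<Sum>i\<in>I. b i ^ k) \<le> (\<Sum>i\<in>I. b i) ^ k"
proof -
  let ?s = "\<Sum>i\<in>I. b i"
  have "(\<Sum>i\<in>I. b i ^ k) \<le> (\<Sum>i\<in>I. b i * ?s ^ (k - 1))"
  proof (rule sum_mono)
    fix i assume i: "i \<in> I"
    have "b i ^ k = b i * b i ^ (k - 1)" using assms(3) by (cases k) auto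
    also have "\<dots> \<le> b i * ?s ^ (k - 1)"
      using i assms by (intro mult_left_mono power_mono member_le_sum) auto
    finally show "b i ^ k \<le> b i * ?s ^ (k - 1)" .
  qed
  also have "\<dots> = ?s ^ k"
    using assms(3) by (cases k) (auto simp: sum_distrib_right[symmetric])
  finally show ?thesis .
qed

text \<open>A case split at y = \<delta> x stands in for the weighted Young inequality. If
  \<open>y\<close> is small, y^k yields a factor \<delta> because k is at least one; otherwise
  \<open>x\<close> is at most y / \<delta>. Neither constant depends on \<open>k\<close>, so all
  terms of the later sum over \<open>k\<close> share one bound.\<close>

lemma young_power:
  fixes x y \<delta> :: real
  assumes "0 \<le> x" "0 \<le> y" "0 < \<delta>" "\<delta> \<le> 1" "1 \<le> k" "k \<le> m"
  shows "x ^ (m - k) * y ^ k \<le> \<delta> * x ^ m + inverse \<delta> ^ m * y ^ m"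
proof (cases "y \<le> \<delta> * x")
  case True
  have "x ^ (m - k) * y ^ k \<le> x ^ (m - k) * (\<delta> * x) ^ k"
    using True assms by (intro mult_left_mono power_mono) auto
  also have "\<dots> = \<delta> ^ k * x ^ m"
    using assms by (simp add: power_mult_distrib power_add[symmetric])
  also have "\<dots> \<le> \<delta> ^ 1 * x ^ m"
    using assms by (intro mult_right_mono power_decreasing) auto
  finally show ?thesis using assms by (simp add: add_increasing2)
next
  case False
  then have "x \<le> inverse \<delta> * y" using assms by (simp add: field_simps)
  then have "x ^ (m - k) * y ^ k \<le> (inverse \<delta> * y) ^ (m - k) * y ^ k"
    using assms by (intro mult_right_mono power_mono) auto
  also have "\<dots> = inverse \<delta> ^ (m - k) * y ^ m"
    using assms by (simp only: power_mult_distrib mult.assoc power_add[symmetric]) simp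
  also have "\<dots> \<le> inverse \<delta> ^ m * y ^ m"
    using assms by (intro mult_right_mono power_increasing) (auto simp: one_le_inverse_iff)
  finally show ?thesis using assms by (simp add: add_increasing)
qed

text \<open>With \<delta> = 1 / (2\<kappa> + 1) in Young's inequality, at most half of the moment to
  be estimated reappears on the right; absorbing it leaves the factor 2\<kappa>
  \<delta>^(-m).\<close>

definition moment_const :: "nat \<Rightarrow> real" where
  "moment_const m = (let \<kappa> = \<Sum>k=1..m. real (2 * m choose (2 * k)) * gauss_coeff k
     in 2 * \<kappa> * (2 * \<kappa> + 1) ^ m)"

lemma moment_const_nonneg: "0 \<le> moment_const m"
  unfolding moment_const_def Let_def
  by (intro mult_nonneg_nonneg zero_le_power add_nonneg_nonneg sum_nonneg gauss_coeff_nonneg) auto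

context brownian_space
begin

text \<open>The integration by parts
  \<open>E N\<^sup>2\<^sup>m = c E \<integral> N\<^sup>2\<^sup>m\<^sup>-\<^sup>2 dA \<le> c E (N\<^sup>2\<^sup>m\<^sup>-\<^sup>2 A)\<close> at the terminal time, where the inequality holds because
  \<open>N\<^sup>2\<^sup>m\<^sup>-\<^sup>2\<close> is a submartingale; Young's inequality then absorbs \<open>N\<close>.\<close>

lemma step_integral_moment:
  fixes u :: "nat \<Rightarrow> real" and c :: "nat \<Rightarrow> 'a \<Rightarrow> real" and n m :: nat
  defines "N \<equiv> \<lambda>k \<omega>. \<Sum>j<k. c j \<omega> * (W (u (Suc j)) \<omega> - W (u j) \<omega>)"
  assumes u: "0 \<le> u 0" "\<And>j. j < n \<Longrightarrow> u j < u (Suc j)"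
    and c_meas: "\<And>j. j < n \<Longrightarrow> c j \<in> borel_measurable (F (u j))"
    and c_bdd: "\<And>j. j < n \<Longrightarrow> \<exists>B. \<forall>\<omega>\<in>space M. \<bar>c j \<omega>\<bar> \<le> B"
    and m: "1 \<le> m"
  shows "integrable M (\<lambda>\<omega>. N n \<omega> ^ (2 * m))"
    and "integrable M (\<lambda>\<omega>. (\<Sum>j<n. (c j \<omega>)\<^sup>2 * (u (Suc j) - u j)) ^ m)"
    and "expectation (\<lambda>\<omega>. N n \<omega> ^ (2 * m))
      \<le> moment_const m * expectation (\<lambda>\<omega>. (\<Sum>j<n. (c j \<omega>)\<^sup>2 * (u (Suc j) - u j)) ^ m)"
proof -
  define A where "A \<omega> = (\<Sum>j<n. (c j \<omega>)\<^sup>2 * (u (Suc j) - u j))" for \<omega>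
  have u_le: "i \<le> j \<Longrightarrow> j \<le> n \<Longrightarrow> u i \<le> u j" for i j
  proof (induction j rule: dec_induct)
    case (step j)
    then show ?case using u(2)[of j] by auto
  qed simp
  have u_nonneg: "j \<le> n \<Longrightarrow> 0 \<le> u j" for j
    using u_le[of 0 j] u(1) by simp
  have c_mom: "all_moments M (c j)" if "j < n" for j
    using c_bdd[OF that] measurable_F_M[OF c_meas[OF that]] by (auto intro: all_moments_bounded)
  have N_mom: "all_moments M (N k)" if "k \<le> n" for k
    unfolding N_def
    by (intro all_moments_sum all_moments_mult c_mom all_moments_increment)
       (use that u u_nonneg in auto)
  have N_meas: "N k \<in> borel_measurable (F (u k))" if "k \<le> n" for k
    unfolding N_def
  proof (intro borel_measurable_sum borel_measurable_times borel_measurable_diff)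
    fix j assume j: "j \<in> {..<k}"
    then have le: "j < n" "Suc j \<le> n" "u j \<le> u k" "u (Suc j) \<le> u k"
      using that u_le[of j k] u_le[of "Suc j" k] by auto
    show "c j \<in> borel_measurable (F (u k))"
      using measurable_F_mono[OF le(3)] c_meas le by blast
    show "W (u (Suc j)) \<in> borel_measurable (F (u k))" "W (u j) \<in> borel_measurable (F (u k))"
      using measurable_F_mono[OF le(4) W_adapted] measurable_F_mono[OF le(3) W_adapted] u_nonneg le
      by auto
  qed
  have N_Suc: "N (Suc k) = (\<lambda>\<omega>. N k \<omega> + c k \<omega> * (W (u (Suc k)) \<omega> - W (u k) \<omega>))" for k
    by (simp add: N_def)
  define \<beta> where "\<beta> j \<omega> = (c j \<omega>)\<^sup>2 * (u (Suc j) - u j)" for j \<omega>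
  have \<beta>_nonneg: "j < n \<Longrightarrow> 0 \<le> \<beta> j \<omega>" for j \<omega>
    using u(2)[of j] by (simp add: \<beta>_def)
  have \<beta>_mom: "j < n \<Longrightarrow> all_moments M (\<beta> j)" for j
    unfolding \<beta>_def by (intro all_moments_mult all_moments_power all_moments_const c_mom)
  have \<beta>_meas: "j < n \<Longrightarrow> \<beta> j \<in> borel_measurable (F (u j))" for j
    using c_meas[of j] unfolding \<beta>_def by measurable
  note step = expectation_step[OF u_nonneg u(2) N_meas c_meas, folded N_Suc \<beta>_def]
  note mom = all_moments_mult all_moments_power all_moments_const N_mom \<beta>_mom all_moments_sum
  \<comment> \<open>Nonnegative \<open>F (u j)\<close>-measurable weights \<open>b\<close> play the
    part of conditioning on the past. In the expansion of the next step all summands are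
    nonnegative, and the summand of index zero is the moment one step earlier.\<close>
  have submart: "expectation (\<lambda>\<omega>. b \<omega> * N j \<omega> ^ (2 * r)) \<le> expectation (\<lambda>\<omega>. b \<omega> * N k \<omega> ^ (2 * r))"
    if "j \<le> k" "k \<le> n" "b \<in> borel_measurable (F (u j))" "all_moments M b" "\<And>\<omega>. 0 \<le> b \<omega>"
    for b j k r
    using that(1,2)
  proof (induction k rule: dec_induct)
    case (step k)
    then have k: "k < n" by simp
    have bk: "b \<in> borel_measurable (F (u k))"
      using measurable_F_mono[OF u_le[of j k]] that(3) step by auto
    have "expectation (\<lambda>\<omega>. b \<omega> * N k \<omega> ^ (2 * r)) =
        (\<Sum>i\<in>{0}. real (2 * r choose (2 * i)) * gauss_coeff i *
           expectation (\<lambda>\<omega>. b \<omega> * (N k \<omega> ^ (2 * r - 2 * i) * \<beta> k \<omega> ^ i)))"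
      by simp
    also have "\<dots> \<le> (\<Sum>i\<le>r. real (2 * r choose (2 * i)) * gauss_coeff i *
           expectation (\<lambda>\<omega>. b \<omega> * (N k \<omega> ^ (2 * r - 2 * i) * \<beta> k \<omega> ^ i)))"
    proof (intro sum_mono2 mult_nonneg_nonneg gauss_coeff_nonneg)
      fix i
      have "0 \<le> b \<omega> * (N k \<omega> ^ (2 * r - 2 * i) * \<beta> k \<omega> ^ i)" for \<omega>
        using that(5)[of \<omega>] \<beta>_nonneg[OF k, of \<omega>]
        by (intro mult_nonneg_nonneg zero_le_power zero_le_even_power) auto
      then show "0 \<le> expectation (\<lambda>\<omega>. b \<omega> * (N k \<omega> ^ (2 * r - 2 * i) * \<beta> k \<omega> ^ i))"
        by simp
    qed auto
    also have "\<dots> = expectation (\<lambda>\<omega>. b \<omega> * N (Suc k) \<omega> ^ (2 * r))"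
      unfolding \<beta>_def N_Suc
      by (rule expectation_step[symmetric])
         (use k u u_nonneg N_meas c_meas bk N_mom c_mom that in auto)
    finally show ?case using step by simp
  qed simp
  define q where "q k = real (2 * m choose (2 * k)) * gauss_coeff k" for k
  have q_nonneg: "0 \<le> q k" for k by (simp add: q_def gauss_coeff_nonneg)
  define \<kappa> where "\<kappa> = (\<Sum>k=1..m. q k)"
  have \<kappa>: "0 \<le> \<kappa>" unfolding \<kappa>_def by (intro sum_nonneg q_nonneg)
  define \<delta> where "\<delta> = inverse (2 * \<kappa> + 1)"
  have \<delta>: "0 < \<delta>" "\<delta> \<le> 1" "2 * \<kappa> * \<delta> \<le> 1"
    using \<kappa> by (auto simp: \<delta>_def field_simps)
  have A_eq: "A \<omega> = (\<Sum>j<n. \<beta> j \<omega>)" for \<omega> by (simp add: A_def \<beta>_def)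
  have A_mom: "all_moments M A"
    unfolding A_eq[abs_def] by (intro mom) auto
  have int: "integrable M (\<lambda>\<omega>. N n \<omega> ^ (2 * m))" "integrable M (\<lambda>\<omega>. A \<omega> ^ m)"
    by (intro all_moments_integrable mom A_mom order_refl)+
  \<comment> \<open>The summand of index zero cancels the earlier moment. In the others
    \<open>N j\<close> is replaced by the terminal \<open>N n\<close> through the submartingale
    inequality with weight \<open>\<beta> j ^ k\<close>.\<close>
  have incr: "expectation (\<lambda>\<omega>. N (Suc j) \<omega> ^ (2 * m)) - expectation (\<lambda>\<omega>. N j \<omega> ^ (2 * m))
      \<le> (\<Sum>k=1..m. q k * expectation (\<lambda>\<omega>. \<beta> j \<omega> ^ k * N n \<omega> ^ (2 * (m - k))))" if j: "j < n" for j
  proof -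
    have "expectation (\<lambda>\<omega>. N (Suc j) \<omega> ^ (2 * m))
        = (\<Sum>k\<le>m. q k * expectation (\<lambda>\<omega>. \<beta> j \<omega> ^ k * N j \<omega> ^ (2 * (m - k))))"
      unfolding \<beta>_def N_Suc q_def
      using expectation_step[of "u j" "u (Suc j)" "N j" "c j" "\<lambda>_. 1" m]
        j u u_nonneg N_meas c_meas N_mom c_mom all_moments_const
      by (simp add: mult.commute diff_mult_distrib diff_mult_distrib2)
    also have "{..m} = insert 0 {1..m}" by auto
    also have "(\<Sum>k\<in>insert 0 {1..m}. q k * expectation (\<lambda>\<omega>. \<beta> j \<omega> ^ k * N j \<omega> ^ (2 * (m - k))))
        = expectation (\<lambda>\<omega>. N j \<omega> ^ (2 * m))
          + (\<Sum>k=1..m. q k * expectation (\<lambda>\<omega>. \<beta> j \<omega> ^ k * N j \<omega> ^ (2 * (m - k))))"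
      by (subst sum.insert) (auto simp: q_def)
    also have "\<dots> \<le> expectation (\<lambda>\<omega>. N j \<omega> ^ (2 * m))
          + (\<Sum>k=1..m. q k * expectation (\<lambda>\<omega>. \<beta> j \<omega> ^ k * N n \<omega> ^ (2 * (m - k))))"
      using j \<beta>_meas[OF j] \<beta>_nonneg[OF j]
      by (intro add_left_mono sum_mono mult_left_mono q_nonneg submart mom) auto
    finally show ?thesis by simp
  qed
  have "expectation (\<lambda>\<omega>. N n \<omega> ^ (2 * m))
      = (\<Sum>j<n. expectation (\<lambda>\<omega>. N (Suc j) \<omega> ^ (2 * m)) - expectation (\<lambda>\<omega>. N j \<omega> ^ (2 * m)))"
    using m by (subst sum_lessThan_telescope) (simp add: N_def)
  also have "\<dots> \<le> (\<Sum>j<n. \<Sum>k=1..m. q k * expectation (\<lambda>\<omega>. \<beta> j \<omega> ^ k * N n \<omega> ^ (2 * (m - k))))"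
    by (intro sum_mono incr) auto
  also have "\<dots> = (\<Sum>k=1..m. q k * expectation (\<lambda>\<omega>. (\<Sum>j<n. \<beta> j \<omega> ^ k) * N n \<omega> ^ (2 * (m - k))))"
  proof (subst sum.swap, intro sum.cong refl)
    fix k
    have "(\<Sum>j<n. expectation (\<lambda>\<omega>. \<beta> j \<omega> ^ k * N n \<omega> ^ (2 * (m - k))))
        = expectation (\<lambda>\<omega>. (\<Sum>j<n. \<beta> j \<omega> ^ k) * N n \<omega> ^ (2 * (m - k)))"
      unfolding sum_distrib_right
      by (intro Bochner_Integration.integral_sum[symmetric] all_moments_integrable mom) auto
    then show "(\<Sum>j<n. q k * expectation (\<lambda>\<omega>. \<beta> j \<omega> ^ k * N n \<omega> ^ (2 * (m - k))))
        = q k * expectation (\<lambda>\<omega>. (\<Sum>j<n. \<beta> j \<omega> ^ k) * N n \<omega> ^ (2 * (m - k)))"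
      by (simp add: sum_distrib_left[symmetric])
  qed
  \<comment> \<open>The k-th powers of the increments of \<open>A\<close> sum to at most
    \<open>A ^ k\<close>, after which Young's inequality separates \<open>A\<close> from
    \<open>N n\<close>.\<close>
  also have "\<dots> \<le> (\<Sum>k=1..m. q k *
      expectation (\<lambda>\<omega>. \<delta> * N n \<omega> ^ (2 * m) + inverse \<delta> ^ m * A \<omega> ^ m))"
  proof (intro sum_mono mult_left_mono q_nonneg integral_mono)
    fix k \<omega> assume k: "k \<in> {1..m}"
    have "(\<Sum>j<n. \<beta> j \<omega> ^ k) * N n \<omega> ^ (2 * (m - k)) \<le> A \<omega> ^ k * ((N n \<omega>)\<^sup>2) ^ (m - k)"
      unfolding A_eq power_mult using k \<beta>_nonneg
      by (intro mult_right_mono sum_power_le_power_sum) auto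
    also have "\<dots> \<le> \<delta> * ((N n \<omega>)\<^sup>2) ^ m + inverse \<delta> ^ m * A \<omega> ^ m"
      using young_power[of "(N n \<omega>)\<^sup>2" "A \<omega>" \<delta> k m] \<delta> k \<beta>_nonneg
      by (auto simp: A_eq mult.commute intro!: sum_nonneg)
    finally show "(\<Sum>j<n. \<beta> j \<omega> ^ k) * N n \<omega> ^ (2 * (m - k))
        \<le> \<delta> * N n \<omega> ^ (2 * m) + inverse \<delta> ^ m * A \<omega> ^ m"
      by (simp add: power_mult)
  next
    show "integrable M (\<lambda>\<omega>. (\<Sum>j<n. \<beta> j \<omega> ^ k) * N n \<omega> ^ (2 * (m - k)))" for k
      by (intro all_moments_integrable mom) auto
    show "integrable M (\<lambda>\<omega>. \<delta> * N n \<omega> ^ (2 * m) + inverse \<delta> ^ m * A \<omega> ^ m)"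
      using int by auto
  qed
  also have "\<dots> = \<kappa> * (\<delta> * expectation (\<lambda>\<omega>. N n \<omega> ^ (2 * m))
      + inverse \<delta> ^ m * expectation (\<lambda>\<omega>. A \<omega> ^ m))"
    using int by (simp add: sum_distrib_right[symmetric] \<kappa>_def)
  finally have "2 * expectation (\<lambda>\<omega>. N n \<omega> ^ (2 * m))
      \<le> 2 * \<kappa> * \<delta> * expectation (\<lambda>\<omega>. N n \<omega> ^ (2 * m))
        + 2 * \<kappa> * inverse \<delta> ^ m * expectation (\<lambda>\<omega>. A \<omega> ^ m)"
    by (simp add: algebra_simps)
  moreover have "2 * \<kappa> * \<delta> * expectation (\<lambda>\<omega>. N n \<omega> ^ (2 * m)) \<le> 1 * expectation (\<lambda>\<omega>. N n \<omega> ^ (2 * m))"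
    using \<delta> by (intro mult_right_mono) auto
  moreover have "moment_const m = 2 * \<kappa> * inverse \<delta> ^ m"
    by (simp add: moment_const_def Let_def \<kappa>_def q_def \<delta>_def)
  ultimately have "expectation (\<lambda>\<omega>. N n \<omega> ^ (2 * m)) \<le> moment_const m * expectation (\<lambda>\<omega>. A \<omega> ^ m)"
    by simp
  then show "integrable M (\<lambda>\<omega>. N n \<omega> ^ (2 * m))"
    and "integrable M (\<lambda>\<omega>. (\<Sum>j<n. (c j \<omega>)\<^sup>2 * (u (Suc j) - u j)) ^ m)"
    and "expectation (\<lambda>\<omega>. N n \<omega> ^ (2 * m))
      \<le> moment_const m * expectation (\<lambda>\<omega>. (\<Sum>j<n. (c j \<omega>)\<^sup>2 * (u (Suc j) - u j)) ^ m)"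
    using int by (simp_all add: A_def)
qed

end

section \<open>Refining elementary processes\<close>

text \<open>Strict increase is what the Gaussian increments ask for, and the clause on
  \<open>p\<close> says that no prescribed point is interior to a cell.\<close>

lemma finite_set_enumeration:
  fixes P :: "real set"
  assumes "finite P" "0 \<in> P" "t \<in> P" "P \<subseteq> {0..t}"
  obtains u :: "nat \<Rightarrow> real" and N :: nat
    where "u 0 = 0" "u N = t" "\<And>j. j < N \<Longrightarrow> u j < u (Suc j)"
      "\<And>j p. j < N \<Longrightarrow> p \<in> P \<Longrightarrow> p < u (Suc j) \<Longrightarrow> p \<le> u j"
      "\<And>j. j \<le> N \<Longrightarrow> u j \<in> P"
proof -
  define xs where "xs = sorted_list_of_set P"
  have xs: "sorted_wrt (<) xs" "set xs = P" using assms by (auto simp: xs_def)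
  have ne: "0 < length xs" using xs assms by (cases xs) auto
  define N where "N = length xs - 1"
  have less: "i < j \<Longrightarrow> j \<le> N \<Longrightarrow> xs ! i < xs ! j" for i j
    using sorted_wrt_nth_less[OF xs(1)] ne by (auto simp: N_def)
  have mem: "xs ! j \<in> P" if "j \<le> N" for j
  proof -
    have "j < length xs" using that ne unfolding N_def by linarith
    then show ?thesis using xs(2) nth_mem by blast
  qed
  have ex: "\<exists>j\<le>N. p = xs ! j" if "p \<in> P" for p
    using that xs(2) ne by (metis N_def One_nat_def Suc_pred in_set_conv_nth less_Suc_eq_le)
  show thesis
  proof (rule that[of "\<lambda>j. xs ! j" N])
    obtain j where j: "j \<le> N" "0 = xs ! j" using ex assms by blast
    have "0 \<le> xs ! 0" using mem[of 0] assms(4) by force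
    then show "xs ! 0 = 0" using less[of 0 j] j by (cases "j = 0") auto
    obtain i where i: "i \<le> N" "t = xs ! i" using ex assms by blast
    have "xs ! N \<le> t" using mem[of N] assms(4) by force
    then show "xs ! N = t" using less[of i N] i by (cases "i = N") auto
    show "xs ! j < xs ! Suc j" if "j < N" for j using that less by auto
    show "p \<le> xs ! j" if p: "j < N" "p \<in> P" "p < xs ! Suc j" for j p
    proof -
      obtain i where i: "i \<le> N" "p = xs ! i" using ex[OF p(2)] by blast
      have "i \<le> j"
      proof (rule ccontr)
        assume "\<not> i \<le> j"
        then consider "i = Suc j" | "Suc j < i" by linarith
        then have "xs ! Suc j \<le> xs ! i" using less[of "Suc j" i] i(1) by cases auto
        then show False using that(3) i(2) by simp
      qed
      then consider "i = j" | "i < j" by linarith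
      then show ?thesis using less[of i j] i(2) that(1) by cases auto
    qed
  qed (use mem in auto)
qed

text \<open>No endpoint of an interval of \<open>S\<close> lies strictly between two neighbouring
  grid points. The implications leave endpoints beyond the last grid point unconstrained, as
  elementary processes may extend past the time horizon.\<close>

definition aligned :: "(nat \<Rightarrow> real) \<Rightarrow> nat \<Rightarrow> 'a elementary \<Rightarrow> bool" where
  "aligned u N S \<longleftrightarrow> (\<forall>(a, b, \<xi>)\<in>set S. \<forall>j<N.
     (a < u (Suc j) \<longrightarrow> a \<le> u j) \<and> (b < u (Suc j) \<longrightarrow> b \<le> u j))"

lemma aligned_grid_exists:
  fixes S :: "'a elementary"
  assumes t: "0 \<le> t" and \<epsilon>: "0 < \<epsilon>" and nonneg: "\<And>a b \<xi>. (a, b, \<xi>) \<in> set S \<Longrightarrow> 0 \<le> a \<and> a \<le> b"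
  obtains u N where "u 0 = 0" "u N = t" "\<And>j. j < N \<Longrightarrow> u j < u (Suc j)"
    "\<And>j. j < N \<Longrightarrow> u (Suc j) - u j \<le> \<epsilon>" "aligned u N S"
proof -
  \<comment> \<open>Enough multiples of \<epsilon> to pass \<open>t\<close>; together with the
    endpoints of \<open>S\<close> in [0, t] they form the grid.\<close>
  define K where "K = Suc (nat \<lceil>t / \<epsilon>\<rceil>)"
  define P where "P = {0, t} \<union> ({a. \<exists>b \<xi>. (a, b, \<xi>) \<in> set S} \<inter> {0..t})
      \<union> ({b. \<exists>a \<xi>. (a, b, \<xi>) \<in> set S} \<inter> {0..t}) \<union> (\<lambda>k. min t (real k * \<epsilon>)) ` {..K}"
  have "{a. \<exists>b \<xi>. (a, b, \<xi>) \<in> set S} = fst ` set S"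
    "{b. \<exists>a \<xi>. (a, b, \<xi>) \<in> set S} = (\<lambda>x. fst (snd x)) ` set S" by force+
  then have "finite P" unfolding P_def by simp
  moreover have "0 \<in> P" "t \<in> P" "P \<subseteq> {0..t}" using t \<epsilon> by (auto simp: P_def)
  ultimately obtain u N where u: "u 0 = 0" "u N = t" "\<And>j. j < N \<Longrightarrow> u j < u (Suc j)"
      "\<And>j p. j < N \<Longrightarrow> p \<in> P \<Longrightarrow> p < u (Suc j) \<Longrightarrow> p \<le> u j" "\<And>j. j \<le> N \<Longrightarrow> u j \<in> P"
    using finite_set_enumeration by blast
  have range: "0 \<le> u j" "u j \<le> t" if "j \<le> N" for j
    using u(5)[OF that] \<open>P \<subseteq> {0..t}\<close> by auto
  show thesis
  proof (rule that[OF u(1-3)])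
    show "u (Suc j) - u j \<le> \<epsilon>" if j: "j < N" for j
    proof (rule ccontr)
      assume *: "\<not> u (Suc j) - u j \<le> \<epsilon>"
      \<comment> \<open>The first multiple of \<epsilon> strictly after \<open>u j\<close>. If the
        cell were longer than \<epsilon>, this multiple would be a grid point strictly inside
        it.\<close>
      define k where "k = nat \<lfloor>u j / \<epsilon>\<rfloor> + 1"
      have uj: "0 \<le> u j" "u j \<le> t" "u (Suc j) \<le> t" using range j by auto
      then have k_eq: "real k = of_int \<lfloor>u j / \<epsilon>\<rfloor> + 1" using \<epsilon> by (simp add: k_def)
      have "u j / \<epsilon> < real k" "real k \<le> u j / \<epsilon> + 1" unfolding k_eq by linarith+
      then have k: "u j < real k * \<epsilon>" "real k * \<epsilon> \<le> u j + \<epsilon>"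
        using \<epsilon> by (auto simp: field_simps)
      have "\<lfloor>u j / \<epsilon>\<rfloor> \<le> \<lceil>t / \<epsilon>\<rceil>"
        using uj \<epsilon> by (meson ceiling_mono divide_right_mono floor_le_ceiling less_imp_le order_trans)
      then have "k \<le> K" by (auto simp: k_def K_def)
      then have "min t (real k * \<epsilon>) \<in> P" by (auto simp: P_def)
      moreover have "min t (real k * \<epsilon>) < u (Suc j)" using k * by linarith
      ultimately have "min t (real k * \<epsilon>) \<le> u j" using u(4) j by blast
      then show False using k uj u(3)[OF j] by linarith
    qed
    show "aligned u N S"
      unfolding aligned_def
    proof (clarify, intro conjI impI)
      fix a b \<xi> j assume S: "(a, b, \<xi>) \<in> set S" and j: "j < N"
      have "0 \<le> a" "0 \<le> b" "u (Suc j) \<le> t" using nonneg[OF S] range j by auto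
      then have "a < u (Suc j) \<Longrightarrow> a \<in> P" "b < u (Suc j) \<Longrightarrow> b \<in> P"
        unfolding P_def using S by (simp_all, blast+)
      then show "a < u (Suc j) \<Longrightarrow> a \<le> u j" and "b < u (Suc j) \<Longrightarrow> b \<le> u j"
        using u(4)[OF j] by blast+
    qed
  qed
qed

lemma elementary_value_Nil [simp]: "elementary_value [] s \<omega> = 0"
  and elementary_value_Cons [simp]:
    "elementary_value ((a, b, \<xi>) # S) s \<omega> = \<xi> \<omega> * indicator {a<..b} s + elementary_value S s \<omega>"
  by (auto simp: elementary_value_def)

lemma elementary_integral_Nil [simp]: "elementary_integral W [] t \<omega> = 0"
  and elementary_integral_Cons [simp]: "elementary_integral W ((a, b, \<xi>) # S) t \<omega> =
    \<xi> \<omega> * (W (min b t) \<omega> - W (min a t) \<omega>) + elementary_integral W S t \<omega>"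
  by (auto simp: elementary_integral_def)

lemma aligned_Cons: "aligned u N ((a, b, \<xi>) # S) \<longleftrightarrow> aligned u N S \<and>
    (\<forall>j<N. (a < u (Suc j) \<longrightarrow> a \<le> u j) \<and> (b < u (Suc j) \<longrightarrow> b \<le> u j))"
  by (auto simp: aligned_def)

text \<open>Intervals are open on the left and closed on the right, so the value on a cell has to be
  read off at its right endpoint.\<close>

lemma aligned_elementary_value:
  assumes "aligned u N S" "j < N" "u j < s" "s \<le> u (Suc j)"
  shows "elementary_value S s \<omega> = elementary_value S (u (Suc j)) \<omega>"
  using assms(1)
proof (induction S)
  case (Cons x S)
  obtain a b \<xi> where x: "x = (a, b, \<xi>)" by (cases x)
  have "indicator {a<..b} s = (indicator {a<..b} (u (Suc j)) :: real)"
    using Cons.prems assms(2-) unfolding x aligned_Cons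
    by (auto simp: indicator_def dest!: spec[of _ j])
  then show ?case using Cons unfolding x aligned_Cons by auto
qed simp

lemma aligned_elementary_integral:
  assumes "aligned u N S" "u 0 = 0" "u N = t" "\<And>j. j < N \<Longrightarrow> u j < u (Suc j)" "0 \<le> t"
    and "\<And>a b \<xi>. (a, b, \<xi>) \<in> set S \<Longrightarrow> 0 \<le> a \<and> a \<le> b"
  shows "elementary_integral W S t \<omega> =
    (\<Sum>j<N. elementary_value S (u (Suc j)) \<omega> * (W (u (Suc j)) \<omega> - W (u j) \<omega>))"
  using assms(1,6)
proof (induction S)
  case (Cons x S)
  obtain a b \<xi> where x: "x = (a, b, \<xi>)" by (cases x)
  have ab: "0 \<le> a" "a \<le> b" using Cons.prems(2)[of a b \<xi>] by (auto simp: x)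
  \<comment> \<open>The path frozen outside [a, b]: over a cell, \<open>h\<close> moves like
    \<open>W\<close> if the cell lies in (a, b] and stays constant otherwise, so the sum
    telescopes.\<close>
  define h where "h r = W (min b (max a r)) \<omega>" for r
  have "indicator {a<..b} (u (Suc j)) * (W (u (Suc j)) \<omega> - W (u j) \<omega>) = h (u (Suc j)) - h (u j)"
    if j: "j < N" for j
  proof -
    have al: "a < u (Suc j) \<longrightarrow> a \<le> u j" "b < u (Suc j) \<longrightarrow> b \<le> u j"
      using Cons.prems(1) j unfolding x aligned_Cons by auto
    show ?thesis
      using al assms(4)[OF j] ab
      by (cases "a < u (Suc j)"; cases "b < u (Suc j)")
         (auto simp: h_def indicator_def max_def min_def)
  qed
  then have "(\<Sum>j<N. indicator {a<..b} (u (Suc j)) * (W (u (Suc j)) \<omega> - W (u j) \<omega>)) = h t - h 0"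
    using sum_lessThan_telescope[of "\<lambda>j. h (u j)" N] assms(2,3) by simp
  also have "\<dots> = W (min b t) \<omega> - W (min a t) \<omega>"
    using ab assms(5) by (auto simp: h_def min_def max_def)
  finally have "(\<Sum>j<N. \<xi> \<omega> * (indicator {a<..b} (u (Suc j)) * (W (u (Suc j)) \<omega> - W (u j) \<omega>)))
      = \<xi> \<omega> * (W (min b t) \<omega> - W (min a t) \<omega>)"
    by (simp add: sum_distrib_left[symmetric])
  moreover have "elementary_integral W S t \<omega> =
    (\<Sum>j<N. elementary_value S (u (Suc j)) \<omega> * (W (u (Suc j)) \<omega> - W (u j) \<omega>))"
    using Cons unfolding x aligned_Cons by auto
  ultimately show ?case
    unfolding x by (simp add: distrib_right sum.distrib mult.assoc)
qed simp

lemma sum_indicator_cells: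
  fixes u :: "nat \<Rightarrow> real"
  assumes "\<And>j. j < N \<Longrightarrow> u j < u (Suc j)"
  shows "(\<Sum>j<N. indicator {u j<..u (Suc j)} s) = (indicator {u 0<..u N} s :: ennreal)"
proof -
  \<comment> \<open>The induction also carries the order of the endpoints, which is needed to glue
    the next cell to the union of the previous ones.\<close>
  have "u 0 \<le> u N \<and> (\<Sum>j<N. indicator {u j<..u (Suc j)} s) = (indicator {u 0<..u N} s :: ennreal)"
    using assms
  proof (induction N)
    case (Suc N)
    then have "u 0 \<le> u N" "u N < u (Suc N)"
      "(\<Sum>j<N. indicator {u j<..u (Suc j)} s) = (indicator {u 0<..u N} s :: ennreal)" by auto
    then show ?case by (auto simp: indicator_def)
  qed simp
  then show ?thesis ..
qed

section \<open>Adaptedness and truncation of elementary processes\<close>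

context brownian_space
begin

lemma elementary_processD:
  assumes "elementary_process F S" "(a, b, \<xi>) \<in> set S"
  shows "0 \<le> a" "a \<le> b" "\<xi> \<in> borel_measurable (F a)" "\<exists>B. \<forall>\<omega>\<in>space M. \<bar>\<xi> \<omega>\<bar> \<le> B"
  using assms by (fastforce simp: elementary_process_def bounded_iff space_F)+

lemma elementary_process_Cons: "elementary_process F (x # S) \<longleftrightarrow>
    elementary_process F [x] \<and> elementary_process F S"
  by (auto simp: elementary_process_def)

text \<open>This is predictability: an interval that contributes on the cell starts no later than
  the cell does, so its coefficient is known at the left endpoint although the value is taken at the
  right one.\<close>

lemma elementary_value_measurable_cell:
  assumes "elementary_process F S" "aligned u N S" "j < N"
  shows "elementary_value S (u (Suc j)) \<in> borel_measurable (F (u j))"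
  using assms(1,2)
proof (induction S)
  case Nil
  then show ?case by (simp add: elementary_value_def[abs_def])
next
  case (Cons x S)
  obtain a b \<xi> where x: "x = (a, b, \<xi>)" by (cases x)
  have "(\<lambda>\<omega>. \<xi> \<omega> * indicator {a<..b} (u (Suc j))) \<in> borel_measurable (F (u j))"
  proof (cases "a < u (Suc j)")
    case True
    then have "a \<le> u j" using Cons.prems(2) assms(3) unfolding x aligned_Cons by auto
    then have "\<xi> \<in> borel_measurable (F (u j))"
      using elementary_processD(3)[OF Cons.prems(1), of a b \<xi>] measurable_F_mono x by auto
    then show ?thesis by simp
  qed (simp add: indicator_def)
  moreover have "elementary_value S (u (Suc j)) \<in> borel_measurable (F (u j))"
    using Cons elementary_process_Cons[of x S] unfolding x aligned_Cons by auto
  ultimately show ?case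
    unfolding x elementary_value_Cons[abs_def] by (rule borel_measurable_add)
qed

lemma elementary_value_bounded:
  assumes "elementary_process F S"
  shows "\<exists>B. \<forall>\<omega>\<in>space M. \<bar>elementary_value S s \<omega>\<bar> \<le> B"
  using assms
proof (induction S)
  case (Cons x S)
  obtain a b \<xi> where x: "x = (a, b, \<xi>)" by (cases x)
  obtain B where B: "\<And>\<omega>. \<omega> \<in> space M \<Longrightarrow> \<bar>elementary_value S s \<omega>\<bar> \<le> B"
    using Cons elementary_process_Cons[of x S] by auto
  obtain B' where B': "\<And>\<omega>. \<omega> \<in> space M \<Longrightarrow> \<bar>\<xi> \<omega>\<bar> \<le> B'"
    using elementary_processD(4)[OF Cons.prems, of a b \<xi>] by (auto simp: x)
  have "\<bar>elementary_value (x # S) s \<omega>\<bar> \<le> B' + B" if "\<omega> \<in> space M" for \<omega>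
  proof -
    have "\<bar>\<xi> \<omega> * indicator {a<..b} s\<bar> \<le> \<bar>\<xi> \<omega>\<bar>" by (auto simp: indicator_def)
    then show ?thesis using B[OF that] B'[OF that] unfolding x elementary_value_Cons by linarith
  qed
  then show ?case by blast
qed auto

lemma elementary_value_measurable:
  assumes "elementary_process F S"
  shows "(\<lambda>(s, \<omega>). elementary_value S s \<omega>) \<in> borel_measurable (borel \<Otimes>\<^sub>M M)"
  using assms
proof (induction S)
  case (Cons x S)
  obtain a b \<xi> where x: "x = (a, b, \<xi>)" by (cases x)
  have [measurable]: "\<xi> \<in> borel_measurable M"
    using elementary_processD(3)[OF Cons.prems, of a b \<xi>] measurable_F_M by (auto simp: x)
  have [measurable]: "(\<lambda>(s, \<omega>). elementary_value S s \<omega>) \<in> borel_measurable (borel \<Otimes>\<^sub>M M)"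
    using Cons elementary_process_Cons[of x S] by auto
  show ?case unfolding x elementary_value_Cons by measurable
qed (simp add: elementary_value_def[abs_def])

lemma elementary_integral_measurable:
  assumes "elementary_process F S" "0 \<le> t"
  shows "elementary_integral W S t \<in> borel_measurable M"
  using assms(1)
proof (induction S)
  case (Cons x S)
  obtain a b \<xi> where x: "x = (a, b, \<xi>)" by (cases x)
  have [measurable]: "\<xi> \<in> borel_measurable M" "W (min a t) \<in> borel_measurable M" "W (min b t) \<in> borel_measurable M"
    using elementary_processD[OF Cons.prems, of a b \<xi>] measurable_F_M W_measurable assms(2) by (auto simp: x)
  have [measurable]: "elementary_integral W S t \<in> borel_measurable M"
    using Cons elementary_process_Cons[of x S] by auto
  show ?case unfolding x elementary_integral_Cons[abs_def] by measurable
qed (simp add: elementary_integral_def[abs_def])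


text \<open>On a fine aligned grid the coefficients of \<open>S\<close> are multiplied by the
  indicators of \<open>G\<close> at the left endpoint and of a bound on the bracket, both known when
  the cell starts. The shift by \<epsilon> in \<open>B\<close> pays for freezing \<open>G\<close> at
  the left endpoint; the cut-off at \<open>R\<close> supplies the domination for the later
  limit.\<close>

lemma truncated_step_approximation:
  fixes S :: "'a elementary" and G :: "real \<Rightarrow> 'a set" and t \<epsilon> R :: real and m :: nat
  defines "B \<equiv> \<lambda>\<omega>. \<integral>\<^sup>+s\<in>{0..t}. ennreal ((elementary_value S s \<omega>)\<^sup>2) * indicator (G (max 0 (s - \<epsilon>))) \<omega> \<partial>lborel"
  assumes S: "elementary_process F S" and t: "0 \<le> t" and \<epsilon>: "0 < \<epsilon>" and m: "1 \<le> m" and R: "0 \<le> R"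
    and G_meas: "\<And>s. 0 \<le> s \<Longrightarrow> s \<le> t \<Longrightarrow> G s \<in> sets (F s)"
    and G_anti: "\<And>r s. 0 \<le> r \<Longrightarrow> r \<le> s \<Longrightarrow> s \<le> t \<Longrightarrow> G s \<subseteq> G r"
  obtains J where "J \<in> borel_measurable M"
    "\<And>\<omega>. \<omega> \<in> G t \<Longrightarrow> B \<omega> \<le> ennreal R \<Longrightarrow> J \<omega> = elementary_integral W S t \<omega>"
    "(\<integral>\<^sup>+\<omega>. ennreal (J \<omega> ^ (2 * m)) \<partial>M) \<le> ennreal (moment_const m) * (\<integral>\<^sup>+\<omega>. (min (ennreal R) (B \<omega>)) ^ m \<partial>M)"
proof -
  have nonneg: "0 \<le> a \<and> a \<le> b" if "(a, b, \<xi>) \<in> set S" for a b \<xi>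
    using elementary_processD[OF S that] by auto
  obtain u N where u: "u 0 = 0" "u N = t" "\<And>j. j < N \<Longrightarrow> u j < u (Suc j)"
      "\<And>j. j < N \<Longrightarrow> u (Suc j) - u j \<le> \<epsilon>" and al: "aligned u N S"
    by (rule aligned_grid_exists[OF t \<epsilon>, of S]) (use nonneg in blast)+
  have u_le: "i \<le> j \<Longrightarrow> j \<le> N \<Longrightarrow> u i \<le> u j" for i j
  proof (induction j rule: dec_induct)
    case (step j)
    then show ?case using u(3)[of j] by auto
  qed simp
  have u_range: "0 \<le> u j" "u j \<le> t" if "j \<le> N" for j
    using u_le[of 0 j] u_le[of j N] that u by auto
  define v where "v j = elementary_value S (u (Suc j))" for j
  define c where "c j \<omega> = v j \<omega> * indicator (G (u j)) \<omega>" for j \<omega>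
  define \<Delta> where "\<Delta> j = u (Suc j) - u j" for j
  define \<sigma> where "\<sigma> j \<omega> = (\<Sum>i<j. (c i \<omega>)\<^sup>2 * \<Delta> i)" for j \<omega>
  \<comment> \<open>The bracket up to the end of the cell is already known at its beginning, so the
    cut is made before \<open>R\<close> is exceeded and there is no overshoot.\<close>
  define d where "d j \<omega> = c j \<omega> * indicator {\<omega> \<in> space M. \<sigma> (Suc j) \<omega> \<le> R} \<omega>" for j \<omega>
  define A where "A k \<omega> = (\<Sum>j<k. (d j \<omega>)\<^sup>2 * \<Delta> j)" for k \<omega>
  define J where "J \<omega> = (\<Sum>j<N. d j \<omega> * (W (u (Suc j)) \<omega> - W (u j) \<omega>))" for \<omega>
  have \<Delta>: "0 < \<Delta> j" if "j < N" for j using u(3)[OF that] by (simp add: \<Delta>_def)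
  have c_meas: "c j \<in> borel_measurable (F (u j))" if "j < N" for j
    unfolding c_def v_def
    using elementary_value_measurable_cell[OF S al that] G_meas[of "u j"] u_range[of j] that
    by (intro borel_measurable_times borel_measurable_indicator) auto
  have c_meas': "c i \<in> borel_measurable (F (u j))" if "i \<le> j" "j < N" for i j
    using measurable_F_mono[OF u_le c_meas, of i j] that by auto
  have d_meas: "d j \<in> borel_measurable (F (u j))" if "j < N" for j
  proof -
    have [measurable]: "\<sigma> (Suc j) \<in> borel_measurable (F (u j))" "c j \<in> borel_measurable (F (u j))"
      unfolding \<sigma>_def using c_meas' that by (auto intro!: borel_measurable_sum)
    have "{\<omega> \<in> space (F (u j)). \<sigma> (Suc j) \<omega> \<le> R} \<in> sets (F (u j))" by measurable
    then show ?thesis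
      unfolding d_def space_F by (intro borel_measurable_times borel_measurable_indicator) auto
  qed
  have d_bdd: "\<exists>B. \<forall>\<omega>\<in>space M. \<bar>d j \<omega>\<bar> \<le> B" if "j < N" for j
  proof -
    obtain B where "\<And>\<omega>. \<omega> \<in> space M \<Longrightarrow> \<bar>v j \<omega>\<bar> \<le> B"
      using elementary_value_bounded[OF S] unfolding v_def by blast
    moreover have "\<bar>d j \<omega>\<bar> \<le> \<bar>v j \<omega>\<bar>" for \<omega>
      by (auto simp: d_def c_def indicator_def)
    ultimately show ?thesis by (meson order_trans)
  qed
  have \<sigma>_mono: "\<sigma> i \<omega> \<le> \<sigma> j \<omega>" if "i \<le> j" "j \<le> N" for i j \<omega>
    unfolding \<sigma>_def using that \<Delta> by (intro sum_mono2 mult_nonneg_nonneg) (auto simp: less_imp_le)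
  have A_le_\<sigma>: "A k \<omega> \<le> \<sigma> k \<omega>" if "k \<le> N" for k \<omega>
    unfolding A_def \<sigma>_def using that \<Delta>
    by (intro sum_mono mult_right_mono) (auto simp: d_def indicator_def less_imp_le)
  \<comment> \<open>If \<sigma> exceeds \<open>R\<close> at the end of cell \<open>k\<close>, then
    \<open>d k\<close> vanishes and the previous bound persists; otherwise \<open>A\<close> is
    dominated by \<sigma>.\<close>
  have A_le_R: "A k \<omega> \<le> R" if "k \<le> N" for k \<omega>
    using that
  proof (induction k)
    case (Suc k)
    show ?case
    proof (cases "\<sigma> (Suc k) \<omega> \<le> R")
      case True
      then show ?thesis using A_le_\<sigma>[OF Suc.prems, of \<omega>] by simp
    next
      case False
      then show ?thesis using Suc by (simp add: A_def d_def)
    qed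
  qed (simp add: A_def R)
  have \<sigma>_le_B: "ennreal (\<sigma> N \<omega>) \<le> B \<omega>" if "\<omega> \<in> space M" for \<omega>
  proof -
    have [measurable]: "{u j<..u (Suc j)} \<in> sets lborel" for j by simp
    have "ennreal (\<sigma> N \<omega>) = (\<Sum>j<N. ennreal ((c j \<omega>)\<^sup>2) * ennreal (\<Delta> j))"
      unfolding \<sigma>_def using \<Delta>
      by (subst sum_ennreal[symmetric]) (auto simp: ennreal_mult less_imp_le)
    also have "\<dots> = (\<Sum>j<N. \<integral>\<^sup>+s. ennreal ((c j \<omega>)\<^sup>2) * indicator {u j<..u (Suc j)} s \<partial>lborel)"
      using u(3) by (intro sum.cong refl) (simp add: nn_integral_cmult_indicator \<Delta>_def less_imp_le)
    also have "\<dots> = (\<integral>\<^sup>+s. (\<Sum>j<N. ennreal ((c j \<omega>)\<^sup>2) * indicator {u j<..u (Suc j)} s) \<partial>lborel)"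
      by (rule nn_integral_sum[symmetric]) simp
    also have "\<dots> \<le> B \<omega>"
      unfolding B_def
    proof (rule nn_integral_mono)
      fix s :: real
      let ?f = "ennreal ((elementary_value S s \<omega>)\<^sup>2) * indicator (G (max 0 (s - \<epsilon>))) \<omega> :: ennreal"
      have "(\<Sum>j<N. ennreal ((c j \<omega>)\<^sup>2) * indicator {u j<..u (Suc j)} s)
          \<le> (\<Sum>j<N. ?f * indicator {u j<..u (Suc j)} s)"
      proof (rule sum_mono)
        fix j assume "j \<in> {..<N}"
        then have j: "j < N" by simp
        show "ennreal ((c j \<omega>)\<^sup>2) * indicator {u j<..u (Suc j)} s \<le> ?f * indicator {u j<..u (Suc j)} s"
        proof (cases "s \<in> {u j<..u (Suc j)} \<and> \<omega> \<in> G (u j)")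
          case True
          then have "elementary_value S s \<omega> = v j \<omega>"
            unfolding v_def by (intro aligned_elementary_value[OF al j]) auto
          \<comment> \<open>Cells have length at most \<epsilon>, so the left endpoint is no earlier
            than \<open>s - \<epsilon>\<close>, and \<open>G\<close> is decreasing.\<close>
          moreover have "\<omega> \<in> G (max 0 (s - \<epsilon>))"
            using G_anti[of "max 0 (s - \<epsilon>)" "u j"] True u(4)[OF j] u_range[of j] j by auto
          ultimately show ?thesis using True by (simp add: c_def)
        qed (auto simp: c_def indicator_def)
      qed
      also have "\<dots> = ?f * indicator {0<..t} s"
        unfolding sum_distrib_left[symmetric] using sum_indicator_cells[of N u s] u by simp
      also have "\<dots> \<le> ?f * indicator {0..t} s"
        by (intro mult_left_mono) (auto simp: indicator_def)
      finally show "(\<Sum>j<N. ennreal ((c j \<omega>)\<^sup>2) * indicator {u j<..u (Suc j)} s) \<le> ?f * indicator {0..t} s" .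
    qed
    finally show ?thesis .
  qed
  note step = step_integral_moment[of u N d m, OF _ u(3) d_meas d_bdd m, folded \<Delta>_def]
  show thesis
  proof
    show "J \<in> borel_measurable M"
      unfolding J_def using measurable_F_M[OF d_meas] W_measurable u_range
      by (intro borel_measurable_sum borel_measurable_times borel_measurable_diff) auto
    show "J \<omega> = elementary_integral W S t \<omega>" if \<omega>: "\<omega> \<in> G t" and B: "B \<omega> \<le> ennreal R" for \<omega>
    proof -
      have sp: "\<omega> \<in> space M" using \<omega> sets.sets_into_space[OF G_meas[OF t order_refl]] by (auto simp: space_F)
      have "\<sigma> N \<omega> \<le> R" using order_trans[OF \<sigma>_le_B[OF sp] B] R by (simp add: ennreal_le_iff)
      then have "d j \<omega> = v j \<omega>" if "j < N" for j
        using \<sigma>_mono[of "Suc j" N \<omega>] that G_anti[of "u j" t] u_range[of j] \<omega> sp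
        by (auto simp: d_def c_def indicator_def)
      then show ?thesis
        unfolding J_def using aligned_elementary_integral[OF al u(1,2,3) t nonneg]
        by (simp add: v_def)
    qed
    have "(\<integral>\<^sup>+\<omega>. ennreal (J \<omega> ^ (2 * m)) \<partial>M) = ennreal (expectation (\<lambda>\<omega>. J \<omega> ^ (2 * m)))"
      using step(1) u by (intro nn_integral_eq_integral) (auto simp: J_def)
    also have "\<dots> \<le> ennreal (moment_const m * expectation (\<lambda>\<omega>. A N \<omega> ^ m))"
      using step(3) u by (intro ennreal_leI) (auto simp: J_def A_def)
    also have "\<dots> = ennreal (moment_const m) * ennreal (expectation (\<lambda>\<omega>. A N \<omega> ^ m))"
      by (rule ennreal_mult') (rule moment_const_nonneg)
    also have "ennreal (expectation (\<lambda>\<omega>. A N \<omega> ^ m)) = (\<integral>\<^sup>+\<omega>. ennreal (A N \<omega> ^ m) \<partial>M)"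
      using step(2) u \<Delta>
      by (intro nn_integral_eq_integral[symmetric])
         (auto simp: A_def less_imp_le intro!: AE_I2 zero_le_power sum_nonneg)
    also have "\<dots> \<le> (\<integral>\<^sup>+\<omega>. (min (ennreal R) (B \<omega>)) ^ m \<partial>M)"
    proof (rule nn_integral_mono)
      fix \<omega> assume \<omega>: "\<omega> \<in> space M"
      have A0: "0 \<le> A N \<omega>" unfolding A_def using \<Delta> by (auto simp: less_imp_le intro!: sum_nonneg)
      have "ennreal (A N \<omega>) \<le> min (ennreal R) (B \<omega>)"
        using A_le_R[of N \<omega>] order_trans[OF ennreal_leI[OF A_le_\<sigma>[OF order_refl]] \<sigma>_le_B[OF \<omega>]]
        by (auto intro: ennreal_leI)
      then show "ennreal (A N \<omega> ^ m) \<le> (min (ennreal R) (B \<omega>)) ^ m"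
        using A0 by (simp add: ennreal_power[symmetric] power_mono)
    qed
    finally show "(\<integral>\<^sup>+\<omega>. ennreal (J \<omega> ^ (2 * m)) \<partial>M)
        \<le> ennreal (moment_const m) * (\<integral>\<^sup>+\<omega>. (min (ennreal R) (B \<omega>)) ^ m \<partial>M)"
      by (simp add: mult_left_mono)
  qed
qed

end

section \<open>A moment bound for the Ito integral\<close>

abbreviation sq_int :: "real \<Rightarrow> (real \<Rightarrow> real) \<Rightarrow> ennreal" where
  "sq_int t f \<equiv> \<integral>\<^sup>+s\<in>{0..t}. ennreal ((f s)\<^sup>2) \<partial>lborel"

text \<open>Finiteness of the limit excludes the products of zero and infinity at which
  multiplication is discontinuous.\<close>

lemma tendsto_power_ennreal:
  fixes f :: "'b \<Rightarrow> ennreal"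
  assumes "(f \<longlongrightarrow> a) F" "a < \<infinity>"
  shows "((\<lambda>x. f x ^ n) \<longlongrightarrow> a ^ n) F"
proof (induction n)
  case (Suc n)
  have "a ^ n < \<infinity>" using assms(2) by (simp add: less_top[symmetric] power_eq_top_ennreal)
  then have "\<not> ((a = 0 \<and> a ^ n = \<infinity>) \<or> (a = \<infinity> \<and> a ^ n = 0))" using assms(2) by force
  then show ?case
    using tendsto_mult_ennreal[OF assms(1) Suc] by simp
qed simp

lemma power2_sum_le:
  fixes x y :: real
  shows "(x + y)\<^sup>2 \<le> 2 * x\<^sup>2 + 2 * y\<^sup>2"
  using sum_squares_bound[of x y] by (simp add: power2_sum)

context brownian_space
begin

text \<open>Clamping the time to [0, T] turns measurability on a restricted product into
  measurability of a total function, so the process can be composed with arbitrary measurable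
  maps.\<close>

lemma progressive_measurable:
  assumes X: "progressive F T X" and T: "0 \<le> T"
    and [measurable]: "f \<in> borel_measurable N" "g \<in> N \<rightarrow>\<^sub>M M"
  shows "(\<lambda>x. X (max 0 (min (f x) T)) (g x)) \<in> borel_measurable N"
proof -
  have X': "(\<lambda>(s, \<omega>). X s \<omega>) \<in> borel_measurable (restrict_space borel {0..T} \<Otimes>\<^sub>M F T)"
    using X T by (auto simp: progressive_def)
  have "g \<in> N \<rightarrow>\<^sub>M F T"
    using assms(4) subalgebra_F[of T] by (auto simp: measurable_def space_F subalgebra_def)
  moreover have "(\<lambda>x. max 0 (min (f x) T)) \<in> N \<rightarrow>\<^sub>M restrict_space borel {0..T}"
    using T by (intro measurable_restrict_space2) auto
  ultimately have "(\<lambda>x. (max 0 (min (f x) T), g x)) \<in> N \<rightarrow>\<^sub>M restrict_space borel {0..T} \<Otimes>\<^sub>M F T"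
    by (rule measurable_Pair[rotated])
  from measurable_compose[OF this X'] show ?thesis by simp
qed

text \<open>By left-continuity, membership in \<open>G s\<close> is decided by \<open>G 0\<close>
  and the events at rational times before \<open>s\<close>; only countably many events are involved
  for all \<open>s\<close> together, which gives joint measurability.\<close>

lemma decreasing_events_measurable:
  fixes G :: "real \<Rightarrow> 'a set"
  assumes t: "0 \<le> t"
    and G_meas: "\<And>s. 0 \<le> s \<Longrightarrow> s \<le> t \<Longrightarrow> G s \<in> sets (F s)"
    and G_anti: "\<And>r s. 0 \<le> r \<Longrightarrow> r \<le> s \<Longrightarrow> s \<le> t \<Longrightarrow> G s \<subseteq> G r"
    and G_left: "\<And>s \<omega>. 0 < s \<Longrightarrow> s \<le> t \<Longrightarrow> (\<And>r. 0 \<le> r \<Longrightarrow> r < s \<Longrightarrow> \<omega> \<in> G r) \<Longrightarrow> \<omega> \<in> G s"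
    and [measurable]: "f \<in> borel_measurable N" "g \<in> N \<rightarrow>\<^sub>M M"
  shows "(\<lambda>x. indicator (G (max 0 (min (f x) t))) (g x) :: ennreal) \<in> borel_measurable N"
proof -
  have iff: "\<omega> \<in> G s \<longleftrightarrow> \<omega> \<in> G 0 \<and> (\<forall>r\<in>\<rat> \<inter> {0..t}. r < s \<longrightarrow> \<omega> \<in> G r)" if "0 \<le> s" "s \<le> t" for s \<omega>
  proof
    assume R: "\<omega> \<in> G 0 \<and> (\<forall>r\<in>\<rat> \<inter> {0..t}. r < s \<longrightarrow> \<omega> \<in> G r)"
    show "\<omega> \<in> G s"
    proof (cases "s = 0")
      case False
      show ?thesis
      proof (rule G_left)
        fix r assume r: "0 \<le> r" "r < s"
        obtain q where q: "q \<in> \<rat>" "r < q" "q < s" using Rats_dense_in_real[OF r(2)] by auto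
        then have "\<omega> \<in> G q" using R r that by auto
        then show "\<omega> \<in> G r" using G_anti[of r q] q r that by auto
      qed (use that False in auto)
    qed (use R in auto)
  next
    assume "\<omega> \<in> G s"
    then show "\<omega> \<in> G 0 \<and> (\<forall>r\<in>\<rat> \<inter> {0..t}. r < s \<longrightarrow> \<omega> \<in> G r)"
      using G_anti[of _ s] that by fastforce
  qed
  have "Measurable.pred N (\<lambda>x. \<forall>r\<in>\<rat> \<inter> {0..t}. r < max 0 (min (f x) t) \<longrightarrow> g x \<in> G r)"
  proof -
    have *: "Measurable.pred N (\<lambda>x. \<forall>q\<in>{q::rat. of_rat q \<in> {0..t}}.
        of_rat q < max 0 (min (f x) t) \<longrightarrow> g x \<in> G (of_rat q))"
    proof (rule pred_intros_countable_bounded)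
      fix q :: rat assume "q \<in> {q. of_rat q \<in> {0..t}}"
      then have [measurable]: "G (of_rat q) \<in> sets M" using G_meas sets_F_M by auto
      show "Measurable.pred N (\<lambda>x. of_rat q < max 0 (min (f x) t) \<longrightarrow> g x \<in> G (of_rat q))" by measurable
    qed
    have "\<rat> \<inter> {0..t} = of_rat ` {q::rat. of_rat q \<in> {0..t}}"
      unfolding Rats_def by blast
    from arg_cong[OF this, of "\<lambda>A. \<forall>r\<in>A. P r" for P]
    have "(\<forall>r\<in>\<rat> \<inter> {0..t}. P r) \<longleftrightarrow> (\<forall>q\<in>{q::rat. of_rat q \<in> {0..t}}. P (of_rat q))" for P
      by blast
    with * show ?thesis by (simp only:)
  qed
  moreover have "G 0 \<in> sets M" using G_meas[of 0] t sets_F_M by auto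
  ultimately have "Measurable.pred N (\<lambda>x. g x \<in> G 0 \<and>
      (\<forall>r\<in>\<rat> \<inter> {0..t}. r < max 0 (min (f x) t) \<longrightarrow> g x \<in> G r))"
    by simp
  then have "Measurable.pred N (\<lambda>x. g x \<in> G (max 0 (min (f x) t)))"
    using t by (subst iff) auto
  then have "{x \<in> space N. g x \<in> G (max 0 (min (f x) t))} \<in> sets N" by simp
  then have "(\<lambda>x. indicator {x \<in> space N. g x \<in> G (max 0 (min (f x) t))} x :: ennreal) \<in> borel_measurable N"
    by simp
  then show ?thesis
    by (rule subst[OF measurable_cong, rotated -1]) (auto simp: indicator_def)
qed

lemma approximation_error_measurable:
  assumes S: "elementary_process F S" and H: "progressive F t H" and t: "0 \<le> t"
  shows "(\<lambda>\<omega>. sq_int t (\<lambda>s. elementary_value S s \<omega> - H s \<omega>)) \<in> borel_measurable M"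
proof -
  have [measurable]: "(\<lambda>(s, \<omega>). elementary_value S s \<omega>) \<in> borel_measurable (borel \<Otimes>\<^sub>M M)"
    by (rule elementary_value_measurable[OF S])
  have [measurable]: "(\<lambda>p. H (max 0 (min (snd p) t)) (fst p)) \<in> borel_measurable (M \<Otimes>\<^sub>M lborel)"
    by (rule progressive_measurable[OF H t]) measurable
  have "(\<lambda>\<omega>. sq_int t (\<lambda>s. elementary_value S s \<omega> - H s \<omega>)) =
      (\<lambda>\<omega>. \<integral>\<^sup>+s. ennreal ((elementary_value S s \<omega> - H (max 0 (min s t)) \<omega>)\<^sup>2) * indicator {0..t} s \<partial>lborel)"
    by (intro ext nn_integral_cong) (auto simp: indicator_def)
  also have "\<dots> \<in> borel_measurable M"
    by (intro lborel.borel_measurable_nn_integral) (simp add: split_beta', measurable)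
  finally show ?thesis .
qed

text \<open>The Borel-Cantelli lemma turns both limits in probability into almost sure ones. One bad
  event collects both failures, so a single choice \<open>\<nu>\<close> serves the integrands and
  the integrals.\<close>

lemma has_ito_integral_AE_approximation:
  assumes ito: "has_ito_integral M F W H t I" and t: "0 \<le> t"
  obtains S where "\<And>k::nat. elementary_process F (S k)"
    "AE \<omega> in M. (\<lambda>k. sq_int t (\<lambda>s. elementary_value (S k) s \<omega> - H s \<omega>)) \<longlonglongrightarrow> 0"
    "AE \<omega> in M. (\<lambda>k. elementary_integral W (S k) t \<omega>) \<longlonglongrightarrow> I \<omega>"
    "\<And>k. (\<lambda>\<omega>. sq_int t (\<lambda>s. elementary_value (S k) s \<omega> - H s \<omega>)) \<in> borel_measurable M"
proof -
  obtain S where S: "\<And>n. elementary_process F (S n)"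
    and QS: "\<And>\<epsilon>. 0 < \<epsilon> \<Longrightarrow> (\<lambda>n. measure M {\<omega> \<in> space M.
            (sq_int t (\<lambda>s. elementary_value (S n) s \<omega> - H s \<omega>)) > ennreal \<epsilon>}) \<longlonglongrightarrow> 0"
    and IS: "\<And>\<epsilon>. 0 < \<epsilon> \<Longrightarrow> (\<lambda>n. measure M {\<omega> \<in> space M. \<bar>elementary_integral W (S n) t \<omega> - I \<omega>\<bar> > \<epsilon>}) \<longlonglongrightarrow> 0"
    and prog: "progressive F t H" and [measurable]: "I \<in> borel_measurable M"
    using ito unfolding has_ito_integral_def by blast
  define Q where "Q n \<omega> = (sq_int t (\<lambda>s. elementary_value (S n) s \<omega> - H s \<omega>))" for n \<omega>
  have Q_meas[measurable]: "Q n \<in> borel_measurable M" for n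
    unfolding Q_def[abs_def] by (rule approximation_error_measurable[OF S prog t])
  have [measurable]: "elementary_integral W (S n) t \<in> borel_measurable M" for n
    by (rule elementary_integral_measurable[OF S t])
  define bad where "bad n k = {\<omega> \<in> space M. Q n \<omega> > ennreal ((1 / 2) ^ k)} \<union>
      {\<omega> \<in> space M. \<bar>elementary_integral W (S n) t \<omega> - I \<omega>\<bar> > (1 / 2) ^ k}" for n k
  have bad_meas: "bad n k \<in> sets M" for n k
    unfolding bad_def by measurable
  have "\<exists>n. measure M (bad n k) \<le> 2 * (1 / 2) ^ k" for k
  proof -
    have pos: "(0::real) < (1 / 2) ^ k" by simp
    have "eventually (\<lambda>n. measure M {\<omega> \<in> space M. Q n \<omega> > ennreal ((1 / 2) ^ k)} < (1 / 2) ^ k \<and>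
       measure M {\<omega> \<in> space M. \<bar>elementary_integral W (S n) t \<omega> - I \<omega>\<bar> > (1 / 2) ^ k} < (1 / 2) ^ k) sequentially"
      using order_tendstoD(2)[OF QS[OF pos] pos] order_tendstoD(2)[OF IS[OF pos] pos]
      unfolding Q_def by eventually_elim auto
    then obtain n where n: "measure M {\<omega> \<in> space M. Q n \<omega> > ennreal ((1 / 2) ^ k)} < (1 / 2) ^ k"
       "measure M {\<omega> \<in> space M. \<bar>elementary_integral W (S n) t \<omega> - I \<omega>\<bar> > (1 / 2) ^ k} < (1 / 2) ^ k"
      by (auto simp: eventually_sequentially)
    have "measure M (bad n k) \<le> measure M {\<omega> \<in> space M. Q n \<omega> > ennreal ((1 / 2) ^ k)}
        + measure M {\<omega> \<in> space M. \<bar>elementary_integral W (S n) t \<omega> - I \<omega>\<bar> > (1 / 2) ^ k}"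
      unfolding bad_def by (rule measure_Un_le) measurable
    then show ?thesis using n by (intro exI[of _ n]) linarith
  qed
  then obtain \<nu> where \<nu>: "\<And>k. measure M (bad (\<nu> k) k) \<le> 2 * (1 / 2) ^ k" by metis
  have "summable (\<lambda>k. measure M (bad (\<nu> k) k))"
    by (rule summable_comparison_test'[where g="\<lambda>k. 2 * (1 / 2) ^ k" and N=0])
       (use \<nu> in \<open>auto intro!: summable_mult summable_geometric\<close>)
  then have "AE \<omega> in M. eventually (\<lambda>k. \<omega> \<in> space M - bad (\<nu> k) k) sequentially"
    by (intro borel_cantelli_AE1 bad_meas) (auto simp: emeasure_eq_measure)
  then have AE: "AE \<omega> in M. eventually (\<lambda>k. Q (\<nu> k) \<omega> \<le> ennreal ((1 / 2) ^ k) \<and>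
      \<bar>elementary_integral W (S (\<nu> k)) t \<omega> - I \<omega>\<bar> \<le> (1 / 2) ^ k) sequentially"
    by eventually_elim (auto simp: bad_def not_less elim!: eventually_mono)
  have pow0: "(\<lambda>k. (1 / 2 :: real) ^ k) \<longlonglongrightarrow> 0" by (rule LIMSEQ_realpow_zero) auto
  show thesis
  proof (rule that[of "\<lambda>k. S (\<nu> k)"])
    show "AE \<omega> in M. (\<lambda>k. sq_int t (\<lambda>s. elementary_value (S (\<nu> k)) s \<omega> - H s \<omega>)) \<longlonglongrightarrow> 0"
      using AE
    proof eventually_elim
      case (elim \<omega>)
      have "(\<lambda>k. ennreal ((1 / 2) ^ k)) \<longlonglongrightarrow> 0"
        using tendsto_ennrealI[OF pow0] by simp
      then have "(\<lambda>k. Q (\<nu> k) \<omega>) \<longlonglongrightarrow> 0"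
        by (rule tendsto_sandwich[OF _ _ tendsto_const, rotated 2]) (use elim in \<open>auto elim: eventually_mono\<close>)
      then show ?case by (simp add: Q_def)
    qed
    show "AE \<omega> in M. (\<lambda>k. elementary_integral W (S (\<nu> k)) t \<omega>) \<longlonglongrightarrow> I \<omega>"
      using AE
    proof eventually_elim
      case (elim \<omega>)
      have "(\<lambda>k. elementary_integral W (S (\<nu> k)) t \<omega> - I \<omega>) \<longlonglongrightarrow> 0"
        by (rule Lim_null_comparison[OF _ pow0]) (use elim in \<open>auto elim: eventually_mono\<close>)
      then show ?case by (rule LIM_zero_cancel)
    qed
  qed (use S Q_meas in \<open>auto simp: Q_def[abs_def]\<close>)
qed


text \<open>The events \<open>G s\<close> localise: before the limit along elementary processes is taken, the integrals
  are stopped by the discretised \<open>G\<close> and by a bound \<open>R\<close> on the discretised bracket.\<close>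

lemma ito_moment_bound:
  fixes G :: "real \<Rightarrow> 'a set"
  assumes ito: "has_ito_integral M F W H t I" and t: "0 \<le> t" and m: "1 \<le> m"
    and G_meas: "\<And>s. 0 \<le> s \<Longrightarrow> s \<le> t \<Longrightarrow> G s \<in> sets (F s)"
    and G_anti: "\<And>r s. 0 \<le> r \<Longrightarrow> r \<le> s \<Longrightarrow> s \<le> t \<Longrightarrow> G s \<subseteq> G r"
    and G_left: "\<And>s \<omega>. 0 < s \<Longrightarrow> s \<le> t \<Longrightarrow> (\<And>r. 0 \<le> r \<Longrightarrow> r < s \<Longrightarrow> \<omega> \<in> G r) \<Longrightarrow> \<omega> \<in> G s"
  shows "(\<integral>\<^sup>+\<omega>. ennreal (I \<omega> ^ (2 * m)) * indicator (G t) \<omega> \<partial>M) \<le>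
    ennreal (2 ^ m * moment_const m) *
      (\<integral>\<^sup>+\<omega>. (\<integral>\<^sup>+s\<in>{0..t}. ennreal ((H s \<omega>)\<^sup>2) * indicator (G s) \<omega> \<partial>lborel) ^ m \<partial>M)"
proof -
  have prog: "progressive F t H" and [measurable]: "I \<in> borel_measurable M"
    and H_fin: "AE \<omega> in M. (sq_int t (\<lambda>s. H s \<omega>)) < \<infinity>"
    using ito by (auto simp: has_ito_integral_def)
  obtain S where S: "\<And>k::nat. elementary_process F (S k)"
    and Q_lim: "AE \<omega> in M. (\<lambda>k. sq_int t (\<lambda>s. elementary_value (S k) s \<omega> - H s \<omega>)) \<longlonglongrightarrow> 0"
    and I_lim: "AE \<omega> in M. (\<lambda>k. elementary_integral W (S k) t \<omega>) \<longlonglongrightarrow> I \<omega>"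
    and Q_meas: "\<And>k. (\<lambda>\<omega>. sq_int t (\<lambda>s. elementary_value (S k) s \<omega> - H s \<omega>)) \<in> borel_measurable M"
    using has_ito_integral_AE_approximation[OF ito t] by blast
  define cl where "cl s = max 0 (min s t)" for s
  have cl: "s \<in> {0..t} \<Longrightarrow> cl s = s" "0 \<le> cl s" "cl s \<le> t" for s using t by (auto simp: cl_def)
  have [measurable]: "cl \<in> borel_measurable borel" unfolding cl_def by measurable
  have H_meas: "(\<lambda>x. H (cl (f x)) (g x)) \<in> borel_measurable N"
    if "f \<in> borel_measurable N" "g \<in> N \<rightarrow>\<^sub>M M" for f g and N :: "'c measure"
    unfolding cl_def by (rule progressive_measurable[OF prog t that])
  have Gi_meas: "(\<lambda>x. indicator (G (cl (f x))) (g x) :: ennreal) \<in> borel_measurable N"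
    if "f \<in> borel_measurable N" "g \<in> N \<rightarrow>\<^sub>M M" for f g and N :: "'c measure"
    unfolding cl_def by (rule decreasing_events_measurable[OF t G_meas G_anti G_left that])
  define Q where "Q k \<omega> = (sq_int t (\<lambda>s. elementary_value (S k) s \<omega> - H s \<omega>))" for k \<omega>
  \<comment> \<open>Mesh bound for the grid of \<open>S k\<close>. It tends to zero, so the shift of
    \<open>G\<close> disappears in the limit.\<close>
  define \<epsilon> where "\<epsilon> k = 1 / real (Suc k)" for k
  have \<epsilon>_pos: "0 < \<epsilon> k" for k by (simp add: \<epsilon>_def)
  define B where "B k \<omega> = (\<integral>\<^sup>+s\<in>{0..t}. ennreal ((elementary_value (S k) s \<omega>)\<^sup>2)
      * indicator (G (max 0 (s - \<epsilon> k))) \<omega> \<partial>lborel)" for k \<omega>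
  define A where "A k \<omega> = (\<integral>\<^sup>+s. ennreal ((H (cl s) \<omega>)\<^sup>2) * indicator (G (cl (s - \<epsilon> k))) \<omega> * indicator {0..t} s \<partial>lborel)" for k \<omega>
  define AG where "AG \<omega> = (\<integral>\<^sup>+s. ennreal ((H (cl s) \<omega>)\<^sup>2) * indicator (G (cl s)) \<omega> * indicator {0..t} s \<partial>lborel)" for \<omega>
  have AG_eq: "AG \<omega> = (\<integral>\<^sup>+s\<in>{0..t}. ennreal ((H s \<omega>)\<^sup>2) * indicator (G s) \<omega> \<partial>lborel)" for \<omega>
    unfolding AG_def by (intro nn_integral_cong) (auto simp: indicator_def cl)
  have A_meas[measurable]: "A k \<in> borel_measurable M" for k
  proof -
    have [measurable]: "(\<lambda>p. H (cl (snd p)) (fst p)) \<in> borel_measurable (M \<Otimes>\<^sub>M lborel)"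
      "(\<lambda>p. indicator (G (cl (snd p - \<epsilon> k))) (fst p) :: ennreal) \<in> borel_measurable (M \<Otimes>\<^sub>M lborel)"
      by (intro H_meas Gi_meas; measurable)+
    show ?thesis unfolding A_def[abs_def]
      by (intro lborel.borel_measurable_nn_integral) (simp add: split_beta', measurable)
  qed
  have AG_meas[measurable]: "AG \<in> borel_measurable M"
  proof -
    have [measurable]: "(\<lambda>p. H (cl (snd p)) (fst p)) \<in> borel_measurable (M \<Otimes>\<^sub>M lborel)"
      "(\<lambda>p. indicator (G (cl (snd p))) (fst p) :: ennreal) \<in> borel_measurable (M \<Otimes>\<^sub>M lborel)"
      by (intro H_meas Gi_meas; measurable)+
    show ?thesis unfolding AG_def[abs_def]
      by (intro lborel.borel_measurable_nn_integral) (simp add: split_beta', measurable)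
  qed
  have Q_meas'[measurable]: "Q k \<in> borel_measurable M" for k
    using Q_meas by (simp add: Q_def[abs_def])
  have Gt[measurable]: "G t \<in> sets M" using G_meas[OF t] sets_F_M by blast
  \<comment> \<open>From e^2 <= 2 (e - h)^2 + 2 h^2 with the elementary value \<open>e\<close> and
    the integrand \<open>h\<close>; this is the source of the factor \<open>2 ^ m\<close> in the
    statement.\<close>
  have B_le: "B k \<omega> \<le> 2 * Q k \<omega> + 2 * A k \<omega>" if \<omega>: "\<omega> \<in> space M" for k \<omega>
  proof -
    have [measurable]: "(\<lambda>s. H (cl s) \<omega>) \<in> borel_measurable lborel"
      "(\<lambda>s. indicator (G (cl (s - \<epsilon> k))) \<omega> :: ennreal) \<in> borel_measurable lborel"
      using \<omega> by (intro H_meas Gi_meas; measurable)+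
    have "(\<lambda>p. elementary_value (S k) (fst p) (snd p)) \<in> borel_measurable (borel \<Otimes>\<^sub>M M)"
      using elementary_value_measurable[OF S] by (simp add: split_beta')
    from measurable_compose[OF measurable_Pair2'[OF \<omega>] this]
    have [measurable]: "(\<lambda>s. elementary_value (S k) s \<omega>) \<in> borel_measurable lborel" by simp
    have "B k \<omega> \<le> (\<integral>\<^sup>+s. 2 * (ennreal ((elementary_value (S k) s \<omega> - H (cl s) \<omega>)\<^sup>2) * indicator {0..t} s)
        + 2 * (ennreal ((H (cl s) \<omega>)\<^sup>2) * indicator (G (cl (s - \<epsilon> k))) \<omega> * indicator {0..t} s) \<partial>lborel)"
      unfolding B_def
    proof (rule nn_integral_mono)
      fix s :: real
      let ?h = "H (cl s) \<omega>" and ?e = "elementary_value (S k) s \<omega>"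
      have "max 0 (s - \<epsilon> k) = cl (s - \<epsilon> k)" if "s \<in> {0..t}"
        using that \<epsilon>_pos[of k] by (auto simp: cl_def min_def)
      moreover have "ennreal (?e\<^sup>2) \<le> 2 * ennreal ((?e - ?h)\<^sup>2) + 2 * ennreal (?h\<^sup>2)"
      proof -
        have "ennreal (?e\<^sup>2) \<le> ennreal (2 * (?e - ?h)\<^sup>2 + 2 * ?h\<^sup>2)"
          using power2_sum_le[of "?e - ?h" ?h] by (intro ennreal_leI) simp
        then show ?thesis by (simp add: ennreal_plus ennreal_mult)
      qed
      ultimately show "ennreal (?e\<^sup>2) * indicator (G (max 0 (s - \<epsilon> k))) \<omega> * indicator {0..t} s
          \<le> 2 * (ennreal ((?e - ?h)\<^sup>2) * indicator {0..t} s)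
          + 2 * (ennreal (?h\<^sup>2) * indicator (G (cl (s - \<epsilon> k))) \<omega> * indicator {0..t} s)"
        by (auto simp: indicator_def)
    qed
    also have "\<dots> = 2 * (\<integral>\<^sup>+s. ennreal ((elementary_value (S k) s \<omega> - H (cl s) \<omega>)\<^sup>2) * indicator {0..t} s \<partial>lborel)
        + 2 * A k \<omega>"
      unfolding A_def by (simp add: nn_integral_add nn_integral_cmult)
    also have "(\<integral>\<^sup>+s. ennreal ((elementary_value (S k) s \<omega> - H (cl s) \<omega>)\<^sup>2) * indicator {0..t} s \<partial>lborel) = Q k \<omega>"
      unfolding Q_def by (intro nn_integral_cong) (auto simp: indicator_def cl)
    finally show ?thesis .
  qed
  \<comment> \<open>At each time the shifted indicator eventually equals the unshifted one: by
    monotonicity if \<omega> belongs to the event, by left-continuity if it does not, and at time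
    zero because of the clamping.\<close>
  have A_lim: "AE \<omega> in M. (\<lambda>k. A k \<omega>) \<longlonglongrightarrow> AG \<omega>"
    using H_fin
  proof (rule AE_mp, intro AE_I2 impI)
    fix \<omega> assume \<omega>: "\<omega> \<in> space M" and fin: "(sq_int t (\<lambda>s. H s \<omega>)) < \<infinity>"
    have [measurable]: "(\<lambda>s. H (cl s) \<omega>) \<in> borel_measurable lborel"
      "(\<lambda>s. indicator (G (cl s)) \<omega> :: ennreal) \<in> borel_measurable lborel"
      "\<And>k. (\<lambda>s. indicator (G (cl (s - \<epsilon> k))) \<omega> :: ennreal) \<in> borel_measurable lborel"
      using \<omega> by (intro H_meas Gi_meas; measurable)+
    show "(\<lambda>k. A k \<omega>) \<longlonglongrightarrow> AG \<omega>"
      unfolding A_def AG_def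
    proof (rule nn_integral_dominated_convergence[where w="\<lambda>s. ennreal ((H (cl s) \<omega>)\<^sup>2) * indicator {0..t} s"])
      have "(\<integral>\<^sup>+s. ennreal ((H (cl s) \<omega>)\<^sup>2) * indicator {0..t} s \<partial>lborel)
          = (sq_int t (\<lambda>s. H s \<omega>))"
        by (intro nn_integral_cong) (auto simp: indicator_def cl)
      then show "(\<integral>\<^sup>+s. ennreal ((H (cl s) \<omega>)\<^sup>2) * indicator {0..t} s \<partial>lborel) < \<infinity>"
        using fin by simp
      show "AE s in lborel. (\<lambda>k. ennreal ((H (cl s) \<omega>)\<^sup>2) * indicator (G (cl (s - \<epsilon> k))) \<omega> * indicator {0..t} s)
          \<longlonglongrightarrow> ennreal ((H (cl s) \<omega>)\<^sup>2) * indicator (G (cl s)) \<omega> * indicator {0..t} s"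
      proof (intro AE_I2 tendsto_eventually)
        fix s :: real
        have "eventually (\<lambda>k. (\<omega> \<in> G (cl (s - \<epsilon> k))) = (\<omega> \<in> G (cl s))) sequentially" if s: "s \<in> {0..t}"
        proof (cases "\<omega> \<in> G (cl s)")
          case True
          have "cl (s - \<epsilon> k) \<le> cl s" for k
            unfolding cl_def using \<epsilon>_pos[of k] by (intro max.mono min.mono) auto
          then show ?thesis using G_anti[of "cl (s - \<epsilon> _)" "cl s"] cl True by (intro always_eventually) auto
        next
          case False
          show ?thesis
          proof (cases "s = 0")
            case True
            then have "cl (s - \<epsilon> k) = cl s" for k
              using t \<epsilon>_pos[of k] by (simp add: cl_def min_def max_def)
            then show ?thesis by simp
          next
            case s0: False
            then obtain r where r: "0 \<le> r" "r < s" "\<omega> \<notin> G r"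
              using G_left[of s \<omega>] False s cl by auto
            have "\<epsilon> \<longlonglongrightarrow> 0" unfolding \<epsilon>_def by (rule LIMSEQ_Suc[OF lim_const_over_n])
            then have "eventually (\<lambda>k. \<epsilon> k < s - r) sequentially"
              using r by (intro order_tendstoD) auto
            then show ?thesis
            proof eventually_elim
              case (elim k)
              then have "r \<le> cl (s - \<epsilon> k)" using r s by (auto simp: cl_def \<epsilon>_def)
              then show ?case using G_anti[of r "cl (s - \<epsilon> k)"] cl r False by auto
            qed
          qed
        qed
        then have "eventually (\<lambda>k. s \<in> {0..t} \<longrightarrow> (\<omega> \<in> G (cl (s - \<epsilon> k))) = (\<omega> \<in> G (cl s))) sequentially"
          by (cases "s \<in> {0..t}") auto
        then show "eventually (\<lambda>k. ennreal ((H (cl s) \<omega>)\<^sup>2) * indicator (G (cl (s - \<epsilon> k))) \<omega> * indicator {0..t} s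
          = ennreal ((H (cl s) \<omega>)\<^sup>2) * indicator (G (cl s)) \<omega> * indicator {0..t} s) sequentially"
          by eventually_elim (auto simp: indicator_def)
      qed
    qed (measurable, measurable, measurable, auto simp: indicator_def)
  qed
  have AG_fin: "AE \<omega> in M. AG \<omega> < \<infinity>"
    using H_fin
  proof eventually_elim
    case (elim \<omega>)
    have "AG \<omega> \<le> (sq_int t (\<lambda>s. H s \<omega>))"
      unfolding AG_eq by (intro nn_integral_mono) (auto simp: indicator_def)
    then show ?case using elim by simp
  qed
  \<comment> \<open>Where \<open>2 * AG \<omega> < R\<close>, the truncation at \<open>R\<close> is
    eventually inactive along the approximation, so the truncated integrals converge to
    \<open>I\<close> there.\<close>
  define f where "f R \<omega> = ennreal (I \<omega> ^ (2 * m)) * indicator (G t) \<omega> * indicator {\<omega> \<in> space M. 2 * AG \<omega> < of_nat R} \<omega>"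
    for R :: nat and \<omega>
  have f_meas[measurable]: "f R \<in> borel_measurable M" for R
    unfolding f_def[abs_def] by measurable
  let ?rhs = "ennreal (2 ^ m * moment_const m) * (\<integral>\<^sup>+\<omega>. AG \<omega> ^ m \<partial>M)"
  have bound: "(\<integral>\<^sup>+\<omega>. f R \<omega> \<partial>M) \<le> ?rhs" for R
  proof -
    have "\<exists>J. J \<in> borel_measurable M \<and>
        (\<forall>\<omega>. \<omega> \<in> G t \<longrightarrow> B k \<omega> \<le> ennreal (real R) \<longrightarrow> J \<omega> = elementary_integral W (S k) t \<omega>) \<and>
        (\<integral>\<^sup>+\<omega>. ennreal (J \<omega> ^ (2 * m)) \<partial>M)
          \<le> ennreal (moment_const m) * (\<integral>\<^sup>+\<omega>. (min (ennreal (real R)) (B k \<omega>)) ^ m \<partial>M)" for k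
      unfolding B_def
      by (rule truncated_step_approximation[of "S k" t "\<epsilon> k" m "real R" G, OF S t _ m _ G_meas G_anti])
         (auto simp: \<epsilon>_def)
    then obtain J where J_meas[measurable]: "\<And>k. J k \<in> borel_measurable M"
      and J_eq: "\<And>k \<omega>. \<omega> \<in> G t \<Longrightarrow> B k \<omega> \<le> ennreal (real R) \<Longrightarrow> J k \<omega> = elementary_integral W (S k) t \<omega>"
      and J_bound: "\<And>k. (\<integral>\<^sup>+\<omega>. ennreal (J k \<omega> ^ (2 * m)) \<partial>M)
          \<le> ennreal (moment_const m) * (\<integral>\<^sup>+\<omega>. (min (ennreal (real R)) (B k \<omega>)) ^ m \<partial>M)"
      by metis
    have lim: "AE \<omega> in M. (\<lambda>k. 2 * Q k \<omega> + 2 * A k \<omega>) \<longlonglongrightarrow> 2 * AG \<omega>"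
      using Q_lim A_lim
    proof eventually_elim
      case (elim \<omega>)
      then have "(\<lambda>k. 2 * Q k \<omega> + 2 * A k \<omega>) \<longlonglongrightarrow> 2 * 0 + 2 * AG \<omega>"
        by (intro tendsto_add ennreal_tendsto_cmult) (auto simp: Q_def)
      then show ?case by simp
    qed
    have "(\<integral>\<^sup>+\<omega>. f R \<omega> \<partial>M) \<le> (\<integral>\<^sup>+\<omega>. liminf (\<lambda>k. ennreal (J k \<omega> ^ (2 * m))) \<partial>M)"
    proof (rule nn_integral_mono_AE)
      show "AE \<omega> in M. f R \<omega> \<le> liminf (\<lambda>k. ennreal (J k \<omega> ^ (2 * m)))"
        using I_lim lim AE_space
      proof eventually_elim
        case (elim \<omega>)
        show ?case
        proof (cases "\<omega> \<in> G t \<and> 2 * AG \<omega> < of_nat R")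
          case True
          then have "eventually (\<lambda>k. 2 * Q k \<omega> + 2 * A k \<omega> < of_nat R) sequentially"
            using elim(2) by (intro order_tendstoD(2)) auto
          then have "eventually (\<lambda>k. elementary_integral W (S k) t \<omega> = J k \<omega>) sequentially"
          proof eventually_elim
            case (elim k)
            then have "B k \<omega> \<le> ennreal (real R)"
              using order_trans[OF B_le[OF \<open>\<omega> \<in> space M\<close>], of k] by (simp add: ennreal_of_nat_eq_real_of_nat)
            then show ?case using J_eq True by simp
          qed
          then have "(\<lambda>k. J k \<omega>) \<longlonglongrightarrow> I \<omega>"
            using elim(1) by (rule Lim_transform_eventually[rotated])
          then have "(\<lambda>k. ennreal (J k \<omega> ^ (2 * m))) \<longlonglongrightarrow> ennreal (I \<omega> ^ (2 * m))"
            by (intro tendsto_ennrealI tendsto_power)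
          then have "liminf (\<lambda>k. ennreal (J k \<omega> ^ (2 * m))) = ennreal (I \<omega> ^ (2 * m))"
            by (intro lim_imp_Liminf) auto
          then show ?thesis by (auto simp: f_def indicator_def)
        qed (auto simp: f_def)
      qed
    qed
    also have "\<dots> \<le> liminf (\<lambda>k. \<integral>\<^sup>+\<omega>. ennreal (J k \<omega> ^ (2 * m)) \<partial>M)"
      by (rule nn_integral_liminf) measurable
    also have "\<dots> \<le> liminf (\<lambda>k. ennreal (moment_const m) *
        (\<integral>\<^sup>+\<omega>. (min (ennreal (real R)) (2 * Q k \<omega> + 2 * A k \<omega>)) ^ m \<partial>M))"
    proof (intro Liminf_mono always_eventually allI)
      fix k
      have "(\<integral>\<^sup>+\<omega>. (min (ennreal (real R)) (B k \<omega>)) ^ m \<partial>M)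
          \<le> (\<integral>\<^sup>+\<omega>. (min (ennreal (real R)) (2 * Q k \<omega> + 2 * A k \<omega>)) ^ m \<partial>M)"
        using B_le by (intro nn_integral_mono power_mono min.mono) auto
      then show "(\<integral>\<^sup>+\<omega>. ennreal (J k \<omega> ^ (2 * m)) \<partial>M) \<le> ennreal (moment_const m) *
        (\<integral>\<^sup>+\<omega>. (min (ennreal (real R)) (2 * Q k \<omega> + 2 * A k \<omega>)) ^ m \<partial>M)"
        by (intro order_trans[OF J_bound] mult_left_mono) auto
    qed
    \<comment> \<open>Dominated convergence: the cut-off at \<open>R\<close> supplies the constant
      majorant, which is integrable on a probability space.\<close>
    also have "\<dots> = ennreal (moment_const m) * (\<integral>\<^sup>+\<omega>. (min (ennreal (real R)) (2 * AG \<omega>)) ^ m \<partial>M)"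
    proof (intro lim_imp_Liminf ennreal_tendsto_cmult)
      show "(\<lambda>k. \<integral>\<^sup>+\<omega>. (min (ennreal (real R)) (2 * Q k \<omega> + 2 * A k \<omega>)) ^ m \<partial>M)
          \<longlonglongrightarrow> (\<integral>\<^sup>+\<omega>. (min (ennreal (real R)) (2 * AG \<omega>)) ^ m \<partial>M)"
      proof (rule nn_integral_dominated_convergence[where w="\<lambda>_. ennreal (real R) ^ m"])
        show "AE \<omega> in M. (\<lambda>k. (min (ennreal (real R)) (2 * Q k \<omega> + 2 * A k \<omega>)) ^ m)
          \<longlonglongrightarrow> (min (ennreal (real R)) (2 * AG \<omega>)) ^ m"
          using lim
        proof eventually_elim
          case (elim \<omega>)
          then show ?case
            by (intro tendsto_power_ennreal tendsto_min tendsto_const) (auto simp: min_less_iff_disj)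
        qed
        show "(\<integral>\<^sup>+\<omega>. ennreal (real R) ^ m \<partial>M) < \<infinity>"
          by (simp add: emeasure_space_1 ennreal_power)
      qed (auto intro!: AE_I2 power_mono)
    qed auto
    also have "\<dots> \<le> ennreal (moment_const m) * (\<integral>\<^sup>+\<omega>. 2 ^ m * AG \<omega> ^ m \<partial>M)"
    proof (intro mult_left_mono nn_integral_mono)
      fix \<omega>
      have "min (ennreal (real R)) (2 * AG \<omega>) ^ m \<le> (2 * AG \<omega>) ^ m"
        by (intro power_mono) auto
      then show "min (ennreal (real R)) (2 * AG \<omega>) ^ m \<le> 2 ^ m * AG \<omega> ^ m"
        by (simp add: power_mult_distrib)
    qed auto
    also have "\<dots> = ?rhs"
      using moment_const_nonneg[of m]
      by (subst nn_integral_cmult) (simp_all add: ennreal_mult ennreal_power[symmetric] mult_ac)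
    finally show ?thesis .
  qed
  have "(\<integral>\<^sup>+\<omega>. ennreal (I \<omega> ^ (2 * m)) * indicator (G t) \<omega> \<partial>M) \<le> (\<integral>\<^sup>+\<omega>. (SUP R. f R \<omega>) \<partial>M)"
  proof (rule nn_integral_mono_AE)
    show "AE \<omega> in M. ennreal (I \<omega> ^ (2 * m)) * indicator (G t) \<omega> \<le> (SUP R. f R \<omega>)"
      using AG_fin AE_space
    proof eventually_elim
      case (elim \<omega>)
      have "2 * AG \<omega> < \<top>" using elim by (simp add: ennreal_mult_less_top)
      then obtain R :: nat where "2 * AG \<omega> < of_nat R" using ennreal_Ex_less_of_nat by blast
      then have "ennreal (I \<omega> ^ (2 * m)) * indicator (G t) \<omega> = f R \<omega>"
        using elim by (simp add: f_def)
      then show ?case by (auto intro: SUP_upper)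
    qed
  qed
  also have "\<dots> = (SUP R. \<integral>\<^sup>+\<omega>. f R \<omega> \<partial>M)"
  proof (rule nn_integral_monotone_convergence_SUP_AE)
    show "AE \<omega> in M. f R \<omega> \<le> f (Suc R) \<omega>" for R
    proof (rule AE_I2)
      fix \<omega>
      have "2 * AG \<omega> < of_nat R \<Longrightarrow> 2 * AG \<omega> < of_nat (Suc R)"
        by (erule less_le_trans) (simp add: ennreal_of_nat_eq_real_of_nat del: of_nat_Suc)
      then show "f R \<omega> \<le> f (Suc R) \<omega>" unfolding f_def
        by (intro mult_left_mono) (auto simp: indicator_def simp del: of_nat_Suc)
    qed
  qed measurable
  also have "\<dots> \<le> ?rhs" by (intro SUP_least bound)
  finally show ?thesis by (simp add: AG_eq)
qed

end

section \<open>Differences and stopping of Ito integrals\<close>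

text \<open>Measurability is asked on [0, t] only, which is where the sections of a progressive
  process provide it.\<close>

lemma set_nn_integral_square_add_le:
  fixes f g :: "real \<Rightarrow> real"
  assumes [measurable]: "f \<in> borel_measurable (restrict_space borel {0..t})"
    "g \<in> borel_measurable (restrict_space borel {0..t})"
  shows "(sq_int t (\<lambda>s. f s + g s)) \<le>
    2 * (sq_int t f) + 2 * (sq_int t g)"
proof -
  let ?L = "restrict_space lborel {0..t}"
  have [measurable]: "f \<in> borel_measurable ?L" "g \<in> borel_measurable ?L"
    using assms by (simp_all cong: measurable_cong_sets sets_restrict_space_cong)
  have "ennreal ((x + y)\<^sup>2) \<le> 2 * ennreal (x\<^sup>2) + 2 * ennreal (y\<^sup>2)" for x y :: real
  proof -
    have "ennreal ((x + y)\<^sup>2) \<le> ennreal (2 * x\<^sup>2 + 2 * y\<^sup>2)"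
      by (intro ennreal_leI power2_sum_le)
    then show ?thesis by (simp add: ennreal_plus ennreal_mult)
  qed
  then have "(\<integral>\<^sup>+s. ennreal ((f s + g s)\<^sup>2) \<partial>?L)
      \<le> (\<integral>\<^sup>+s. 2 * ennreal ((f s)\<^sup>2) + 2 * ennreal ((g s)\<^sup>2) \<partial>?L)"
    by (intro nn_integral_mono)
  also have "\<dots> = 2 * (\<integral>\<^sup>+s. ennreal ((f s)\<^sup>2) \<partial>?L) + 2 * (\<integral>\<^sup>+s. ennreal ((g s)\<^sup>2) \<partial>?L)"
    by (simp add: nn_integral_add nn_integral_cmult)
  finally show ?thesis by (simp add: nn_integral_restrict_space)
qed

lemma elementary_value_append [simp]:
  "elementary_value (S @ S') s \<omega> = elementary_value S s \<omega> + elementary_value S' s \<omega>"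
  by (simp add: elementary_value_def)

lemma elementary_integral_append [simp]:
  "elementary_integral W (S @ S') t \<omega> = elementary_integral W S t \<omega> + elementary_integral W S' t \<omega>"
  by (simp add: elementary_integral_def)

definition elementary_uminus :: "'a elementary \<Rightarrow> 'a elementary" where
  "elementary_uminus S = map (\<lambda>(a, b, \<xi>). (a, b, \<lambda>\<omega>. - \<xi> \<omega>)) S"

lemma elementary_value_uminus [simp]:
  "elementary_value (elementary_uminus S) s \<omega> = - elementary_value S s \<omega>"
  by (induction S) (auto simp: elementary_uminus_def elementary_value_def)

lemma elementary_integral_uminus [simp]:
  "elementary_integral W (elementary_uminus S) t \<omega> = - elementary_integral W S t \<omega>"
  by (induction S) (auto simp: elementary_uminus_def elementary_integral_def)

text \<open>The outer \<open>max a\<close> turns an interval that starts after \<open>s\<close> into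
  an empty one instead of reversing its endpoints.\<close>

definition elementary_stop :: "real \<Rightarrow> 'a elementary \<Rightarrow> 'a elementary" where
  "elementary_stop s S = map (\<lambda>(a, b, \<xi>). (a, max a (min b s), \<xi>)) S"

lemma elementary_value_stop:
  "elementary_value (elementary_stop s S) r \<omega> = elementary_value S r \<omega> * indicator {..s} r"
  by (induction S) (auto simp: elementary_stop_def elementary_value_def indicator_def distrib_right)

lemma elementary_integral_stop:
  assumes "s \<le> t" "\<And>a b \<xi>. (a, b, \<xi>) \<in> set S \<Longrightarrow> a \<le> b"
  shows "elementary_integral W (elementary_stop s S) t \<omega> = elementary_integral W S s \<omega>"
  using assms(2)
proof (induction S)
  case (Cons x S)
  obtain a b \<xi> where x: "x = (a, b, \<xi>)" by (cases x)
  have ab: "a \<le> b" using Cons.prems[of a b \<xi>] by (auto simp: x)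
  have IH: "elementary_integral W (elementary_stop s S) t \<omega> = elementary_integral W S s \<omega>"
    by (rule Cons.IH) (use Cons.prems in auto)
  have "W (min (max a (min b s)) t) \<omega> - W (min a t) \<omega> = W (min b s) \<omega> - W (min a s) \<omega>"
  proof (cases "a \<le> s")
    case True
    then have "min (max a (min b s)) t = min b s" "min a t = min a s"
      using assms(1) ab by linarith+
    then show ?thesis by simp
  next
    case False
    then have "max a (min b s) = a" "min b s = s" "min a s = s" using ab by linarith+
    then show ?thesis by simp
  qed
  then show ?case using IH by (simp add: x elementary_stop_def)
qed (simp add: elementary_stop_def)

context brownian_space
begin

lemma elementary_process_append:
  "elementary_process F S \<Longrightarrow> elementary_process F S' \<Longrightarrow> elementary_process F (S @ S')"
  by (auto simp: elementary_process_def)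

lemma elementary_process_Cons_iff: "elementary_process F ((a, b, \<xi>) # S) \<longleftrightarrow>
    0 \<le> a \<and> a \<le> b \<and> \<xi> \<in> borel_measurable (F a) \<and> bounded (\<xi> ` space (F a)) \<and> elementary_process F S"
  by (simp add: elementary_process_def)

lemma elementary_process_uminus:
  "elementary_process F S \<Longrightarrow> elementary_process F (elementary_uminus S)"
proof (induction S)
  case (Cons x S)
  obtain a b \<xi> where x: "x = (a, b, \<xi>)" by (cases x)
  have "elementary_process F (elementary_uminus S)" "0 \<le> a" "a \<le> b"
    "\<xi> \<in> borel_measurable (F a)" "bounded (\<xi> ` space (F a))"
    using Cons by (simp_all add: x elementary_process_Cons_iff)
  moreover from this have "bounded ((\<lambda>\<omega>. - \<xi> \<omega>) ` space (F a))" by (simp add: bounded_iff)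
  moreover have "elementary_uminus (x # S) = (a, b, \<lambda>\<omega>. - \<xi> \<omega>) # elementary_uminus S"
    by (simp add: elementary_uminus_def x)
  moreover have "(\<lambda>\<omega>. - \<xi> \<omega>) \<in> borel_measurable (F a)"
    using calculation(4) by (rule borel_measurable_uminus)
  ultimately show ?case by (simp only: elementary_process_Cons_iff simp_thms)
qed (simp add: elementary_process_def elementary_uminus_def)

lemma elementary_process_stop:
  "elementary_process F S \<Longrightarrow> elementary_process F (elementary_stop s S)"
proof (induction S)
  case (Cons x S)
  obtain a b \<xi> where x: "x = (a, b, \<xi>)" by (cases x)
  have "elementary_stop s (x # S) = (a, max a (min b s), \<xi>) # elementary_stop s S"
    by (simp add: elementary_stop_def x)
  then show ?case using Cons by (simp add: x elementary_process_Cons_iff)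
qed (simp add: elementary_process_def elementary_stop_def)

lemma progressive_section:
  assumes "progressive F T X" "0 \<le> T" "\<omega> \<in> space M"
  shows "(\<lambda>s. X s \<omega>) \<in> borel_measurable (restrict_space borel {0..T})"
proof -
  have X: "(\<lambda>(s, \<omega>). X s \<omega>) \<in> borel_measurable (restrict_space borel {0..T} \<Otimes>\<^sub>M F T)"
    using assms(1,2) by (simp add: progressive_def)
  have "(\<lambda>s. (s, \<omega>)) \<in> restrict_space borel {0..T} \<rightarrow>\<^sub>M restrict_space borel {0..T} \<Otimes>\<^sub>M F T"
    using assms(3) by (intro measurable_Pair2') (simp add: space_F)
  from measurable_compose[OF this X] show ?thesis by simp
qed

lemma elementary_value_section:
  assumes "elementary_process F S" "\<omega> \<in> space M"
  shows "(\<lambda>s. elementary_value S s \<omega>) \<in> borel_measurable borel"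
  using measurable_compose[OF measurable_Pair2'[OF assms(2)] elementary_value_measurable[OF assms(1)]]
  by simp

lemma progressive_diff:
  "progressive F T X \<Longrightarrow> progressive F T Y \<Longrightarrow> progressive F T (\<lambda>s \<omega>. X s \<omega> - Y s \<omega>)"
  by (auto simp: progressive_def split_beta' intro!: borel_measurable_diff)

text \<open>Up to time \<open>t'\<close> only values at times up to \<open>min s t'\<close> enter.
  They are measurable for the sigma-algebra at that time, which is contained in the one at
  \<open>t'\<close>.\<close>

lemma progressive_stop:
  assumes "progressive F s X" "0 \<le> s"
  shows "progressive F t (\<lambda>r \<omega>. X r \<omega> * indicator {..s} r)"
  unfolding progressive_def
proof
  fix t' assume t': "t' \<in> {0..t}"
  let ?N = "restrict_space borel {0..t'} \<Otimes>\<^sub>M F t'"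
  define s' where "s' = min s t'"
  have s': "0 \<le> s'" "s' \<le> s" "s' \<le> t'" using assms(2) t' by (auto simp: s'_def)
  have X: "(\<lambda>(s, \<omega>). X s \<omega>) \<in> borel_measurable (restrict_space borel {0..s'} \<Otimes>\<^sub>M F s')"
    using assms(1) s' by (simp add: progressive_def)
  have "(\<lambda>p. (max 0 (min (fst p) s'), snd p)) \<in> ?N \<rightarrow>\<^sub>M restrict_space borel {0..s'} \<Otimes>\<^sub>M F s'"
  proof (intro measurable_Pair measurable_restrict_space2)
    have "fst \<in> borel_measurable ?N"
      by (rule measurable_compose[OF measurable_fst]) (simp add: measurable_restrict_space1)
    then show "(\<lambda>p. max 0 (min (fst p) s')) \<in> borel_measurable ?N" by measurable
    show "snd \<in> ?N \<rightarrow>\<^sub>M F s'"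
      using measurable_snd[of "restrict_space borel {0..t'}" "F t'"] sets_F_mono[OF s'(3)]
      by (auto simp: measurable_def space_F)
  qed (use s' in auto)
  from measurable_compose[OF this X]
  have "(\<lambda>p. X (max 0 (min (fst p) s')) (snd p)) \<in> borel_measurable ?N" by simp
  moreover have "(\<lambda>p. indicator {..s} (fst p) :: real) \<in> borel_measurable ?N"
    by (rule measurable_compose[OF measurable_fst]) (simp add: measurable_restrict_space1)
  ultimately have "(\<lambda>p. X (max 0 (min (fst p) s')) (snd p) * indicator {..s} (fst p)) \<in> borel_measurable ?N"
    by (rule borel_measurable_times)
  then show "(\<lambda>(r, \<omega>). X r \<omega> * indicator {..s} r) \<in> borel_measurable ?N"
    by (rule subst[OF measurable_cong, rotated -1])
       (auto simp: space_pair_measure indicator_def s'_def)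
qed

lemma has_ito_integral_diff:
  assumes t: "0 \<le> t" and ito1: "has_ito_integral M F W H1 t I1" and ito2: "has_ito_integral M F W H2 t I2"
  shows "has_ito_integral M F W (\<lambda>s \<omega>. H1 s \<omega> - H2 s \<omega>) t (\<lambda>\<omega>. I1 \<omega> - I2 \<omega>)"
proof -
  have prog: "progressive F t H1" "progressive F t H2"
    and [measurable]: "I1 \<in> borel_measurable M" "I2 \<in> borel_measurable M"
    and fin: "AE \<omega> in M. (sq_int t (\<lambda>s. H1 s \<omega>)) < \<infinity>"
      "AE \<omega> in M. (sq_int t (\<lambda>s. H2 s \<omega>)) < \<infinity>"
    using ito1 ito2 by (auto simp: has_ito_integral_def)
  obtain S1 where S1: "\<And>n. elementary_process F (S1 n)"
    and Q1: "\<And>\<epsilon>. 0 < \<epsilon> \<Longrightarrow> (\<lambda>n. measure M {\<omega> \<in> space M.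
            (sq_int t (\<lambda>s. elementary_value (S1 n) s \<omega> - H1 s \<omega>)) > ennreal \<epsilon>}) \<longlonglongrightarrow> 0"
    and J1: "\<And>\<epsilon>. 0 < \<epsilon> \<Longrightarrow> (\<lambda>n. measure M {\<omega> \<in> space M. \<bar>elementary_integral W (S1 n) t \<omega> - I1 \<omega>\<bar> > \<epsilon>}) \<longlonglongrightarrow> 0"
    using ito1 unfolding has_ito_integral_def by blast
  obtain S2 where S2: "\<And>n. elementary_process F (S2 n)"
    and Q2: "\<And>\<epsilon>. 0 < \<epsilon> \<Longrightarrow> (\<lambda>n. measure M {\<omega> \<in> space M.
            (sq_int t (\<lambda>s. elementary_value (S2 n) s \<omega> - H2 s \<omega>)) > ennreal \<epsilon>}) \<longlonglongrightarrow> 0"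
    and J2: "\<And>\<epsilon>. 0 < \<epsilon> \<Longrightarrow> (\<lambda>n. measure M {\<omega> \<in> space M. \<bar>elementary_integral W (S2 n) t \<omega> - I2 \<omega>\<bar> > \<epsilon>}) \<longlonglongrightarrow> 0"
    using ito2 unfolding has_ito_integral_def by blast
  define S where "S n = S1 n @ elementary_uminus (S2 n)" for n
  have val: "elementary_value (S n) s \<omega> = elementary_value (S1 n) s \<omega> - elementary_value (S2 n) s \<omega>" for n s \<omega>
    by (simp add: S_def)
  have integ: "elementary_integral W (S n) t \<omega> = elementary_integral W (S1 n) t \<omega> - elementary_integral W (S2 n) t \<omega>" for n \<omega>
    by (simp add: S_def)
  have union_bound: "(\<lambda>n. measure M {\<omega> \<in> space M. P n \<omega>}) \<longlonglongrightarrow> 0"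
    if lim: "(\<lambda>n. measure M {\<omega> \<in> space M. P1 n \<omega>}) \<longlonglongrightarrow> 0" "(\<lambda>n. measure M {\<omega> \<in> space M. P2 n \<omega>}) \<longlonglongrightarrow> 0"
      and imp: "\<And>n \<omega>. \<omega> \<in> space M \<Longrightarrow> P n \<omega> \<Longrightarrow> P1 n \<omega> \<or> P2 n \<omega>"
      and [measurable]: "\<And>n. Measurable.pred M (P1 n)" "\<And>n. Measurable.pred M (P2 n)"
    for P P1 P2 :: "nat \<Rightarrow> 'a \<Rightarrow> bool"
  proof (rule tendsto_sandwich[OF _ _ tendsto_const])
    show "(\<lambda>n. measure M {\<omega> \<in> space M. P1 n \<omega>} + measure M {\<omega> \<in> space M. P2 n \<omega>}) \<longlonglongrightarrow> 0"
      using tendsto_add[OF lim] by simp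
    have "measure M {\<omega> \<in> space M. P n \<omega>} \<le> measure M {\<omega> \<in> space M. P1 n \<omega>} + measure M {\<omega> \<in> space M. P2 n \<omega>}" for n
    proof -
      have "measure M {\<omega> \<in> space M. P n \<omega>} \<le> measure M ({\<omega> \<in> space M. P1 n \<omega>} \<union> {\<omega> \<in> space M. P2 n \<omega>})"
        using imp by (intro finite_measure_mono) auto
      also have "\<dots> \<le> measure M {\<omega> \<in> space M. P1 n \<omega>} + measure M {\<omega> \<in> space M. P2 n \<omega>}"
        by (rule measure_Un_le) measurable
      finally show ?thesis .
    qed
    then show "\<forall>\<^sub>F n in sequentially. measure M {\<omega> \<in> space M. P n \<omega>}
        \<le> measure M {\<omega> \<in> space M. P1 n \<omega>} + measure M {\<omega> \<in> space M. P2 n \<omega>}"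
      by (intro always_eventually) blast
  qed simp
  show ?thesis
    unfolding has_ito_integral_def
  proof (intro conjI exI[of _ S] allI impI)
    show "progressive F t (\<lambda>s \<omega>. H1 s \<omega> - H2 s \<omega>)" using prog by (rule progressive_diff)
    show "(\<lambda>\<omega>. I1 \<omega> - I2 \<omega>) \<in> borel_measurable M" by measurable
    show "elementary_process F (S n)" for n
      unfolding S_def by (intro elementary_process_append elementary_process_uminus S1 S2)
    show "AE \<omega> in M. (sq_int t (\<lambda>s. H1 s \<omega> - H2 s \<omega>)) < \<infinity>"
      using fin AE_space
    proof eventually_elim
      case (elim \<omega>)
      have [measurable]: "(\<lambda>s. H1 s \<omega>) \<in> borel_measurable (restrict_space borel {0..t})"
        "(\<lambda>s. H2 s \<omega>) \<in> borel_measurable (restrict_space borel {0..t})"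
        using progressive_section prog t elim by blast+
      have "(sq_int t (\<lambda>s. H1 s \<omega> + - H2 s \<omega>))
          \<le> 2 * (sq_int t (\<lambda>s. H1 s \<omega>)) + 2 * (sq_int t (\<lambda>s. - H2 s \<omega>))"
        by (rule set_nn_integral_square_add_le) measurable
      also have "\<dots> < \<infinity>" using elim by (simp add: ennreal_mult_less_top)
      finally show ?case by simp
    qed
    fix \<epsilon> :: real assume \<epsilon>: "0 < \<epsilon>"
    show "(\<lambda>n. measure M {\<omega> \<in> space M. \<epsilon> < \<bar>elementary_integral W (S n) t \<omega> - (I1 \<omega> - I2 \<omega>)\<bar>}) \<longlonglongrightarrow> 0"
    proof (rule union_bound[OF J1[of "\<epsilon> / 2"] J2[of "\<epsilon> / 2"]])
      have [measurable]: "elementary_integral W (S1 n) t \<in> borel_measurable M" "elementary_integral W (S2 n) t \<in> borel_measurable M" for n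
        by (intro elementary_integral_measurable S1 S2 t)+
      show "Measurable.pred M (\<lambda>\<omega>. \<epsilon> / 2 < \<bar>elementary_integral W (S1 n) t \<omega> - I1 \<omega>\<bar>)"
        "Measurable.pred M (\<lambda>\<omega>. \<epsilon> / 2 < \<bar>elementary_integral W (S2 n) t \<omega> - I2 \<omega>\<bar>)" for n
        by measurable
      show "\<epsilon> / 2 < \<bar>elementary_integral W (S1 n) t \<omega> - I1 \<omega>\<bar> \<or> \<epsilon> / 2 < \<bar>elementary_integral W (S2 n) t \<omega> - I2 \<omega>\<bar>"
        if "\<epsilon> < \<bar>elementary_integral W (S n) t \<omega> - (I1 \<omega> - I2 \<omega>)\<bar>" for n \<omega>
        using that unfolding integ by arith
    qed (use \<epsilon> in auto)
    show "(\<lambda>n. measure M {\<omega> \<in> space M. ennreal \<epsilon> < (sq_int t (\<lambda>s. elementary_value (S n) s \<omega> - (H1 s \<omega> - H2 s \<omega>)))}) \<longlonglongrightarrow> 0"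
    \<comment> \<open>The square of a sum costs a factor two for each summand, so each of the two
      errors is allowed a quarter of \<epsilon>.\<close>
    proof (rule union_bound[OF Q1[of "\<epsilon> / 4"] Q2[of "\<epsilon> / 4"]])
      note [measurable] = approximation_error_measurable[OF S1 prog(1) t] approximation_error_measurable[OF S2 prog(2) t]
      show "Measurable.pred M (\<lambda>\<omega>. ennreal (\<epsilon> / 4) < (sq_int t (\<lambda>s. elementary_value (S1 n) s \<omega> - H1 s \<omega>)))"
        "Measurable.pred M (\<lambda>\<omega>. ennreal (\<epsilon> / 4) < (sq_int t (\<lambda>s. elementary_value (S2 n) s \<omega> - H2 s \<omega>)))" for n
        by measurable
      fix n \<omega>
      let ?q1 = "sq_int t (\<lambda>s. elementary_value (S1 n) s \<omega> - H1 s \<omega>)"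
      let ?q2 = "sq_int t (\<lambda>s. elementary_value (S2 n) s \<omega> - H2 s \<omega>)"
      assume \<omega>: "\<omega> \<in> space M" and less: "ennreal \<epsilon> < (sq_int t (\<lambda>s. elementary_value (S n) s \<omega> - (H1 s \<omega> - H2 s \<omega>)))"
      have [measurable]: "(\<lambda>s. H1 s \<omega>) \<in> borel_measurable (restrict_space borel {0..t})"
        "(\<lambda>s. H2 s \<omega>) \<in> borel_measurable (restrict_space borel {0..t})"
        using progressive_section prog t \<omega> by blast+
      have [measurable]: "(\<lambda>s. elementary_value (S1 n) s \<omega>) \<in> borel_measurable (restrict_space borel {0..t})"
        "(\<lambda>s. elementary_value (S2 n) s \<omega>) \<in> borel_measurable (restrict_space borel {0..t})"
        by (intro measurable_restrict_space1 elementary_value_section S1 S2 \<omega>)+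
      have eq: "elementary_value (S1 n) s \<omega> - H1 s \<omega> + - (elementary_value (S2 n) s \<omega> - H2 s \<omega>)
          = elementary_value (S n) s \<omega> - (H1 s \<omega> - H2 s \<omega>)" for s
        by (simp add: val)
      have "(sq_int t (\<lambda>s. elementary_value (S1 n) s \<omega> - H1 s \<omega> + - (elementary_value (S2 n) s \<omega> - H2 s \<omega>)))
          \<le> 2 * ?q1 + 2 * (sq_int t (\<lambda>s. - (elementary_value (S2 n) s \<omega> - H2 s \<omega>)))"
        by (rule set_nn_integral_square_add_le) measurable
      then have "(sq_int t (\<lambda>s. elementary_value (S n) s \<omega> - (H1 s \<omega> - H2 s \<omega>))) \<le> 2 * ?q1 + 2 * ?q2"
        unfolding power2_minus eq .
      with less have lt: "ennreal \<epsilon> < 2 * ?q1 + 2 * ?q2" by (rule less_le_trans)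
      show "ennreal (\<epsilon> / 4) < ?q1 \<or> ennreal (\<epsilon> / 4) < ?q2"
      proof (rule ccontr)
        assume "\<not> (ennreal (\<epsilon> / 4) < ?q1 \<or> ennreal (\<epsilon> / 4) < ?q2)"
        then have "2 * ?q1 + 2 * ?q2 \<le> 2 * ennreal (\<epsilon> / 4) + 2 * ennreal (\<epsilon> / 4)"
          by (intro add_mono mult_left_mono) (auto simp: not_less)
        also have "\<dots> = ennreal 2 * ennreal (\<epsilon> / 4) + ennreal 2 * ennreal (\<epsilon> / 4)" by simp
        also have "\<dots> = ennreal \<epsilon>"
          using \<epsilon> by (subst (1 2) ennreal_mult[symmetric]) (auto simp flip: ennreal_plus)
        finally show False using lt by simp
      qed
    qed (use \<epsilon> in auto)
  qed
qed

text \<open>Integrals up to different times become integrals over one interval, so that the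
  increment of a convolution between \<open>s\<close> and \<open>t\<close> is again a single Ito
  integral, governed by the increment of the kernel.\<close>

lemma has_ito_integral_stop:
  assumes s: "0 \<le> s" "s \<le> t" and ito: "has_ito_integral M F W H s I"
  shows "has_ito_integral M F W (\<lambda>r \<omega>. H r \<omega> * indicator {..s} r) t I"
proof -
  obtain S where S: "\<And>n. elementary_process F (S n)"
    and Q: "\<And>\<epsilon>. 0 < \<epsilon> \<Longrightarrow> (\<lambda>n. measure M {\<omega> \<in> space M.
            (sq_int s (\<lambda>r. elementary_value (S n) r \<omega> - H r \<omega>)) > ennreal \<epsilon>}) \<longlonglongrightarrow> 0"
    and J: "\<And>\<epsilon>. 0 < \<epsilon> \<Longrightarrow> (\<lambda>n. measure M {\<omega> \<in> space M. \<bar>elementary_integral W (S n) s \<omega> - I \<omega>\<bar> > \<epsilon>}) \<longlonglongrightarrow> 0"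
    and prog: "progressive F s H" and I: "I \<in> borel_measurable M"
    and fin: "AE \<omega> in M. (sq_int s (\<lambda>r. H r \<omega>)) < \<infinity>"
    using ito unfolding has_ito_integral_def by blast
  have eq: "(sq_int t (\<lambda>r. f r * indicator {..s} r)) = (sq_int s f)"
    for f :: "real \<Rightarrow> real"
    using s by (intro nn_integral_cong) (auto simp: indicator_def)
  have "elementary_integral W (elementary_stop s (S n)) t \<omega> = elementary_integral W (S n) s \<omega>" for n \<omega>
    using elementary_processD(2)[OF S] s by (intro elementary_integral_stop) auto
  then show ?thesis
    unfolding has_ito_integral_def
    using progressive_stop[OF prog s(1)] I fin S Q J elementary_process_stop
    by (intro conjI exI[of _ "\<lambda>n. elementary_stop s (S n)"])
       (simp_all add: eq elementary_value_stop left_diff_distrib[symmetric])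
qed

end

section \<open>Kernels and convolution inequalities\<close>

lemma mult_power_rearrangement_ennreal:
  fixes a b :: ennreal
  shows "a * b ^ m + b * a ^ m \<le> a ^ Suc m + b ^ Suc m"
proof -
  have *: "a * b ^ m + b * a ^ m \<le> a ^ Suc m + b ^ Suc m" if "a \<le> b" for a b :: ennreal
  proof -
    \<comment> \<open>The claim is (a - b) (a^m - b^m) >= 0. Writing \<open>b\<close> as
      \<open>a + d\<close> avoids subtraction, which is truncated here and could meet
      infinity.\<close>
    define d where "d = b - a"
    have b: "b = a + d" unfolding d_def by (rule ennreal_ineq_diff_add[OF that])
    have "a * b ^ m + b * a ^ m = a * b ^ m + a ^ Suc m + d * a ^ m"
      unfolding b by (simp add: algebra_simps)
    also have "\<dots> \<le> a * b ^ m + a ^ Suc m + d * b ^ m"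
      using that by (intro add_mono mult_left_mono power_mono) auto
    also have "\<dots> = a ^ Suc m + (a + d) * b ^ m" by (simp add: algebra_simps)
    finally show ?thesis by (simp add: b)
  qed
  show ?thesis
    using *[of a b] *[of b a] by (cases "a \<le> b") (auto simp: add.commute not_le)
qed

text \<open>Integrate the rearrangement inequality for \<open>h x\<close> and \<open>h y\<close>
  against the weight \<open>k x * k y\<close>; each side becomes twice a product of single
  integrals.\<close>

lemma nn_integral_Chebyshev:
  assumes [measurable]: "k \<in> borel_measurable M" "h \<in> borel_measurable M"
  shows "(\<integral>\<^sup>+x. k x * h x \<partial>M) * (\<integral>\<^sup>+x. k x * h x ^ m \<partial>M)
    \<le> (\<integral>\<^sup>+x. k x \<partial>M) * (\<integral>\<^sup>+x. k x * h x ^ Suc m \<partial>M)"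
proof -
  define A where "A = (\<integral>\<^sup>+x. k x * h x \<partial>M)"
  define B where "B = (\<integral>\<^sup>+x. k x * h x ^ m \<partial>M)"
  define K where "K = (\<integral>\<^sup>+x. k x \<partial>M)"
  define C where "C = (\<integral>\<^sup>+x. k x * h x ^ Suc m \<partial>M)"
  have "(\<integral>\<^sup>+x. \<integral>\<^sup>+y. k x * k y * (h x * h y ^ m + h y * h x ^ m) \<partial>M \<partial>M)
      = (\<integral>\<^sup>+x. \<integral>\<^sup>+y. (k x * h x) * (k y * h y ^ m) + (k x * h x ^ m) * (k y * h y) \<partial>M \<partial>M)"
    by (intro nn_integral_cong) (simp add: distrib_left mult_ac)
  also have "\<dots> = (\<integral>\<^sup>+x. (k x * h x) * B + (k x * h x ^ m) * A \<partial>M)"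
    unfolding A_def B_def by (simp add: nn_integral_add nn_integral_cmult)
  also have "\<dots> = A * B + B * A"
    by (simp add: nn_integral_add nn_integral_multc A_def[symmetric] B_def[symmetric])
  finally have 1: "(\<integral>\<^sup>+x. \<integral>\<^sup>+y. k x * k y * (h x * h y ^ m + h y * h x ^ m) \<partial>M \<partial>M) = A * B + B * A" .
  have "(\<integral>\<^sup>+x. \<integral>\<^sup>+y. k x * k y * (h x ^ Suc m + h y ^ Suc m) \<partial>M \<partial>M)
      = (\<integral>\<^sup>+x. \<integral>\<^sup>+y. (k x * h x ^ Suc m) * k y + k x * (k y * h y ^ Suc m) \<partial>M \<partial>M)"
    by (intro nn_integral_cong) (simp add: distrib_left mult_ac)
  also have "\<dots> = (\<integral>\<^sup>+x. (k x * h x ^ Suc m) * K + k x * C \<partial>M)"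
    unfolding K_def C_def by (simp add: nn_integral_add nn_integral_cmult del: power_Suc)
  also have "\<dots> = C * K + K * C"
    by (simp add: nn_integral_add nn_integral_multc K_def[symmetric] C_def[symmetric] del: power_Suc)
  finally have 2: "(\<integral>\<^sup>+x. \<integral>\<^sup>+y. k x * k y * (h x ^ Suc m + h y ^ Suc m) \<partial>M \<partial>M) = C * K + K * C" .
  have "A * B + B * A \<le> C * K + K * C"
    unfolding 1[symmetric] 2[symmetric]
    by (intro nn_integral_mono mult_left_mono mult_power_rearrangement_ennreal) auto
  then have "2 * (A * B) \<le> 2 * (K * C)" by (simp only: mult_2 mult.commute[of B A] mult.commute[of C K])
  then have "A * B \<le> K * C" by (subst (asm) ennreal_mult_le_mult_iff) auto
  then show ?thesis by (simp add: A_def B_def K_def C_def)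
qed

text \<open>Jensen's inequality for the measure with density \<open>k\<close>, without normalisation
  and with infinite values allowed. Chebyshev's inequality raises the exponent by one at each step
  of the induction.\<close>

lemma nn_integral_power_le:
  assumes [measurable]: "k \<in> borel_measurable M" "h \<in> borel_measurable M"
  shows "(\<integral>\<^sup>+x. k x * h x \<partial>M) ^ Suc n \<le> (\<integral>\<^sup>+x. k x \<partial>M) ^ n * (\<integral>\<^sup>+x. k x * h x ^ Suc n \<partial>M)"
proof (induction n)
  case (Suc n)
  have "(\<integral>\<^sup>+x. k x * h x \<partial>M) ^ Suc (Suc n)
      \<le> (\<integral>\<^sup>+x. k x * h x \<partial>M) * ((\<integral>\<^sup>+x. k x \<partial>M) ^ n * (\<integral>\<^sup>+x. k x * h x ^ Suc n \<partial>M))"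
    unfolding power_Suc[of _ "Suc n"] by (intro mult_left_mono Suc) simp
  also have "\<dots> = (\<integral>\<^sup>+x. k x \<partial>M) ^ n * ((\<integral>\<^sup>+x. k x * h x \<partial>M) * (\<integral>\<^sup>+x. k x * h x ^ Suc n \<partial>M))"
    by (simp only: mult_ac)
  also have "\<dots> \<le> (\<integral>\<^sup>+x. k x \<partial>M) ^ n * ((\<integral>\<^sup>+x. k x \<partial>M) * (\<integral>\<^sup>+x. k x * h x ^ Suc (Suc n) \<partial>M))"
    by (intro mult_left_mono nn_integral_Chebyshev) auto
  also have "\<dots> = (\<integral>\<^sup>+x. k x \<partial>M) ^ Suc n * (\<integral>\<^sup>+x. k x * h x ^ Suc (Suc n) \<partial>M)"
    by (simp only: power_Suc mult_ac)
  finally show ?case .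
qed simp

section \<open>Square integrals of kernels in L^gamma\<close>

lemma set_nn_integral_reflect:
  fixes \<phi> :: "real \<Rightarrow> ennreal"
  assumes [measurable]: "(\<lambda>u. \<phi> u * indicator {a..b} u) \<in> borel_measurable borel"
  shows "(\<integral>\<^sup>+s\<in>{t - b..t - a}. \<phi> (t - s) \<partial>lborel) = (\<integral>\<^sup>+u\<in>{a..b}. \<phi> u \<partial>lborel)"
proof -
  have "(\<integral>\<^sup>+u\<in>{a..b}. \<phi> u \<partial>lborel) = (\<integral>\<^sup>+s. \<phi> (t - s) * indicator {a..b} (t - s) \<partial>lborel)"
    using nn_integral_real_affine[of "\<lambda>u. \<phi> u * indicator {a..b} u" "-1" t] by simp
  also have "\<dots> = (\<integral>\<^sup>+s\<in>{t - b..t - a}. \<phi> (t - s) \<partial>lborel)"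
    by (intro nn_integral_cong) (auto simp: indicator_def)
  finally show ?thesis by simp
qed

text \<open>A threshold replaces Hoelder's inequality: above \<open>A\<close>, the square is the
  power \<gamma> times a negative power that is largest at \<open>A\<close>. Choosing
  \<open>A\<close> afterwards recovers the Hoelder exponent, and the pointwise bound also serves
  weighted integrals.\<close>

lemma power2_le_powr_split:
  fixes x A \<gamma> :: real
  assumes "0 < A" "2 < \<gamma>"
  shows "x\<^sup>2 \<le> A powr (2 - \<gamma>) * \<bar>x\<bar> powr \<gamma> + A\<^sup>2"
proof (cases "\<bar>x\<bar> \<le> A")
  case True
  then have "x\<^sup>2 \<le> A\<^sup>2" using power_mono[of "\<bar>x\<bar>" A 2] by simp
  then show ?thesis by (simp add: add_increasing)
next
  case False
  then have x: "A < \<bar>x\<bar>" "0 < \<bar>x\<bar>" using assms by auto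
  have "x\<^sup>2 = \<bar>x\<bar> powr 2" using x by (simp add: powr_numeral)
  also have "\<dots> = \<bar>x\<bar> powr (2 - \<gamma>) * \<bar>x\<bar> powr \<gamma>"
    using x by (simp add: powr_add[symmetric])
  also have "\<dots> \<le> A powr (2 - \<gamma>) * \<bar>x\<bar> powr \<gamma>"
    using x assms by (intro mult_right_mono powr_mono2') auto
  finally show ?thesis by (simp add: add_increasing2)
qed

lemma in_L_measurable:
  assumes "in_L \<gamma> T K"
  shows "(\<lambda>u. K u * indicator {0..T} u) \<in> borel_measurable borel"
  using assms by (simp add: in_L_def set_borel_measurable_def mult.commute)

lemma in_L_square_measurable:
  assumes "in_L \<gamma> T K" "0 \<le> a" "b \<le> T"
  shows "(\<lambda>u. ennreal ((K u)\<^sup>2) * indicator {a..b} u) \<in> borel_measurable borel"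
proof -
  note [measurable] = in_L_measurable[OF assms(1)]
  have "(\<lambda>u. ennreal ((K u)\<^sup>2) * indicator {a..b} u)
      = (\<lambda>u. ennreal ((K u * indicator {0..T} u)\<^sup>2) * indicator {a..b} u)"
    using assms by (auto simp: indicator_def fun_eq_iff)
  also have "\<dots> \<in> borel_measurable borel" by measurable
  finally show ?thesis .
qed

lemma L_norm_nonneg: "0 \<le> L_norm \<gamma> T K"
  by (simp add: L_norm_def)

lemma nn_integral_powr_L_norm:
  assumes "in_L \<gamma> T K" "0 < \<gamma>"
  shows "(\<integral>\<^sup>+u\<in>{0..T}. ennreal (\<bar>K u\<bar> powr \<gamma>) \<partial>lborel) = ennreal (L_norm \<gamma> T K powr \<gamma>)"
proof -
  have int: "integrable lborel (\<lambda>u. indicator {0..T} u *\<^sub>R \<bar>K u\<bar> powr \<gamma>)"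
    using assms by (simp add: in_L_def set_integrable_def)
  have "(\<integral>\<^sup>+u\<in>{0..T}. ennreal (\<bar>K u\<bar> powr \<gamma>) \<partial>lborel) = (\<integral>\<^sup>+u. ennreal (indicator {0..T} u *\<^sub>R \<bar>K u\<bar> powr \<gamma>) \<partial>lborel)"
    by (intro nn_integral_cong) (auto simp: indicator_def)
  also have "\<dots> = ennreal (LINT s:{0..T}|lborel. \<bar>K s\<bar> powr \<gamma>)"
    unfolding set_lebesgue_integral_def by (intro nn_integral_eq_integral int) auto
  also have "(LINT s:{0..T}|lborel. \<bar>K s\<bar> powr \<gamma>) = L_norm \<gamma> T K powr \<gamma>"
  proof -
    have "0 \<le> (LINT s:{0..T}|lborel. \<bar>K s\<bar> powr \<gamma>)"
      unfolding set_lebesgue_integral_def by (intro Bochner_Integration.integral_nonneg) auto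
    then show ?thesis using assms(2) unfolding L_norm_def by (simp add: powr_powr)
  qed
  finally show ?thesis .
qed

text \<open>The weight is kept only in the bounded part, while the L^\<gamma> part uses that the
  weight is at most one. Once \<open>A\<close> is fixed, a weight of small total mass keeps the
  second summand small, uniformly over kernels of norm at most \<Lambda>.\<close>

lemma weighted_kernel_square_le:
  assumes K: "in_L \<gamma> T K" and \<gamma>: "2 < \<gamma>" and A: "0 < A" and h: "h \<le> T"
    and \<Lambda>: "L_norm \<gamma> T K \<le> \<Lambda>"
    and w[measurable]: "w \<in> borel_measurable borel" "\<And>u. 0 \<le> u \<Longrightarrow> w u \<le> 1"
  shows "(\<integral>\<^sup>+u\<in>{0..h}. w u * ennreal ((K u)\<^sup>2) \<partial>lborel)
    \<le> ennreal (A powr (2 - \<gamma>) * \<Lambda> powr \<gamma>) + ennreal (A\<^sup>2) * (\<integral>\<^sup>+u\<in>{0..h}. w u \<partial>lborel)"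
proof -
  have m: "(\<lambda>u. ennreal (\<bar>K u\<bar> powr \<gamma>) * indicator {0..T} u) \<in> borel_measurable borel"
  proof -
    note [measurable] = in_L_measurable[OF K]
    have "(\<lambda>u. ennreal (\<bar>K u\<bar> powr \<gamma>) * indicator {0..T} u)
      = (\<lambda>u. ennreal (\<bar>K u * indicator {0..T} u\<bar> powr \<gamma>) * indicator {0..T} u)"
      by (auto simp: indicator_def fun_eq_iff)
    also have "\<dots> \<in> borel_measurable borel" by measurable
    finally show ?thesis .
  qed
  note [measurable] = m
  have "(\<integral>\<^sup>+u\<in>{0..h}. w u * ennreal ((K u)\<^sup>2) \<partial>lborel)
      \<le> (\<integral>\<^sup>+u. ennreal (A powr (2 - \<gamma>)) * (ennreal (\<bar>K u\<bar> powr \<gamma>) * indicator {0..T} u)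
          + ennreal (A\<^sup>2) * (w u * indicator {0..h} u) \<partial>lborel)"
  proof (rule nn_integral_mono)
    fix u :: real
    show "w u * ennreal ((K u)\<^sup>2) * indicator {0..h} u
      \<le> ennreal (A powr (2 - \<gamma>)) * (ennreal (\<bar>K u\<bar> powr \<gamma>) * indicator {0..T} u)
          + ennreal (A\<^sup>2) * (w u * indicator {0..h} u)"
    proof (cases "u \<in> {0..h}")
      case True
      have "w u * ennreal ((K u)\<^sup>2) \<le> w u * (ennreal (A powr (2 - \<gamma>) * \<bar>K u\<bar> powr \<gamma>) + ennreal (A\<^sup>2))"
        using power2_le_powr_split[OF A \<gamma>, of "K u"]
        by (intro mult_left_mono) (auto simp flip: ennreal_plus)
      also have "\<dots> \<le> 1 * ennreal (A powr (2 - \<gamma>) * \<bar>K u\<bar> powr \<gamma>) + w u * ennreal (A\<^sup>2)"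
        unfolding distrib_left using w(2)[of u] True by (intro add_right_mono mult_right_mono) auto
      finally show ?thesis using True h by (simp add: ennreal_mult mult.commute)
    qed simp
  qed
  also have "\<dots> = ennreal (A powr (2 - \<gamma>)) * (\<integral>\<^sup>+u\<in>{0..T}. ennreal (\<bar>K u\<bar> powr \<gamma>) \<partial>lborel)
      + ennreal (A\<^sup>2) * (\<integral>\<^sup>+u\<in>{0..h}. w u \<partial>lborel)"
    by (simp add: nn_integral_add nn_integral_cmult)
  also have "(\<integral>\<^sup>+u\<in>{0..T}. ennreal (\<bar>K u\<bar> powr \<gamma>) \<partial>lborel) \<le> ennreal (\<Lambda> powr \<gamma>)"
    using nn_integral_powr_L_norm[OF K] \<gamma> \<Lambda> L_norm_nonneg[of \<gamma> T K]
    by (auto intro!: ennreal_leI powr_mono2)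
  finally show ?thesis
    by (simp add: ennreal_mult mult_left_mono add_right_mono)
qed

lemma kernel_square_le:
  assumes K: "in_L \<gamma> T K" and \<gamma>: "2 < \<gamma>" and h: "0 < h" "h \<le> T"
    and \<Lambda>: "L_norm \<gamma> T K \<le> \<Lambda>" "0 < \<Lambda>"
  shows "(sq_int h K) \<le> ennreal (2 * \<Lambda>\<^sup>2 * h powr (1 - 2 / \<gamma>))"
proof -
  \<comment> \<open>This threshold makes both summands equal to \<Lambda>^2 h^(1 - 2/\<gamma>),
    whence the factor two.\<close>
  define A where "A = \<Lambda> * h powr (- (1 / \<gamma>))"
  have A: "0 < A" using h \<Lambda> by (simp add: A_def)
  have "(sq_int h K)
      \<le> ennreal (A powr (2 - \<gamma>) * \<Lambda> powr \<gamma>) + ennreal (A\<^sup>2) * (\<integral>\<^sup>+u\<in>{0..h}. 1 \<partial>lborel)"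
    using weighted_kernel_square_le[OF K \<gamma> A h(2) \<Lambda>(1), of "\<lambda>_. 1"] by simp
  also have "\<dots> = ennreal (A powr (2 - \<gamma>) * \<Lambda> powr \<gamma>) + ennreal (A\<^sup>2 * h)"
    using h by (simp add: ennreal_mult)
  also have "\<dots> = ennreal (A powr (2 - \<gamma>) * \<Lambda> powr \<gamma> + A\<^sup>2 * h)"
    using h by (intro ennreal_plus[symmetric]) auto
  also have "A powr (2 - \<gamma>) * \<Lambda> powr \<gamma> = \<Lambda>\<^sup>2 * h powr (1 - 2 / \<gamma>)"
  proof -
    have "A powr (2 - \<gamma>) * \<Lambda> powr \<gamma> = (\<Lambda> powr (2 - \<gamma>) * \<Lambda> powr \<gamma>) * (h powr (- (1 / \<gamma>))) powr (2 - \<gamma>)"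
      using h \<Lambda> by (simp add: A_def powr_mult)
    also have "\<Lambda> powr (2 - \<gamma>) * \<Lambda> powr \<gamma> = \<Lambda>\<^sup>2"
      using \<Lambda> by (simp add: powr_add[symmetric])
    also have "(h powr (- (1 / \<gamma>))) powr (2 - \<gamma>) = h powr (1 - 2 / \<gamma>)"
    proof -
      have "- (1 / \<gamma>) * (2 - \<gamma>) = 1 - 2 / \<gamma>" using \<gamma> by (simp add: field_simps)
      then show ?thesis unfolding powr_powr by simp
    qed
    finally show ?thesis .
  qed
  also have "A\<^sup>2 * h = \<Lambda>\<^sup>2 * h powr (1 - 2 / \<gamma>)"
  proof -
    have "A\<^sup>2 * h = \<Lambda>\<^sup>2 * (h powr (- (1 / \<gamma>)) * h powr (- (1 / \<gamma>)) * h powr 1)"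
      using h by (simp add: A_def power2_eq_square)
    also have "h powr (- (1 / \<gamma>)) * h powr (- (1 / \<gamma>)) * h powr 1 = h powr (1 - 2 / \<gamma>)"
      unfolding powr_add[symmetric] by simp
    finally show ?thesis .
  qed
  finally show ?thesis by (simp add: mult.assoc)
qed

text \<open>The rate \<open>\<theta>\<close> depends on the bound \<open>R\<close> for the norm and
  not on the kernel, which keeps the constants of the Gronwall argument uniform over
  kernels.\<close>

lemma weighted_kernel_square_small:
  assumes \<gamma>: "2 < (\<gamma>::real)" and \<eta>: "0 < (\<eta>::real)" and T: "0 < T"
  obtains \<theta> where "0 < \<theta>" "\<And>K. in_L \<gamma> T K \<Longrightarrow> L_norm \<gamma> T K \<le> R \<Longrightarrow>
    (\<integral>\<^sup>+u\<in>{0..T}. ennreal (exp (- \<theta> * u)) * ennreal ((K u)\<^sup>2) \<partial>lborel) \<le> ennreal \<eta>"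
proof -
  define R' where "R' = max R 1"
  have R': "0 < R'" "R \<le> R'" by (auto simp: R'_def)
  \<comment> \<open>\<open>A\<close>, and after it \<open>\<theta>\<close>, are chosen so that each
    of the two summands is at most half of \<eta>.\<close>
  define A where "A = (\<eta> / (2 * R' powr \<gamma>)) powr (1 / (2 - \<gamma>))"
  have A: "0 < A" using \<eta> R' by (simp add: A_def)
  have A_powr: "A powr (2 - \<gamma>) * R' powr \<gamma> = \<eta> / 2"
    using \<gamma> \<eta> R' by (simp add: A_def powr_powr)
  define \<theta> where "\<theta> = 2 * A\<^sup>2 / \<eta>"
  have \<theta>: "0 < \<theta>" using A \<eta> by (simp add: \<theta>_def)
  have exp_int: "(\<integral>\<^sup>+u\<in>{0..T}. ennreal (exp (- \<theta> * u)) \<partial>lborel) \<le> ennreal (1 / \<theta>)"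
  proof -
    have "(\<integral>\<^sup>+u\<in>{0..T}. ennreal (exp (- \<theta> * u)) \<partial>lborel)
        = ennreal (- exp (- \<theta> * T) / \<theta> - - exp (- \<theta> * 0) / \<theta>)"
      using \<theta> T
      by (intro nn_integral_FTC_Icc) (auto intro!: derivative_eq_intros simp: field_simps)
    also have "\<dots> \<le> ennreal (1 / \<theta>)" using \<theta> by (intro ennreal_leI) (simp add: field_simps)
    finally show ?thesis .
  qed
  show thesis
  proof (rule that[OF \<theta>])
    fix K assume K: "in_L \<gamma> T K" "L_norm \<gamma> T K \<le> R"
    have "(\<integral>\<^sup>+u\<in>{0..T}. ennreal (exp (- \<theta> * u)) * ennreal ((K u)\<^sup>2) \<partial>lborel)
        \<le> ennreal (A powr (2 - \<gamma>) * R' powr \<gamma>) + ennreal (A\<^sup>2) * (\<integral>\<^sup>+u\<in>{0..T}. ennreal (exp (- \<theta> * u)) \<partial>lborel)"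
      using K R' \<theta> by (intro weighted_kernel_square_le \<gamma> A) auto
    also have "\<dots> \<le> ennreal (\<eta> / 2) + ennreal (A\<^sup>2) * ennreal (1 / \<theta>)"
      unfolding A_powr by (intro add_left_mono mult_left_mono exp_int) auto
    also have "ennreal (A\<^sup>2) * ennreal (1 / \<theta>) = ennreal (\<eta> / 2)"
      using \<theta> A \<eta> by (subst ennreal_mult[symmetric]) (auto simp: \<theta>_def)
    also have "ennreal (\<eta> / 2) + ennreal (\<eta> / 2) = ennreal \<eta>"
      using \<eta> by (simp flip: ennreal_plus)
    finally show "(\<integral>\<^sup>+u\<in>{0..T}. ennreal (exp (- \<theta> * u)) * ennreal ((K u)\<^sup>2) \<partial>lborel) \<le> ennreal \<eta>" .
  qed
qed

text \<open>The weight \<open>e\<^bsup>-\<theta> t\<^esup>\<close> turns the convolution into a contraction.\<close>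

lemma volterra_gronwall:
  fixes f :: "real \<Rightarrow> ennreal" and a :: ennreal
  assumes K: "in_L \<gamma> T K" and b: "0 \<le> b" and \<theta>: "0 < \<theta>"
    and small: "ennreal b * (\<integral>\<^sup>+u\<in>{0..T}. ennreal (exp (- \<theta> * u)) * ennreal ((K u)\<^sup>2) \<partial>lborel) \<le> ennreal (1 / 2)"
    and bdd: "\<And>t. t \<in> {0..T} \<Longrightarrow> f t \<le> N" "N < \<infinity>"
    and le: "\<And>t. t \<in> {0..T} \<Longrightarrow> f t \<le> a + ennreal b * (\<integral>\<^sup>+s\<in>{0..t}. ennreal ((K (t - s))\<^sup>2) * f s \<partial>lborel)"
    and t: "t \<in> {0..T}"
  shows "f t \<le> 2 * a * ennreal (exp (\<theta> * T))"
proof -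
  \<comment> \<open>The weighted supremum is finite by the crude bound \<open>N\<close>, so half of
    it can be subtracted at the end; \<open>N\<close> itself does not enter the resulting
    estimate.\<close>
  define S where "S = (SUP t\<in>{0..T}. ennreal (exp (- \<theta> * t)) * f t)"
  have exp_le: "ennreal (exp (- \<theta> * s)) \<le> 1" if "0 \<le> s" for s
    using that \<theta> by (auto simp: ennreal_le_1)
  have "S \<le> N"
    unfolding S_def
  proof (rule SUP_least)
    fix t assume t: "t \<in> {0..T}"
    have "ennreal (exp (- \<theta> * t)) * f t \<le> 1 * N"
      using t by (intro mult_mono exp_le bdd) auto
    then show "ennreal (exp (- \<theta> * t)) * f t \<le> N" by simp
  qed
  then have S_fin: "S < \<infinity>" using bdd(2) by (rule le_less_trans)
  have "S \<le> a + ennreal (1 / 2) * S"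
    unfolding S_def
  proof (rule SUP_least, fold S_def)
    fix t assume t: "t \<in> {0..T}"
    have meas: "(\<lambda>u. ennreal (exp (- \<theta> * u)) * ennreal ((K u)\<^sup>2) * indicator {0..t} u) \<in> borel_measurable borel"
    proof -
      note [measurable] = in_L_square_measurable[OF K, of 0 t]
      have "(\<lambda>u. ennreal (exp (- \<theta> * u)) * ennreal ((K u)\<^sup>2) * indicator {0..t} u)
        = (\<lambda>u. ennreal (exp (- \<theta> * u)) * (ennreal ((K u)\<^sup>2) * indicator {0..t} u))"
        by (simp add: mult.assoc)
      then show ?thesis using t by simp
    qed
    have meas': "(\<lambda>s. ennreal (exp (- \<theta> * (t - s))) * ennreal ((K (t - s))\<^sup>2) * indicator {0..t} s) \<in> borel_measurable borel"
    proof -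
      have "(\<lambda>s. t - s) \<in> borel_measurable borel" by measurable
      from measurable_compose[OF this meas] show ?thesis
        by (rule subst[OF measurable_cong, rotated -1]) (auto simp: indicator_def)
    qed
    have meas'': "(\<lambda>s. ennreal (exp (\<theta> * s)) * ennreal ((K (t - s))\<^sup>2) * indicator {0..t} s) \<in> borel_measurable lborel"
    proof -
      have "(\<lambda>s. ennreal (exp (\<theta> * t)) * (ennreal (exp (- \<theta> * (t - s))) * ennreal ((K (t - s))\<^sup>2) * indicator {0..t} s))
        = (\<lambda>s. ennreal (exp (\<theta> * s)) * ennreal ((K (t - s))\<^sup>2) * indicator {0..t} s)"
        by (simp add: mult.assoc[symmetric] ennreal_mult[symmetric] exp_add[symmetric] right_diff_distrib)
      moreover have "(\<lambda>s. ennreal (exp (\<theta> * t)) * (ennreal (exp (- \<theta> * (t - s))) * ennreal ((K (t - s))\<^sup>2) * indicator {0..t} s))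
        \<in> borel_measurable lborel"
        using borel_measurable_times_ennreal[OF borel_measurable_const meas'] by simp
      ultimately show ?thesis by simp
    qed
    have "(\<integral>\<^sup>+s\<in>{0..t}. ennreal ((K (t - s))\<^sup>2) * f s \<partial>lborel)
        \<le> (\<integral>\<^sup>+s. (ennreal (exp (\<theta> * s)) * ennreal ((K (t - s))\<^sup>2) * indicator {0..t} s) * S \<partial>lborel)"
    proof (rule nn_integral_mono)
      fix s :: real
      show "ennreal ((K (t - s))\<^sup>2) * f s * indicator {0..t} s
        \<le> (ennreal (exp (\<theta> * s)) * ennreal ((K (t - s))\<^sup>2) * indicator {0..t} s) * S"
      proof (cases "s \<in> {0..t}")
        case True
        have "f s = ennreal (exp (\<theta> * s)) * (ennreal (exp (- \<theta> * s)) * f s)"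
          by (simp add: mult.assoc[symmetric] ennreal_mult[symmetric] exp_add[symmetric])
        also have "\<dots> \<le> ennreal (exp (\<theta> * s)) * S"
          unfolding S_def using True t by (intro mult_left_mono SUP_upper) auto
        finally have "ennreal ((K (t - s))\<^sup>2) * f s \<le> ennreal ((K (t - s))\<^sup>2) * (ennreal (exp (\<theta> * s)) * S)"
          by (rule mult_left_mono) simp
        then show ?thesis using True by (simp add: mult_ac)
      qed simp
    qed
    also have "\<dots> = (\<integral>\<^sup>+s. ennreal (exp (\<theta> * s)) * ennreal ((K (t - s))\<^sup>2) * indicator {0..t} s \<partial>lborel) * S"
      by (rule nn_integral_multc[OF meas''])
    finally have "ennreal (exp (- \<theta> * t)) * (\<integral>\<^sup>+s\<in>{0..t}. ennreal ((K (t - s))\<^sup>2) * f s \<partial>lborel)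
      \<le> ennreal (exp (- \<theta> * t)) *
        (\<integral>\<^sup>+s. ennreal (exp (\<theta> * s)) * ennreal ((K (t - s))\<^sup>2) * indicator {0..t} s \<partial>lborel) * S"
      unfolding mult.assoc by (rule mult_left_mono) simp
    \<comment> \<open>The weights at \<open>t\<close> and \<open>s\<close> combine to a function of
      the lag \<open>t - s\<close> alone, so reflection produces the integral that was assumed
      small.\<close>
    also have "ennreal (exp (- \<theta> * t)) *
        (\<integral>\<^sup>+s. ennreal (exp (\<theta> * s)) * ennreal ((K (t - s))\<^sup>2) * indicator {0..t} s \<partial>lborel)
      = (\<integral>\<^sup>+s. ennreal (exp (- \<theta> * (t - s))) * ennreal ((K (t - s))\<^sup>2) * indicator {0..t} s \<partial>lborel)"
      by (subst nn_integral_cmult[OF meas'', symmetric])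
         (simp add: mult.assoc[symmetric] ennreal_mult[symmetric] exp_add[symmetric] right_diff_distrib)
    also have "(\<integral>\<^sup>+s. ennreal (exp (- \<theta> * (t - s))) * ennreal ((K (t - s))\<^sup>2) * indicator {0..t} s \<partial>lborel)
      = (\<integral>\<^sup>+u\<in>{0..t}. ennreal (exp (- \<theta> * u)) * ennreal ((K u)\<^sup>2) \<partial>lborel)"
      using set_nn_integral_reflect[OF meas, of t] by simp
    also have "\<dots> \<le> (\<integral>\<^sup>+u\<in>{0..T}. ennreal (exp (- \<theta> * u)) * ennreal ((K u)\<^sup>2) \<partial>lborel)"
      using t by (intro nn_integral_mono mult_left_mono) (auto simp: indicator_def)
    finally have conv: "ennreal (exp (- \<theta> * t)) * (\<integral>\<^sup>+s\<in>{0..t}. ennreal ((K (t - s))\<^sup>2) * f s \<partial>lborel)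
      \<le> (\<integral>\<^sup>+u\<in>{0..T}. ennreal (exp (- \<theta> * u)) * ennreal ((K u)\<^sup>2) \<partial>lborel) * S"
      by (simp add: mult_right_mono)
    have "ennreal (exp (- \<theta> * t)) * f t
      \<le> ennreal (exp (- \<theta> * t)) * (a + ennreal b * (\<integral>\<^sup>+s\<in>{0..t}. ennreal ((K (t - s))\<^sup>2) * f s \<partial>lborel))"
      by (intro mult_left_mono le t) auto
    also have "\<dots> = ennreal (exp (- \<theta> * t)) * a + ennreal b *
        (ennreal (exp (- \<theta> * t)) * (\<integral>\<^sup>+s\<in>{0..t}. ennreal ((K (t - s))\<^sup>2) * f s \<partial>lborel))"
      by (simp only: distrib_left mult_ac)
    also have "\<dots> \<le> 1 * a + ennreal b * ((\<integral>\<^sup>+u\<in>{0..T}. ennreal (exp (- \<theta> * u)) * ennreal ((K u)\<^sup>2) \<partial>lborel) * S)"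
      using t by (intro add_mono mult_right_mono mult_left_mono exp_le conv) auto
    also have "\<dots> \<le> a + ennreal (1 / 2) * S"
      using mult_right_mono[OF small, of S] by (simp add: mult.assoc)
    finally show "ennreal (exp (- \<theta> * t)) * f t \<le> a + ennreal (1 / 2) * S" .
  qed
  then have S_le: "S \<le> 2 * a"
  proof (cases a)
    case (real r)
    obtain x where x: "S = ennreal x" "0 \<le> x" using S_fin by (cases S) auto
    have "ennreal x \<le> ennreal r + ennreal (1 / 2) * ennreal x"
      using \<open>S \<le> a + ennreal (1 / 2) * S\<close> unfolding real(2) x(1) .
    also have "ennreal (1 / 2) * ennreal x = ennreal (1 / 2 * x)"
      by (rule ennreal_mult[symmetric]) (use x in auto)
    also have "ennreal r + ennreal (1 / 2 * x) = ennreal (r + 1 / 2 * x)"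
      by (rule ennreal_plus[symmetric]) (use real x in auto)
    finally have "ennreal x \<le> ennreal (r + 1 / 2 * x)" .
    then have "x \<le> r + 1 / 2 * x"
      by (rule ennreal_le_iff[THEN iffD1, rotated]) (use real x in auto)
    then have "x \<le> 2 * r" by simp
    then have "ennreal x \<le> ennreal (2 * r)" by (rule ennreal_leI)
    then show ?thesis using real x by (simp add: ennreal_mult)
  qed (simp add: ennreal_mult_top)
  have "f t = ennreal (exp (\<theta> * t)) * (ennreal (exp (- \<theta> * t)) * f t)"
    by (simp add: mult.assoc[symmetric] ennreal_mult[symmetric] exp_add[symmetric])
  also have "\<dots> \<le> ennreal (exp (\<theta> * T)) * (2 * a)"
  proof (rule mult_mono)
    show "ennreal (exp (\<theta> * t)) \<le> ennreal (exp (\<theta> * T))"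
      using t \<theta> by (intro ennreal_leI) auto
    have "ennreal (exp (- \<theta> * t)) * f t \<le> S" unfolding S_def by (rule SUP_upper2[OF t]) simp
    then show "ennreal (exp (- \<theta> * t)) * f t \<le> 2 * a" using S_le by (rule order_trans)
  qed auto
  finally show ?thesis by (simp add: mult_ac)
qed

section \<open>Monotone kernels and their time increments\<close>

lemma completely_monotone_antimono:
  assumes "completely_monotone K" "0 < u" "u \<le> v"
  shows "0 \<le> K v" "K v \<le> K u"
proof -
  obtain \<mu> where \<mu>: "sets \<mu> = sets (restrict_space borel {0::real..})"
    "\<And>t. 0 < t \<Longrightarrow> integrable \<mu> (\<lambda>x. exp (- x * t))" "\<And>t. 0 < t \<Longrightarrow> K t = (\<integral>x. exp (- x * t) \<partial>\<mu>)"
    using assms(1) unfolding completely_monotone_def by blast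
  have "space \<mu> = {0..}" using sets_eq_imp_space_eq[OF \<mu>(1)] by (simp add: space_restrict_space)
  then have "(\<integral>x. exp (- x * v) \<partial>\<mu>) \<le> (\<integral>x. exp (- x * u) \<partial>\<mu>)"
    using assms \<mu>(2) by (intro integral_mono) (auto intro!: mult_left_mono)
  then show "K v \<le> K u" using \<mu>(3) assms by simp
  show "0 \<le> K v" using \<mu>(3) assms by simp
qed

text \<open>Expanding the square gives the equivalent form
  \<open>(K v)\<^sup>2 \<le> K u * K v\<close>: the value \<open>K v\<close> lies between zero and
  \<open>K u\<close>. This is the form in which complete monotonicity enters the estimates. It is
  invariant under a change of sign, so both alternatives for \<open>K1 - K2\<close> are treated at
  once.\<close>

definition square_superadditive :: "(real \<Rightarrow> real) \<Rightarrow> bool" where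
  "square_superadditive K \<longleftrightarrow> (\<forall>u v. 0 < u \<longrightarrow> u \<le> v \<longrightarrow> (K v - K u)\<^sup>2 + (K v)\<^sup>2 \<le> (K u)\<^sup>2)"

lemma completely_monotone_square_superadditive:
  assumes "completely_monotone K"
  shows "square_superadditive K"
  unfolding square_superadditive_def
proof (intro allI impI)
  fix u v :: real assume "0 < u" "u \<le> v"
  then have "0 \<le> K v" "K v \<le> K u" using completely_monotone_antimono assms by blast+
  then have "K v * K v \<le> K v * K u" by (intro mult_left_mono)
  then show "(K v - K u)\<^sup>2 + (K v)\<^sup>2 \<le> (K u)\<^sup>2" by (simp add: power2_eq_square algebra_simps)
qed

lemma square_superadditive_uminus:
  "square_superadditive (\<lambda>u. - K u) \<Longrightarrow> square_superadditive K"
  by (simp add: square_superadditive_def power2_eq_square algebra_simps)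

lemma in_L_diff:
  assumes K: "in_L \<gamma> T K1" "in_L \<gamma> T K2" and \<gamma>: "0 < \<gamma>"
  shows "in_L \<gamma> T (\<lambda>u. K1 u - K2 u)"
proof -
  note [measurable] = in_L_measurable[OF K(1)] in_L_measurable[OF K(2)]
  have [measurable]: "(\<lambda>u. (K1 u - K2 u) * indicator {0..T} u) \<in> borel_measurable borel"
    unfolding left_diff_distrib by measurable
  have m: "(\<lambda>u. indicator {0..T} u *\<^sub>R \<bar>K1 u - K2 u\<bar> powr \<gamma>) \<in> borel_measurable borel"
  proof -
    have "(\<lambda>u. indicator {0..T} u *\<^sub>R \<bar>K1 u - K2 u\<bar> powr \<gamma>)
      = (\<lambda>u. indicator {0..T} u *\<^sub>R \<bar>(K1 u - K2 u) * indicator {0..T} u\<bar> powr \<gamma>)"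
      by (auto simp: indicator_def fun_eq_iff)
    also have "\<dots> \<in> borel_measurable borel" by measurable
    finally show ?thesis .
  qed
  have "set_integrable lborel {0..T} (\<lambda>s. \<bar>K1 s - K2 s\<bar> powr \<gamma>)"
    unfolding set_integrable_def
  proof (rule Bochner_Integration.integrable_bound)
    show "integrable lborel (\<lambda>u. 2 powr \<gamma> * (indicator {0..T} u *\<^sub>R \<bar>K1 u\<bar> powr \<gamma> + indicator {0..T} u *\<^sub>R \<bar>K2 u\<bar> powr \<gamma>))"
      using K unfolding in_L_def set_integrable_def by (intro integrable_mult_right integrable_add) auto
    have "\<bar>x - y\<bar> powr \<gamma> \<le> 2 powr \<gamma> * (\<bar>x\<bar> powr \<gamma> + \<bar>y\<bar> powr \<gamma>)" for x y :: real
    proof -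
      have "\<bar>x - y\<bar> powr \<gamma> \<le> (2 * max \<bar>x\<bar> \<bar>y\<bar>) powr \<gamma>"
        using \<gamma> by (intro powr_mono2) auto
      also have "\<dots> = 2 powr \<gamma> * max \<bar>x\<bar> \<bar>y\<bar> powr \<gamma>" by (simp add: powr_mult)
      also have "\<dots> \<le> 2 powr \<gamma> * (\<bar>x\<bar> powr \<gamma> + \<bar>y\<bar> powr \<gamma>)"
        by (intro mult_left_mono) (auto simp: max_def)
      finally show ?thesis .
    qed
    then show "AE u in lborel. norm (indicator {0..T} u *\<^sub>R \<bar>K1 u - K2 u\<bar> powr \<gamma>)
      \<le> norm (2 powr \<gamma> * (indicator {0..T} u *\<^sub>R \<bar>K1 u\<bar> powr \<gamma> + indicator {0..T} u *\<^sub>R \<bar>K2 u\<bar> powr \<gamma>))"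
      by (intro AE_I2) (auto simp: indicator_def)
  qed (use m in simp)
  then show ?thesis
    by (simp add: in_L_def set_borel_measurable_def mult.commute[of "indicator _ _"])
qed

lemma kernel_square_finite:
  assumes K: "in_L \<gamma> T K" and \<gamma>: "2 < \<gamma>" and T: "0 < T"
  shows "(sq_int T K) < \<infinity>"
  using kernel_square_le[OF K \<gamma> T order_refl, of "L_norm \<gamma> T K + 1"] L_norm_nonneg[of \<gamma> T K]
  by (auto intro: le_less_trans)

lemma kernel_increment_measurable:
  assumes K: "in_L \<gamma> T K" and st: "0 \<le> s" "s \<le> t" "t \<le> T"
  shows "(\<lambda>r. ennreal ((K (t - r) - K (s - r) * indicator {..s} r)\<^sup>2) * indicator {0..t} r) \<in> borel_measurable borel"
proof -
  \<comment> \<open>Measurability of \<open>K\<close> is known on [0, T] only. All arguments that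
    matter for \<open>r\<close> in [0, t] lie there, so the extension by zero changes
    nothing.\<close>
  define K' where "K' u = K u * indicator {0..T} u" for u
  have [measurable]: "K' \<in> borel_measurable borel"
    using in_L_measurable[OF K] by (simp add: K'_def[abs_def])
  have "(\<lambda>r. ennreal ((K (t - r) - K (s - r) * indicator {..s} r)\<^sup>2) * indicator {0..t} r)
      = (\<lambda>r. ennreal ((K' (t - r) - K' (s - r) * indicator {..s} r)\<^sup>2) * indicator {0..t} r)"
    using st by (auto simp: K'_def indicator_def fun_eq_iff)
  also have "\<dots> \<in> borel_measurable borel" by measurable
  finally show ?thesis .
qed

text \<open>For \<open>0 \<le> b \<le> a\<close> one has \<open>(a - b)\<^sup>2 \<le> a\<^sup>2 - b\<^sup>2\<close>, so the increments of the kernel telescope in \<open>L\<^sup>2\<close>.\<close>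

lemma kernel_increment_le:
  assumes K: "in_L \<gamma> T K" and \<gamma>: "2 < \<gamma>" and sq: "square_superadditive K"
    and st: "0 \<le> s" "s < t" "t \<le> T"
  shows "(sq_int t (\<lambda>r. K (t - r) - K (s - r) * indicator {..s} r))
    \<le> 2 * (sq_int (t - s) K)"
proof -
  define k where "k u = ennreal ((K u)\<^sup>2)" for u
  have k_meas: "(\<lambda>u. k u * indicator {a..b} u) \<in> borel_measurable borel" if "0 \<le> a" "b \<le> T" for a b
    unfolding k_def by (rule in_L_square_measurable[OF K that])
  define \<phi> where "\<phi> r = ennreal ((K (t - r) - K (s - r) * indicator {..s} r)\<^sup>2)" for r
  have [measurable]: "(\<lambda>r. \<phi> r * indicator {0..t} r) \<in> borel_measurable borel"
    unfolding \<phi>_def using kernel_increment_measurable[OF K] st by simp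
  have refl_meas: "(\<lambda>r. k (c - r) * indicator {c - b..c - a} r) \<in> borel_measurable borel"
    if "0 \<le> a" "b \<le> T" for a b c
  proof -
    have "(\<lambda>r. c - r) \<in> borel_measurable borel" by measurable
    from measurable_compose[OF this k_meas[OF that]] show ?thesis
      by (rule subst[OF measurable_cong, rotated -1]) (auto simp: indicator_def)
  qed
  have [measurable]: "(\<lambda>r. k (t - r) * indicator {0..s} r) \<in> borel_measurable borel"
    "(\<lambda>r. k (s - r) * indicator {0..s} r) \<in> borel_measurable borel"
    "(\<lambda>r. k (t - r) * indicator {s..t} r) \<in> borel_measurable borel"
    using refl_meas[of "t - s" t t] refl_meas[of 0 s s] refl_meas[of 0 "t - s" t] st by auto
  \<comment> \<open>The overlap of the two shifted kernels. It appears on both sides of the final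
    inequality and may be cancelled because it is finite.\<close>
  define X where "X = (\<integral>\<^sup>+u\<in>{t - s..t}. k u \<partial>lborel)"
  define Z where "Z = (\<integral>\<^sup>+u\<in>{0..t - s}. k u \<partial>lborel)"
  have X_eq: "(\<integral>\<^sup>+r\<in>{0..s}. k (t - r) \<partial>lborel) = X"
    unfolding X_def using set_nn_integral_reflect[OF k_meas[of "t - s" t], of t] st by simp
  have "(\<integral>\<^sup>+r\<in>{0..t}. \<phi> r \<partial>lborel) + X = (\<integral>\<^sup>+r. \<phi> r * indicator {0..t} r + k (t - r) * indicator {0..s} r \<partial>lborel)"
    unfolding X_eq[symmetric] by (simp add: nn_integral_add)
  also have "\<dots> \<le> (\<integral>\<^sup>+r. k (s - r) * indicator {0..s} r + k (t - r) * indicator {s..t} r \<partial>lborel)"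
  proof (rule nn_integral_mono_AE)
    \<comment> \<open>At \<open>r = s\<close> the kernel would be evaluated at zero, where
      monotonicity says nothing.\<close>
    have "AE r in lborel. r \<noteq> s" by (rule AE_lborel_singleton)
    then show "AE r in lborel. \<phi> r * indicator {0..t} r + k (t - r) * indicator {0..s} r
        \<le> k (s - r) * indicator {0..s} r + k (t - r) * indicator {s..t} r"
    proof eventually_elim
      case (elim r)
      show ?case
      proof (cases "r < s")
        case True
        have "(K (t - r) - K (s - r))\<^sup>2 + (K (t - r))\<^sup>2 \<le> (K (s - r))\<^sup>2"
          using sq True st by (simp add: square_superadditive_def)
        then have "\<phi> r + k (t - r) \<le> k (s - r)"
          using True by (simp add: \<phi>_def k_def flip: ennreal_plus)
        then show ?thesis using True st by (auto simp: indicator_def)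
      next
        case False
        with elim have "s < r" by simp
        then show ?thesis by (auto simp: indicator_def \<phi>_def k_def)
      qed
    qed
  qed
  also have "\<dots> = (\<integral>\<^sup>+r\<in>{0..s}. k (s - r) \<partial>lborel) + (\<integral>\<^sup>+r\<in>{s..t}. k (t - r) \<partial>lborel)"
    by (simp add: nn_integral_add)
  also have "(\<integral>\<^sup>+r\<in>{s..t}. k (t - r) \<partial>lborel) = Z"
    unfolding Z_def using set_nn_integral_reflect[OF k_meas[of 0 "t - s"], of t] st by simp
  also have "(\<integral>\<^sup>+r\<in>{0..s}. k (s - r) \<partial>lborel) = (\<integral>\<^sup>+u\<in>{0..s}. k u \<partial>lborel)"
    using set_nn_integral_reflect[OF k_meas[of 0 s], of s] st by simp
  \<comment> \<open>The range [0, s] is covered by [0, t - s] and [t - s, t]; with the piece over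
    [s, t] this leaves twice \<open>Z\<close> plus the overlap \<open>X\<close>.\<close>
  also have "(\<integral>\<^sup>+u\<in>{0..s}. k u \<partial>lborel) \<le> (\<integral>\<^sup>+u. k u * indicator {0..t - s} u + k u * indicator {t - s..t} u \<partial>lborel)"
    using st by (intro nn_integral_mono) (auto simp: indicator_def)
  also have "\<dots> = Z + X"
    unfolding Z_def X_def using k_meas[of 0 "t - s"] k_meas[of "t - s" t] st by (intro nn_integral_add) auto
  finally have "X + (\<integral>\<^sup>+r\<in>{0..t}. \<phi> r \<partial>lborel) \<le> X + (Z + Z)"
    by (simp add: add_ac)
  moreover have "X < \<infinity>"
  proof -
    have "X \<le> (\<integral>\<^sup>+u\<in>{0..T}. k u \<partial>lborel)"
      unfolding X_def using st by (intro nn_integral_mono) (auto simp: indicator_def)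
    also have "\<dots> < \<infinity>" unfolding k_def using st by (intro kernel_square_finite[OF K \<gamma>]) auto
    finally show ?thesis .
  qed
  ultimately have "(\<integral>\<^sup>+r\<in>{0..t}. \<phi> r \<partial>lborel) \<le> Z + Z"
    by (subst (asm) ennreal_add_left_cancel_le) auto
  then show ?thesis by (simp add: \<phi>_def Z_def k_def mult_2)
qed

section \<open>Pathwise chaining over dyadic points\<close>

lemma dyadic_chaining:
  fixes f :: "real \<Rightarrow> real"
  assumes incr: "\<And>n j. j < 2 ^ n \<Longrightarrow> \<bar>f (T * real (Suc j) / 2 ^ n) - f (T * real j / 2 ^ n)\<bar> \<le> Z * \<rho> ^ n"
    and \<rho>: "0 \<le> \<rho>" and Z: "0 \<le> Z" and j: "j \<le> 2 ^ n"
  shows "\<bar>f (T * real j / 2 ^ n)\<bar> \<le> \<bar>f 0\<bar> + Z * (\<Sum>i\<le>n. \<rho> ^ i)"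
  using j
proof (induction n arbitrary: j)
  case 0
  then have "j = 0 \<or> j = 1" by auto
  then show ?case using incr[of 0 0] Z by auto
next
  case (Suc n)
  have even: "\<bar>f (T * real (2 * i) / 2 ^ Suc n)\<bar> \<le> \<bar>f 0\<bar> + Z * (\<Sum>i\<le>n. \<rho> ^ i)" if "i \<le> 2 ^ n" for i
    using Suc.IH[OF that] by simp
  show ?case
  proof (cases "even j")
    case True
    then obtain i where i: "j = 2 * i" by (elim evenE)
    then have "\<bar>f (T * real j / 2 ^ Suc n)\<bar> \<le> \<bar>f 0\<bar> + Z * (\<Sum>i\<le>n. \<rho> ^ i)"
      using even[of i] Suc.prems by simp
    also have "\<dots> \<le> \<bar>f 0\<bar> + Z * (\<Sum>i\<le>Suc n. \<rho> ^ i)"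
      using \<rho> Z by (intro add_left_mono mult_left_mono) auto
    finally show ?thesis .
  next
    case False
    \<comment> \<open>An odd point is one step of the new level away from its left neighbour, which
      already belongs to the coarser level; thus each level costs at most one increment.\<close>
    then obtain i where i: "j = Suc (2 * i)" by (metis oddE Suc_eq_plus1)
    then have "2 * i < 2 ^ Suc n" "i \<le> 2 ^ n" using Suc.prems by auto
    then have "\<bar>f (T * real j / 2 ^ Suc n) - f (T * real (2 * i) / 2 ^ Suc n)\<bar> \<le> Z * \<rho> ^ Suc n"
      "\<bar>f (T * real (2 * i) / 2 ^ Suc n)\<bar> \<le> \<bar>f 0\<bar> + Z * (\<Sum>i\<le>n. \<rho> ^ i)"
      using incr[of "2 * i" "Suc n"] even[of i] i by auto
    then show ?thesis by (simp add: distrib_left)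
  qed
qed

lemma dyadic_chaining_continuous:
  fixes f :: "real \<Rightarrow> real"
  assumes cont: "continuous_on {0..T} f" and T: "0 < T" and t: "t \<in> {0..T}"
    and incr: "\<And>n j. j < 2 ^ n \<Longrightarrow> \<bar>f (T * real (Suc j) / 2 ^ n) - f (T * real j / 2 ^ n)\<bar> \<le> Z * \<rho> ^ n"
    and \<rho>: "0 \<le> \<rho>" "\<rho> < 1" and Z: "0 \<le> Z"
  shows "\<bar>f t\<bar> \<le> \<bar>f 0\<bar> + Z / (1 - \<rho>)"
proof -
  \<comment> \<open>The index of the last dyadic point of level \<open>n\<close> not after
    \<open>t\<close>; hence \<open>x n\<close> stays in [0, T] and converges to
    \<open>t\<close>.\<close>
  define j where "j n = nat \<lfloor>2 ^ n * t / T\<rfloor>" for n :: nat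
  define x where "x n = T * real (j n) / 2 ^ n" for n
  have j_eq: "real (j n) = of_int \<lfloor>2 ^ n * t / T\<rfloor>" for n
    using t T by (simp add: j_def)
  have j_bounds: "real (j n) \<le> 2 ^ n * t / T" "2 ^ n * t / T < real (j n) + 1" for n
    unfolding j_eq by linarith+
  have x_le: "x n \<le> t" "t - T / 2 ^ n \<le> x n" for n
  proof -
    show "x n \<le> t" using j_bounds[of n] T by (simp add: x_def field_simps)
    have "t * 2 ^ n < T * (real (j n) + 1)" using j_bounds(2)[of n] T by (simp add: field_simps)
    then have "t < T * (real (j n) + 1) / 2 ^ n" by (simp add: pos_less_divide_eq)
    also have "\<dots> = x n + T / 2 ^ n" by (simp add: x_def distrib_left add_divide_distrib)
    finally show "t - T / 2 ^ n \<le> x n" by simp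
  qed
  have x_range: "x n \<in> {0..T}" for n
    using x_le[of n] t T by (auto simp: x_def)
  have j_le: "j n \<le> 2 ^ n" for n
  proof -
    have "real (j n) \<le> 2 ^ n" using x_range[of n] T by (simp add: x_def field_simps)
    then show ?thesis by (metis of_nat_le_iff of_nat_numeral of_nat_power)
  qed
  have "(\<lambda>n. T * (1 / 2) ^ n) \<longlonglongrightarrow> T * 0" by (intro tendsto_mult LIMSEQ_realpow_zero) auto
  from tendsto_diff[OF tendsto_const this] have "(\<lambda>n. t - T / 2 ^ n) \<longlonglongrightarrow> t"
    by (simp add: power_divide)
  then have "x \<longlonglongrightarrow> t"
    by (rule tendsto_sandwich[OF _ _ _ tendsto_const, rotated 2]) (use x_le in auto)
  then have "(\<lambda>n. f (x n)) \<longlonglongrightarrow> f t"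
    using cont t x_range by (intro continuous_on_tendsto_compose[of "{0..T}" f]) auto
  then have "(\<lambda>n. \<bar>f (x n)\<bar>) \<longlonglongrightarrow> \<bar>f t\<bar>" by (rule tendsto_rabs)
  moreover have "\<bar>f (x n)\<bar> \<le> \<bar>f 0\<bar> + Z / (1 - \<rho>)" for n
  proof -
    have "(\<Sum>i\<le>n. \<rho> ^ i) \<le> 1 / (1 - \<rho>)"
      using \<rho> sum_gp0[of \<rho> n] by (simp add: divide_right_mono)
    then have "Z * (\<Sum>i\<le>n. \<rho> ^ i) \<le> Z * (1 / (1 - \<rho>))" using Z by (rule mult_left_mono)
    moreover have "\<bar>f (T * real (j n) / 2 ^ n)\<bar> \<le> \<bar>f 0\<bar> + Z * (\<Sum>i\<le>n. \<rho> ^ i)"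
      by (rule dyadic_chaining[OF _ \<rho>(1) Z j_le]) (rule incr)
    ultimately show ?thesis unfolding x_def by simp
  qed
  ultimately show ?thesis by (intro LIMSEQ_le_const2) auto
qed

section \<open>Chaining\<close>

text \<open>With q = 2m, the factor 2^q separates the initial value from the oscillation, 3 is the
  sum of the geometric series of ratio 2/3, and 1 - \<rho> with \<rho> = (3/4)^(1/q) comes from
  summing the increments of one path over the levels.\<close>

definition chaining_const :: "nat \<Rightarrow> real \<Rightarrow> real" where
  "chaining_const m T = 2 ^ (2 * m) * (1 + 3 * T\<^sup>2 / (1 - root (2 * m) (3 / 4)) ^ (2 * m))"

text \<open>Kolmogorov's criterion with exponent two: the \<open>2\<^sup>n\<close> increments of dyadic level \<open>n\<close>, weighted by
  \<open>\<rho>\<^sup>-\<^sup>q\<^sup>n = (4/3)\<^sup>n\<close>, have total moment of order \<open>(2/3)\<^sup>n\<close>.\<close>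

lemma sup_moment_bound:
  fixes D :: "real \<Rightarrow> 'a \<Rightarrow> real" and C T :: real and m :: nat
  assumes T: "0 < T" and m: "1 \<le> m" and C: "0 \<le> C"
    and meas[measurable]: "\<And>t. t \<in> {0..T} \<Longrightarrow> D t \<in> borel_measurable M"
    and cont: "AE \<omega> in M. continuous_on {0..T} (\<lambda>t. D t \<omega>)"
    and init: "(\<integral>\<^sup>+\<omega>. ennreal (D 0 \<omega> ^ (2 * m)) \<partial>M) \<le> ennreal C"
    and incr: "\<And>s t. 0 \<le> s \<Longrightarrow> s < t \<Longrightarrow> t \<le> T \<Longrightarrow>
      (\<integral>\<^sup>+\<omega>. ennreal ((D t \<omega> - D s \<omega>) ^ (2 * m)) \<partial>M) \<le> ennreal (C * (t - s)\<^sup>2)"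
  obtains U where "U \<in> borel_measurable M"
    "AE \<omega> in M. \<forall>t\<in>{0..T}. ennreal (D t \<omega> ^ (2 * m)) \<le> U \<omega>"
    "(\<integral>\<^sup>+\<omega>. U \<omega> \<partial>M) \<le> ennreal (chaining_const m T * C)"
proof -
  define q where "q = 2 * m"
  have q: "0 < q" "even q" using m by (auto simp: q_def)
  define \<rho> where "\<rho> = root q (3 / 4)"
  have \<rho>: "0 < \<rho>" "\<rho> < 1" "\<rho> ^ q = 3 / 4"
    using q real_root_lt_1_iff[of q "3 / 4"] by (auto simp: \<rho>_def)
  define x where "x n j = T * real j / 2 ^ n" for n j :: nat
  have x_range: "x n j \<in> {0..T}" if "j \<le> 2 ^ n" for n j
  proof -
    have "real j \<le> 2 ^ n" using that by (metis of_nat_le_iff of_nat_numeral of_nat_power)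
    then show ?thesis using T by (auto simp: x_def field_simps)
  qed
  define \<Delta> where "\<Delta> n j \<omega> = D (x n (Suc j)) \<omega> - D (x n j) \<omega>" for n j \<omega>
  \<comment> \<open>All levels are collected in one variable, so that its value at \<omega> controls
    every dyadic increment of the path.\<close>
  define V where "V \<omega> = (\<Sum>n. ennreal ((4 / 3) ^ n) * (\<Sum>j<2 ^ n. ennreal (\<Delta> n j \<omega> ^ q)))" for \<omega>
  have \<Delta>_meas: "\<Delta> n j \<in> borel_measurable M" if "j < 2 ^ n" for n j
    unfolding \<Delta>_def using x_range[of j n] x_range[of "Suc j" n] that
    by (intro borel_measurable_diff meas) auto
  have sum_meas[measurable]: "(\<lambda>\<omega>. \<Sum>j<2 ^ n. ennreal (\<Delta> n j \<omega> ^ q)) \<in> borel_measurable M" for n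
  proof (rule borel_measurable_sum)
    fix j :: nat assume "j \<in> {..<2 ^ n}"
    then have [measurable]: "\<Delta> n j \<in> borel_measurable M" using \<Delta>_meas by simp
    show "(\<lambda>\<omega>. ennreal (\<Delta> n j \<omega> ^ q)) \<in> borel_measurable M" by measurable
  qed
  have V_meas[measurable]: "V \<in> borel_measurable M" unfolding V_def[abs_def] by measurable
  have incr_le: "(\<integral>\<^sup>+\<omega>. ennreal (\<Delta> n j \<omega> ^ q) \<partial>M) \<le> ennreal (C * T\<^sup>2 * (1 / 4) ^ n)" if j: "j < 2 ^ n" for n j
  proof -
    have diff: "x n (Suc j) - x n j = T / 2 ^ n" by (simp add: x_def distrib_left diff_divide_distrib[symmetric])
    have "0 < T / 2 ^ n" using T by simp
    then have "x n j < x n (Suc j)" using diff by linarith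
    then have "(\<integral>\<^sup>+\<omega>. ennreal (\<Delta> n j \<omega> ^ q) \<partial>M) \<le> ennreal (C * (x n (Suc j) - x n j)\<^sup>2)"
      unfolding \<Delta>_def q_def using x_range[of j n] x_range[of "Suc j" n] j by (intro incr) auto
    also have "(x n (Suc j) - x n j)\<^sup>2 = T\<^sup>2 * (1 / 4) ^ n"
      unfolding diff by (simp add: power_divide power_mult[symmetric] mult.commute[of n 2] power_mult)
    finally show ?thesis by (simp add: mult.assoc)
  qed
  have V_int: "(\<integral>\<^sup>+\<omega>. V \<omega> \<partial>M) \<le> ennreal (3 * C * T\<^sup>2)"
  proof -
    have "(\<integral>\<^sup>+\<omega>. V \<omega> \<partial>M) = (\<Sum>n. \<integral>\<^sup>+\<omega>. ennreal ((4 / 3) ^ n) * (\<Sum>j<2 ^ n. ennreal (\<Delta> n j \<omega> ^ q)) \<partial>M)"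
      unfolding V_def by (intro nn_integral_suminf) measurable
    also have "\<dots> \<le> (\<Sum>n. ennreal (C * T\<^sup>2 * (2 / 3) ^ n))"
    proof (rule suminf_le)
      fix n
      have "(\<integral>\<^sup>+\<omega>. ennreal ((4 / 3) ^ n) * (\<Sum>j<2 ^ n. ennreal (\<Delta> n j \<omega> ^ q)) \<partial>M)
          = ennreal ((4 / 3) ^ n) * (\<Sum>j<2 ^ n. \<integral>\<^sup>+\<omega>. ennreal (\<Delta> n j \<omega> ^ q) \<partial>M)"
        using \<Delta>_meas by (subst nn_integral_cmult) (auto intro!: nn_integral_sum arg_cong2[where f="(*)"])
      also have "\<dots> \<le> ennreal ((4 / 3) ^ n) * (\<Sum>j<(2::nat) ^ n. ennreal (C * T\<^sup>2 * (1 / 4) ^ n))"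
        by (intro mult_left_mono sum_mono incr_le) auto
      also have "(\<Sum>j<(2::nat) ^ n. ennreal (C * T\<^sup>2 * (1 / 4) ^ n)) = ennreal (\<Sum>j<(2::nat) ^ n. C * T\<^sup>2 * (1 / 4) ^ n)"
        using C by (intro sum_ennreal) auto
      also have "ennreal ((4 / 3) ^ n) * \<dots> = ennreal ((4 / 3) ^ n * (\<Sum>j<(2::nat) ^ n. C * T\<^sup>2 * (1 / 4) ^ n))"
        using C by (intro ennreal_mult[symmetric] sum_nonneg) auto
      also have "(4 / 3) ^ n * (\<Sum>j<(2::nat) ^ n. C * T\<^sup>2 * (1 / 4) ^ n) = C * T\<^sup>2 * ((4 / 3) * 2 * (1 / 4)) ^ n"
        by (simp only: sum_constant card_lessThan of_nat_power of_nat_numeral power_mult_distrib mult_ac)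
      finally show "(\<integral>\<^sup>+\<omega>. ennreal ((4 / 3) ^ n) * (\<Sum>j<2 ^ n. ennreal (\<Delta> n j \<omega> ^ q)) \<partial>M)
          \<le> ennreal (C * T\<^sup>2 * (2 / 3) ^ n)" by simp
    qed auto
    also have "\<dots> = ennreal (\<Sum>n. C * T\<^sup>2 * (2 / 3) ^ n)"
      using C by (intro suminf_ennreal2 summable_mult summable_geometric) auto
    also have "(\<Sum>n. C * T\<^sup>2 * (2 / 3) ^ n) = 3 * C * T\<^sup>2"
      by (subst suminf_mult) (auto simp: suminf_geometric)
    finally show ?thesis .
  qed
  define b where "b = 1 / (1 - \<rho>) ^ q"
  have b: "0 \<le> b" using \<rho> by (simp add: b_def)
  \<comment> \<open>A measurable majorant is constructed, since the supremum over uncountably many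
    times need not be measurable.\<close>
  define U where "U \<omega> = ennreal (2 ^ q) * (ennreal (D 0 \<omega> ^ q) + ennreal b * V \<omega>)" for \<omega>
  have D0[measurable]: "D 0 \<in> borel_measurable M" using meas[of 0] T by simp
  show thesis
  proof
    show "U \<in> borel_measurable M" unfolding U_def[abs_def] by measurable
    show "AE \<omega> in M. \<forall>t\<in>{0..T}. ennreal (D t \<omega> ^ (2 * m)) \<le> U \<omega>"
      using cont
    proof eventually_elim
      case (elim \<omega>)
      show ?case
      proof (cases "V \<omega> = \<top>")
        case True
        have "0 < ennreal b" using \<rho> by (simp add: b_def)
        then have "U \<omega> = \<top>" by (simp add: U_def True ennreal_mult_eq_top_iff ennreal_top_mult ennreal_mult_top)
        then show ?thesis by simp
      next
        case False
        then obtain v where v: "V \<omega> = ennreal v" "0 \<le> v" by (cases "V \<omega>") auto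
        \<comment> \<open>With this \<open>Z\<close> every increment of level \<open>n\<close> is at
          most \<open>Z * \<rho> ^ n\<close>: the weight (4/3)^n in \<open>V\<close> is undone by
          \<rho>^q = 3/4.\<close>
        define Z where "Z = root q v"
        have Z: "0 \<le> Z" "Z ^ q = v" using v q by (auto simp: Z_def)
        have step: "\<bar>D (T * real (Suc j) / 2 ^ n) \<omega> - D (T * real j / 2 ^ n) \<omega>\<bar> \<le> Z * \<rho> ^ n"
          if j: "j < 2 ^ n" for n j
        proof -
          have "ennreal (\<Delta> n j \<omega> ^ q) \<le> (\<Sum>j<2 ^ n. ennreal (\<Delta> n j \<omega> ^ q))"
            using j by (intro member_le_sum) auto
          then have "ennreal ((4 / 3) ^ n) * ennreal (\<Delta> n j \<omega> ^ q) \<le> ennreal ((4 / 3) ^ n) * (\<Sum>j<2 ^ n. ennreal (\<Delta> n j \<omega> ^ q))"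
            by (rule mult_left_mono) simp
          also have "\<dots> \<le> V \<omega>"
            unfolding V_def
            using sum_le_suminf[of "\<lambda>n. ennreal ((4 / 3) ^ n) * (\<Sum>j<2 ^ n. ennreal (\<Delta> n j \<omega> ^ q))" "{n}"] by simp
          finally have "(4 / 3) ^ n * \<Delta> n j \<omega> ^ q \<le> v"
            unfolding v(1) using v(2) q by (simp add: ennreal_mult[symmetric] ennreal_le_iff zero_le_even_power)
          then have "\<bar>\<Delta> n j \<omega>\<bar> ^ q \<le> v * (3 / 4) ^ n"
            using q by (simp add: power_even_abs field_simps)
          also have "\<dots> = (Z * \<rho> ^ n) ^ q"
            unfolding power_mult_distrib Z(2) \<rho>(3)[symmetric] by (simp add: power_mult[symmetric] mult.commute)
          finally have "\<bar>\<Delta> n j \<omega>\<bar> \<le> Z * \<rho> ^ n"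
            using power_mono_iff[of "\<bar>\<Delta> n j \<omega>\<bar>" "Z * \<rho> ^ n" q] q Z \<rho> by simp
          then show ?thesis by (simp add: \<Delta>_def x_def)
        qed
        show ?thesis
        proof
          fix t assume t: "t \<in> {0..T}"
          have "\<bar>D t \<omega>\<bar> \<le> \<bar>D 0 \<omega>\<bar> + Z / (1 - \<rho>)"
            using elim T t step \<rho> Z by (intro dyadic_chaining_continuous[where f="\<lambda>t. D t \<omega>"]) auto
          then have "\<bar>D t \<omega>\<bar> ^ q \<le> (\<bar>D 0 \<omega>\<bar> + Z / (1 - \<rho>)) ^ q" by (intro power_mono) auto
          also have "\<dots> \<le> 2 ^ q * (\<bar>D 0 \<omega>\<bar> ^ q + (Z / (1 - \<rho>)) ^ q)"
            using Z \<rho> by (intro abs_add_power_le) auto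
          also have "\<dots> = 2 ^ q * (D 0 \<omega> ^ q + b * v)"
            using q Z(2) by (simp add: power_even_abs power_divide b_def)
          finally have "D t \<omega> ^ q \<le> 2 ^ q * (D 0 \<omega> ^ q + b * v)" using q by (simp add: power_even_abs)
          then have "ennreal (D t \<omega> ^ q) \<le> ennreal (2 ^ q * (D 0 \<omega> ^ q + b * v))" by (rule ennreal_leI)
          also have "\<dots> = U \<omega>"
            unfolding U_def v(1) using v(2) b q
            by (simp add: ennreal_mult ennreal_plus zero_le_even_power)
          finally show "ennreal (D t \<omega> ^ (2 * m)) \<le> U \<omega>" by (simp add: q_def)
        qed
      qed
    qed
    have "(\<integral>\<^sup>+\<omega>. U \<omega> \<partial>M) = ennreal (2 ^ q) * ((\<integral>\<^sup>+\<omega>. ennreal (D 0 \<omega> ^ q) \<partial>M) + ennreal b * (\<integral>\<^sup>+\<omega>. V \<omega> \<partial>M))"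
      unfolding U_def by (simp add: nn_integral_cmult nn_integral_add)
    also have "\<dots> \<le> ennreal (2 ^ q) * (ennreal C + ennreal b * ennreal (3 * C * T\<^sup>2))"
      using init by (intro mult_left_mono add_mono V_int) (auto simp: q_def)
    also have "\<dots> = ennreal (2 ^ q * (C + b * (3 * C * T\<^sup>2)))"
      using C b by (simp add: ennreal_mult ennreal_plus)
    also have "2 ^ q * (C + b * (3 * C * T\<^sup>2)) = chaining_const m T * C"
      by (simp add: chaining_const_def b_def \<rho>_def q_def algebra_simps)
    finally show "(\<integral>\<^sup>+\<omega>. U \<omega> \<partial>M) \<le> ennreal (chaining_const m T * C)" .
  qed
qed

section \<open>Moments of stochastic convolutions\<close>

text \<open>Jensen's inequality for each \<omega>, then Fubini: the moment of a time integral is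
  reduced to moments at fixed times.\<close>

lemma nn_integral_weighted_power_le:
  fixes z :: "real \<Rightarrow> 'a \<Rightarrow> ennreal"
  assumes "sigma_finite_measure M"
    and [measurable]: "\<kappa> \<in> borel_measurable borel" "(\<lambda>(s, \<omega>). z s \<omega>) \<in> borel_measurable (borel \<Otimes>\<^sub>M M)"
  shows "(\<integral>\<^sup>+\<omega>. (\<integral>\<^sup>+s. \<kappa> s * z s \<omega> \<partial>lborel) ^ Suc n \<partial>M)
    \<le> (\<integral>\<^sup>+s. \<kappa> s \<partial>lborel) ^ n * (\<integral>\<^sup>+s. \<kappa> s * (\<integral>\<^sup>+\<omega>. z s \<omega> ^ Suc n \<partial>M) \<partial>lborel)"
proof -
  interpret sigma_finite_measure M by fact
  interpret pair_sigma_finite lborel M ..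
  have z[measurable]: "(\<lambda>(s, \<omega>). z s \<omega>) \<in> borel_measurable (lborel \<Otimes>\<^sub>M M)"
    using assms(3) by (simp cong: measurable_cong_sets sets_pair_measure_cong)
  have sec[measurable]: "(\<lambda>s. z s \<omega>) \<in> borel_measurable lborel" if "\<omega> \<in> space M" for \<omega>
    using measurable_compose[OF measurable_Pair2'[OF that] z] by simp
  have "(\<integral>\<^sup>+\<omega>. (\<integral>\<^sup>+s. \<kappa> s * z s \<omega> \<partial>lborel) ^ Suc n \<partial>M)
      \<le> (\<integral>\<^sup>+\<omega>. (\<integral>\<^sup>+s. \<kappa> s \<partial>lborel) ^ n * (\<integral>\<^sup>+s. \<kappa> s * z s \<omega> ^ Suc n \<partial>lborel) \<partial>M)"
    by (intro nn_integral_mono nn_integral_power_le) (auto intro: sec)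
  also have "\<dots> = (\<integral>\<^sup>+s. \<kappa> s \<partial>lborel) ^ n * (\<integral>\<^sup>+\<omega>. \<integral>\<^sup>+s. \<kappa> s * z s \<omega> ^ Suc n \<partial>lborel \<partial>M)"
    by (intro nn_integral_cmult borel_measurable_nn_integral_fst lborel.borel_measurable_nn_integral) measurable
  also have "(\<integral>\<^sup>+\<omega>. \<integral>\<^sup>+s. \<kappa> s * z s \<omega> ^ Suc n \<partial>lborel \<partial>M) = (\<integral>\<^sup>+s. \<integral>\<^sup>+\<omega>. \<kappa> s * z s \<omega> ^ Suc n \<partial>M \<partial>lborel)"
    by (intro Fubini') measurable
  also have "\<dots> = (\<integral>\<^sup>+s. \<kappa> s * (\<integral>\<^sup>+\<omega>. z s \<omega> ^ Suc n \<partial>M) \<partial>lborel)"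
  proof (intro nn_integral_cong nn_integral_cmult)
    fix s :: real
    show "(\<lambda>\<omega>. z s \<omega> ^ Suc n) \<in> borel_measurable M"
      using measurable_compose[OF measurable_Pair1'[of s borel] assms(3)] by simp
  qed
  finally show ?thesis .
qed

lemma ennreal_add_power_le:
  fixes x y :: ennreal
  shows "(x + y) ^ n \<le> 2 ^ n * (x ^ n + y ^ n)"
proof -
  have "(x + y) ^ n \<le> (2 * max x y) ^ n"
    by (intro power_mono) (auto simp: mult_2 intro: add_mono)
  also have "\<dots> = 2 ^ n * max x y ^ n" by (rule power_mult_distrib)
  also have "\<dots> \<le> 2 ^ n * (x ^ n + y ^ n)"
    by (intro mult_left_mono) (auto simp: max_def)
  finally show ?thesis .
qed

text \<open>The base 8 is 2 * 2 * 2: one factor two comes from \<open>ito_moment_bound\<close>, one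
  from squaring a sum of two terms, and one from raising such a sum to the power
  \<open>Suc n\<close>.\<close>

definition conv_const :: "nat \<Rightarrow> real" where
  "conv_const n = 8 ^ Suc n * moment_const (Suc n)"

lemma conv_const_nonneg: "0 \<le> conv_const n"
  by (simp add: conv_const_def moment_const_nonneg)

context brownian_space
begin

text \<open>The right-hand side contains moments at fixed times only, so it yields a Volterra
  inequality for a function of time. The events \<open>G s\<close> remain inside it, which allows
  localised moments to be fed back into the inequality.\<close>

lemma ito_convolution_moment_bound:
  fixes G :: "real \<Rightarrow> 'a set" and k1 k2 :: "real \<Rightarrow> real"
  assumes ito: "has_ito_integral M F W (\<lambda>s \<omega>. k1 s * \<alpha> s \<omega> + k2 s * \<beta> s \<omega>) t I" and t: "0 \<le> t"
    and \<alpha>: "progressive F t \<alpha>" and \<beta>: "progressive F t \<beta>"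
    and k1: "(\<lambda>s. ennreal ((k1 s)\<^sup>2) * indicator {0..t} s) \<in> borel_measurable borel"
    and k2: "(\<lambda>s. ennreal ((k2 s)\<^sup>2) * indicator {0..t} s) \<in> borel_measurable borel"
    and G_meas: "\<And>s. 0 \<le> s \<Longrightarrow> s \<le> t \<Longrightarrow> G s \<in> sets (F s)"
    and G_anti: "\<And>r s. 0 \<le> r \<Longrightarrow> r \<le> s \<Longrightarrow> s \<le> t \<Longrightarrow> G s \<subseteq> G r"
    and G_left: "\<And>s \<omega>. 0 < s \<Longrightarrow> s \<le> t \<Longrightarrow> (\<And>r. 0 \<le> r \<Longrightarrow> r < s \<Longrightarrow> \<omega> \<in> G r) \<Longrightarrow> \<omega> \<in> G s"
  shows "(\<integral>\<^sup>+\<omega>. ennreal (I \<omega> ^ (2 * Suc n)) * indicator (G t) \<omega> \<partial>M) \<le> ennreal (conv_const n) *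
    ((sq_int t k1) ^ n *
       (\<integral>\<^sup>+s\<in>{0..t}. ennreal ((k1 s)\<^sup>2) * (\<integral>\<^sup>+\<omega>. ennreal (\<alpha> s \<omega> ^ (2 * Suc n)) * indicator (G s) \<omega> \<partial>M) \<partial>lborel)
     + (sq_int t k2) ^ n *
       (\<integral>\<^sup>+s\<in>{0..t}. ennreal ((k2 s)\<^sup>2) * (\<integral>\<^sup>+\<omega>. ennreal (\<beta> s \<omega> ^ (2 * Suc n)) * indicator (G s) \<omega> \<partial>M) \<partial>lborel))"
proof -
  define cl where "cl s = max 0 (min s t)" for s
  have cl: "s \<in> {0..t} \<Longrightarrow> cl s = s" for s by (auto simp: cl_def)
  define \<kappa> where "\<kappa> k s = ennreal ((k s)\<^sup>2) * indicator {0..t} s" for k :: "real \<Rightarrow> real" and s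
  define z where "z x s \<omega> = ennreal ((x (cl s) \<omega>)\<^sup>2) * indicator (G (cl s)) \<omega>" for x :: "real \<Rightarrow> 'a \<Rightarrow> real" and s \<omega>
  define P where "P k x \<omega> = (\<integral>\<^sup>+s. \<kappa> k s * z x s \<omega> \<partial>lborel)" for k x \<omega>
  note \<kappa>_meas[measurable] = k1[folded \<kappa>_def] k2[folded \<kappa>_def]
  have z_meas: "(\<lambda>p. z x (fst p) (snd p)) \<in> borel_measurable (borel \<Otimes>\<^sub>M M)"
    "(\<lambda>p. z x (snd p) (fst p)) \<in> borel_measurable (M \<Otimes>\<^sub>M lborel)"
    "\<omega> \<in> space M \<Longrightarrow> (\<lambda>s. z x s \<omega>) \<in> borel_measurable lborel"
    if x: "progressive F t x" for x \<omega>
  proof -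
    have *: "(\<lambda>p. z x (f p) (g p)) \<in> borel_measurable N"
      if f: "f \<in> borel_measurable N" "g \<in> N \<rightarrow>\<^sub>M M" for f g and N :: "'c measure"
    proof -
      have [measurable]: "(\<lambda>p. x (cl (f p)) (g p)) \<in> borel_measurable N"
        unfolding cl_def by (rule progressive_measurable[OF x t f])
      have [measurable]: "(\<lambda>p. indicator (G (cl (f p))) (g p) :: ennreal) \<in> borel_measurable N"
        unfolding cl_def by (rule decreasing_events_measurable[OF t G_meas G_anti G_left f])
      show ?thesis unfolding z_def by measurable
    qed
    show "(\<lambda>p. z x (fst p) (snd p)) \<in> borel_measurable (borel \<Otimes>\<^sub>M M)" by (rule *) measurable
    show "(\<lambda>p. z x (snd p) (fst p)) \<in> borel_measurable (M \<Otimes>\<^sub>M lborel)" by (rule *) measurable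
    show "\<omega> \<in> space M \<Longrightarrow> (\<lambda>s. z x s \<omega>) \<in> borel_measurable lborel" by (rule *) auto
  qed
  have P_meas: "P k x \<in> borel_measurable M" if x: "progressive F t x" and [measurable]: "\<kappa> k \<in> borel_measurable borel" for k x
  proof -
    note [measurable] = z_meas(2)[OF x]
    show ?thesis unfolding P_def[abs_def]
      by (intro lborel.borel_measurable_nn_integral) (simp add: split_beta', measurable)
  qed
  note [measurable] = P_meas[OF \<alpha> \<kappa>_meas(1)] P_meas[OF \<beta> \<kappa>_meas(2)]
  have P_power: "(\<integral>\<^sup>+\<omega>. P k x \<omega> ^ Suc n \<partial>M) \<le> (sq_int t k) ^ n *
       (\<integral>\<^sup>+s\<in>{0..t}. ennreal ((k s)\<^sup>2) * (\<integral>\<^sup>+\<omega>. ennreal (x s \<omega> ^ (2 * Suc n)) * indicator (G s) \<omega> \<partial>M) \<partial>lborel)"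
    if x: "progressive F t x" and k: "\<kappa> k \<in> borel_measurable borel" for k x
  proof -
    have "(\<integral>\<^sup>+\<omega>. P k x \<omega> ^ Suc n \<partial>M) \<le> (\<integral>\<^sup>+s. \<kappa> k s \<partial>lborel) ^ n *
        (\<integral>\<^sup>+s. \<kappa> k s * (\<integral>\<^sup>+\<omega>. z x s \<omega> ^ Suc n \<partial>M) \<partial>lborel)"
      unfolding P_def using z_meas(1)[OF x]
      by (intro nn_integral_weighted_power_le k sigma_finite_measure_axioms) (simp add: split_beta')
    also have "(\<integral>\<^sup>+s. \<kappa> k s * (\<integral>\<^sup>+\<omega>. z x s \<omega> ^ Suc n \<partial>M) \<partial>lborel) =
        (\<integral>\<^sup>+s\<in>{0..t}. ennreal ((k s)\<^sup>2) * (\<integral>\<^sup>+\<omega>. ennreal (x s \<omega> ^ (2 * Suc n)) * indicator (G s) \<omega> \<partial>M) \<partial>lborel)"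
    proof (rule nn_integral_cong)
      fix s :: real
      have "z x s \<omega> ^ Suc n = ennreal (x s \<omega> ^ (2 * Suc n)) * indicator (G s) \<omega>" if "s \<in> {0..t}" for \<omega>
        using cl[OF that]
        by (auto simp: z_def indicator_def ennreal_power power_mult simp del: power_Suc mult_Suc_right)
      then show "\<kappa> k s * (\<integral>\<^sup>+\<omega>. z x s \<omega> ^ Suc n \<partial>M)
        = ennreal ((k s)\<^sup>2) * (\<integral>\<^sup>+\<omega>. ennreal (x s \<omega> ^ (2 * Suc n)) * indicator (G s) \<omega> \<partial>M) * indicator {0..t} s"
        by (cases "s \<in> {0..t}") (simp_all add: \<kappa>_def)
    qed
    finally show ?thesis by (simp add: \<kappa>_def)
  qed
  have inner: "(\<integral>\<^sup>+s\<in>{0..t}. ennreal ((k1 s * \<alpha> s \<omega> + k2 s * \<beta> s \<omega>)\<^sup>2) * indicator (G s) \<omega> \<partial>lborel)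
      \<le> 2 * (P k1 \<alpha> \<omega> + P k2 \<beta> \<omega>)" if \<omega>: "\<omega> \<in> space M" for \<omega>
  proof -
    note [measurable] = z_meas(3)[OF \<alpha> \<omega>] z_meas(3)[OF \<beta> \<omega>]
    have "(\<integral>\<^sup>+s\<in>{0..t}. ennreal ((k1 s * \<alpha> s \<omega> + k2 s * \<beta> s \<omega>)\<^sup>2) * indicator (G s) \<omega> \<partial>lborel)
        \<le> (\<integral>\<^sup>+s. 2 * (\<kappa> k1 s * z \<alpha> s \<omega> + \<kappa> k2 s * z \<beta> s \<omega>) \<partial>lborel)"
    proof (rule nn_integral_mono)
      fix s :: real
      have "ennreal ((k1 s * \<alpha> s \<omega> + k2 s * \<beta> s \<omega>)\<^sup>2) \<le> ennreal (2 * (k1 s * \<alpha> s \<omega>)\<^sup>2 + 2 * (k2 s * \<beta> s \<omega>)\<^sup>2)"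
        by (intro ennreal_leI power2_sum_le)
      also have "\<dots> = 2 * (ennreal ((k1 s)\<^sup>2) * ennreal ((\<alpha> s \<omega>)\<^sup>2) + ennreal ((k2 s)\<^sup>2) * ennreal ((\<beta> s \<omega>)\<^sup>2))"
        by (simp add: power_mult_distrib ennreal_plus ennreal_mult distrib_left)
      finally show "ennreal ((k1 s * \<alpha> s \<omega> + k2 s * \<beta> s \<omega>)\<^sup>2) * indicator (G s) \<omega> * indicator {0..t} s
        \<le> 2 * (\<kappa> k1 s * z \<alpha> s \<omega> + \<kappa> k2 s * z \<beta> s \<omega>)"
        using cl[of s] by (cases "s \<in> {0..t}"; cases "\<omega> \<in> G s") (simp_all add: \<kappa>_def z_def)
    qed
    also have "\<dots> = 2 * (P k1 \<alpha> \<omega> + P k2 \<beta> \<omega>)"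
      unfolding P_def by (simp add: nn_integral_cmult nn_integral_add)
    finally show ?thesis .
  qed
  have "(\<integral>\<^sup>+\<omega>. ennreal (I \<omega> ^ (2 * Suc n)) * indicator (G t) \<omega> \<partial>M) \<le>
    ennreal (2 ^ Suc n * moment_const (Suc n)) *
      (\<integral>\<^sup>+\<omega>. (\<integral>\<^sup>+s\<in>{0..t}. ennreal ((k1 s * \<alpha> s \<omega> + k2 s * \<beta> s \<omega>)\<^sup>2) * indicator (G s) \<omega> \<partial>lborel) ^ Suc n \<partial>M)"
    by (rule ito_moment_bound[OF ito t _ G_meas G_anti G_left]) simp_all
  also have "\<dots> \<le> ennreal (2 ^ Suc n * moment_const (Suc n)) *
      (\<integral>\<^sup>+\<omega>. 4 ^ Suc n * (P k1 \<alpha> \<omega> ^ Suc n + P k2 \<beta> \<omega> ^ Suc n) \<partial>M)"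
  proof (intro mult_left_mono nn_integral_mono)
    fix \<omega> assume "\<omega> \<in> space M"
    then have "(\<integral>\<^sup>+s\<in>{0..t}. ennreal ((k1 s * \<alpha> s \<omega> + k2 s * \<beta> s \<omega>)\<^sup>2) * indicator (G s) \<omega> \<partial>lborel) ^ Suc n
        \<le> (2 * (P k1 \<alpha> \<omega> + P k2 \<beta> \<omega>)) ^ Suc n"
      by (intro power_mono inner) auto
    also have "\<dots> = 2 ^ Suc n * (P k1 \<alpha> \<omega> + P k2 \<beta> \<omega>) ^ Suc n"
      by (rule power_mult_distrib)
    also have "\<dots> \<le> 2 ^ Suc n * (2 ^ Suc n * (P k1 \<alpha> \<omega> ^ Suc n + P k2 \<beta> \<omega> ^ Suc n))"
      by (intro mult_left_mono ennreal_add_power_le) auto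
    also have "\<dots> = 4 ^ Suc n * (P k1 \<alpha> \<omega> ^ Suc n + P k2 \<beta> \<omega> ^ Suc n)"
      unfolding mult.assoc[symmetric] power_mult_distrib[symmetric] by simp
    finally show "(\<integral>\<^sup>+s\<in>{0..t}. ennreal ((k1 s * \<alpha> s \<omega> + k2 s * \<beta> s \<omega>)\<^sup>2) * indicator (G s) \<omega> \<partial>lborel) ^ Suc n
      \<le> 4 ^ Suc n * (P k1 \<alpha> \<omega> ^ Suc n + P k2 \<beta> \<omega> ^ Suc n)" .
  qed auto
  also have "(\<integral>\<^sup>+\<omega>. 4 ^ Suc n * (P k1 \<alpha> \<omega> ^ Suc n + P k2 \<beta> \<omega> ^ Suc n) \<partial>M)
      = 4 ^ Suc n * ((\<integral>\<^sup>+\<omega>. P k1 \<alpha> \<omega> ^ Suc n \<partial>M) + (\<integral>\<^sup>+\<omega>. P k2 \<beta> \<omega> ^ Suc n \<partial>M))"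
    by (simp add: nn_integral_cmult nn_integral_add del: power_Suc)
  also have "ennreal (2 ^ Suc n * moment_const (Suc n)) *
      (4 ^ Suc n * ((\<integral>\<^sup>+\<omega>. P k1 \<alpha> \<omega> ^ Suc n \<partial>M) + (\<integral>\<^sup>+\<omega>. P k2 \<beta> \<omega> ^ Suc n \<partial>M)))
      = ennreal (conv_const n) * ((\<integral>\<^sup>+\<omega>. P k1 \<alpha> \<omega> ^ Suc n \<partial>M) + (\<integral>\<^sup>+\<omega>. P k2 \<beta> \<omega> ^ Suc n \<partial>M))"
  proof -
    have "conv_const n = 2 ^ Suc n * moment_const (Suc n) * 4 ^ Suc n"
      by (simp only: conv_const_def mult_ac power_mult_distrib[symmetric]) simp
    then have "ennreal (conv_const n) = ennreal (2 ^ Suc n * moment_const (Suc n)) * ennreal (4 ^ Suc n)"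
      by (simp add: ennreal_mult' moment_const_nonneg del: power_Suc)
    also have "ennreal (4 ^ Suc n) = 4 ^ Suc n" by (simp add: ennreal_power[symmetric] del: power_Suc)
    finally show ?thesis by (simp add: mult.assoc)
  qed
  also have "\<dots> \<le> ennreal (conv_const n) *
    ((sq_int t k1) ^ n *
       (\<integral>\<^sup>+s\<in>{0..t}. ennreal ((k1 s)\<^sup>2) * (\<integral>\<^sup>+\<omega>. ennreal (\<alpha> s \<omega> ^ (2 * Suc n)) * indicator (G s) \<omega> \<partial>M) \<partial>lborel)
     + (sq_int t k2) ^ n *
       (\<integral>\<^sup>+s\<in>{0..t}. ennreal ((k2 s)\<^sup>2) * (\<integral>\<^sup>+\<omega>. ennreal (\<beta> s \<omega> ^ (2 * Suc n)) * indicator (G s) \<omega> \<partial>M) \<partial>lborel))"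
    by (intro mult_left_mono add_mono P_power \<alpha> \<beta> \<kappa>_meas) auto
  finally show ?thesis .
qed

end

section \<open>A priori moments of Volterra solutions\<close>

lemma reflected_kernel_measurable:
  assumes "in_L \<gamma> T K" "t \<le> T"
  shows "(\<lambda>s. ennreal ((K (t - s))\<^sup>2) * indicator {0..t} s) \<in> borel_measurable borel"
proof -
  have "(\<lambda>s. t - s) \<in> borel_measurable borel" by measurable
  from measurable_compose[OF this in_L_square_measurable[OF assms(1) order_refl assms(2)]] show ?thesis
    by (rule subst[OF measurable_cong, rotated -1]) (auto simp: indicator_def)
qed

lemma reflected_kernel_integral_le:
  assumes K: "in_L \<gamma> T K" and \<gamma>: "2 < \<gamma>" and t: "t \<in> {0..T}" and T: "0 < T"
    and \<Lambda>: "L_norm \<gamma> T K \<le> \<Lambda>" "0 < \<Lambda>"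
  shows "(sq_int t (\<lambda>s. K (t - s))) \<le> ennreal (2 * \<Lambda>\<^sup>2 * T powr (1 - 2 / \<gamma>))"
proof -
  have "(sq_int t (\<lambda>s. K (t - s))) = (sq_int t K)"
    using set_nn_integral_reflect[of "\<lambda>u. ennreal ((K u)\<^sup>2)" 0 t t] in_L_square_measurable[OF K, of 0 t] t
    by simp
  also have "\<dots> \<le> (sq_int T K)"
    using t by (intro nn_integral_mono) (auto simp: indicator_def)
  also have "\<dots> \<le> ennreal (2 * \<Lambda>\<^sup>2 * T powr (1 - 2 / \<gamma>))"
    by (rule kernel_square_le[OF K \<gamma> T order_refl \<Lambda>])
  finally show ?thesis .
qed

lemma linear_growth_power_le:
  fixes \<sigma> :: "real \<Rightarrow> real"
  assumes "\<And>x. \<bar>\<sigma> x\<bar> \<le> G * (1 + \<bar>x\<bar>)"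
  shows "\<sigma> x ^ (2 * m) \<le> (2 * \<bar>G\<bar>) ^ (2 * m) * (1 + x ^ (2 * m))"
proof -
  have "\<bar>\<sigma> x\<bar> \<le> \<bar>G\<bar> * (1 + \<bar>x\<bar>)"
    using assms[of x] by (rule order_trans) (intro mult_right_mono, auto)
  then have "\<bar>\<sigma> x\<bar> ^ (2 * m) \<le> (\<bar>G\<bar> * (1 + \<bar>x\<bar>)) ^ (2 * m)"
    by (intro power_mono) auto
  also have "\<dots> = \<bar>G\<bar> ^ (2 * m) * (1 + \<bar>x\<bar>) ^ (2 * m)" by (rule power_mult_distrib)
  also have "\<dots> \<le> \<bar>G\<bar> ^ (2 * m) * (2 ^ (2 * m) * (1 ^ (2 * m) + \<bar>x\<bar> ^ (2 * m)))"
    by (intro mult_left_mono abs_add_power_le) auto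
  also have "\<dots> = (2 * \<bar>G\<bar>) ^ (2 * m) * (1 + x ^ (2 * m))"
    by (simp add: power_mult_distrib power_even_abs)
  finally show ?thesis by (simp add: power_even_abs)
qed

context brownian_space
begin

lemma progressive_adapted:
  assumes "progressive F T X" "t \<in> {0..T}"
  shows "X t \<in> borel_measurable (F t)"
proof -
  have X: "(\<lambda>(s, \<omega>). X s \<omega>) \<in> borel_measurable (restrict_space borel {0..t} \<Otimes>\<^sub>M F t)"
    using assms by (simp add: progressive_def)
  have "Pair t \<in> F t \<rightarrow>\<^sub>M restrict_space borel {0..t} \<Otimes>\<^sub>M F t"
    using assms(2) by (intro measurable_Pair1') (simp add: space_restrict_space)
  from measurable_compose[OF this X] show ?thesis by simp
qed

lemma progressive_compose:
  "progressive F T X \<Longrightarrow> \<sigma> \<in> borel_measurable borel \<Longrightarrow> progressive F T (\<lambda>s \<omega>. \<sigma> (X s \<omega>))"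
  unfolding progressive_def split_beta' by (auto intro: measurable_compose)

lemma progressive_mono: "progressive F T X \<Longrightarrow> t \<le> T \<Longrightarrow> progressive F t X"
  by (auto simp: progressive_def)

lemma progressive_zero: "progressive F T (\<lambda>_ _. 0)"
  by (simp add: progressive_def)

text \<open>Localising by the events that \<open>\<bar>X\<bar> \<le> N\<close> up to a given time makes the moments finite, as
  the Gronwall argument requires; its bound does not depend on \<open>N\<close>.\<close>

lemma volterra_moment_bound:
  fixes T \<gamma> G B R :: real and n :: nat
  assumes T: "0 < T" and \<gamma>: "2 < \<gamma>"
  obtains C where "0 \<le> C" "\<And>\<sigma> x0 K X t. \<sigma> \<in> borel_measurable borel \<Longrightarrow> (\<And>x. \<bar>\<sigma> x\<bar> \<le> G * (1 + \<bar>x\<bar>)) \<Longrightarrow>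
    (\<And>t. t \<in> {0..T} \<Longrightarrow> \<bar>x0 t\<bar> \<le> B) \<Longrightarrow> in_L \<gamma> T K \<Longrightarrow> L_norm \<gamma> T K \<le> R \<Longrightarrow>
    volterra_solution M F W T x0 K \<sigma> X \<Longrightarrow> t \<in> {0..T} \<Longrightarrow>
    (\<integral>\<^sup>+\<omega>. ennreal (X t \<omega> ^ (2 * Suc n)) \<partial>M) \<le> ennreal C"
proof -
  define q where "q = 2 * Suc n"
  have q: "even q" by (simp add: q_def)
  define R' where "R' = max R 1"
  have R': "R \<le> R'" "0 < R'" by (auto simp: R'_def)
  define Q where "Q = 2 * R'\<^sup>2 * T powr (1 - 2 / \<gamma>)"
  have Q: "0 \<le> Q" by (simp add: Q_def)
  define b where "b = 2 ^ q * conv_const n * Q ^ n * (2 * \<bar>G\<bar>) ^ q"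
  have b: "0 \<le> b" using Q by (simp add: b_def conv_const_nonneg)
  define a where "a = 1 + 2 ^ q * \<bar>B\<bar> ^ q"
  have a: "0 \<le> a" by (simp add: a_def)
  \<comment> \<open>Small enough for \<open>b * \<eta>\<close> to be at most one half; the added 1
    covers the case \<open>b = 0\<close>.\<close>
  define \<eta> where "\<eta> = 1 / (2 * (b + 1))"
  have \<eta>: "0 < \<eta>" "b * \<eta> \<le> 1 / 2" using b by (auto simp: \<eta>_def field_simps)
  obtain \<theta> where \<theta>: "0 < \<theta>" and small: "\<And>K. in_L \<gamma> T K \<Longrightarrow> L_norm \<gamma> T K \<le> R \<Longrightarrow>
    (\<integral>\<^sup>+u\<in>{0..T}. ennreal (exp (- \<theta> * u)) * ennreal ((K u)\<^sup>2) \<partial>lborel) \<le> ennreal \<eta>"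
    using weighted_kernel_square_small[OF \<gamma> \<eta>(1) T] by blast
  define C where "C = 2 * a * exp (\<theta> * T)"
  show thesis
  proof (rule that[of C])
    show "0 \<le> C" using a by (simp add: C_def)
    fix \<sigma> x0 K X t
    assume \<sigma>[measurable]: "\<sigma> \<in> borel_measurable borel" and growth: "\<And>x. \<bar>\<sigma> x\<bar> \<le> G * (1 + \<bar>x\<bar>)"
      and x0: "\<And>t. t \<in> {0..T} \<Longrightarrow> \<bar>x0 t\<bar> \<le> B"
      and K: "in_L \<gamma> T K" "L_norm \<gamma> T K \<le> R" and sol: "volterra_solution M F W T x0 K \<sigma> X"
      and t: "t \<in> {0..T}"
    have prog: "progressive F T X" and cont: "AE \<omega> in M. continuous_on {0..T} (\<lambda>t. X t \<omega>)"
      and ito: "\<And>t. t \<in> {0..T} \<Longrightarrow> has_ito_integral M F W (\<lambda>s \<omega>. K (t - s) * \<sigma> (X s \<omega>)) t (\<lambda>\<omega>. X t \<omega> - x0 t)"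
      using sol by (auto simp: volterra_solution_def)
    have X_meas: "X t \<in> borel_measurable (F t)" if "t \<in> {0..T}" for t
      using progressive_adapted[OF prog that] .
    have X_M: "X t \<in> borel_measurable M" if "t \<in> {0..T}" for t
      using measurable_F_M[OF X_meas[OF that]] .
    \<comment> \<open>Besides time zero only times strictly before \<open>s\<close> are tested,
      which makes the family left-continuous; rational times keep the intersection countable and the
      event measurable at \<open>s\<close>.\<close>
    define E where "E N s = {\<omega> \<in> space M. \<bar>X 0 \<omega>\<bar> \<le> real N \<and>
        (\<forall>r\<in>{r::rat. 0 \<le> r \<and> of_rat r < s}. \<bar>X (of_rat r) \<omega>\<bar> \<le> real N)}" for N :: nat and s :: real
    have E_meas: "E N s \<in> sets (F s)" if s: "0 \<le> s" "s \<le> T" for N s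
    proof -
      have [measurable]: "X 0 \<in> borel_measurable (F s)"
        using measurable_F_mono[OF s(1) X_meas] T by simp
      have "Measurable.pred (F s) (\<lambda>\<omega>. \<forall>r\<in>{r::rat. 0 \<le> r \<and> of_rat r < s}. \<bar>X (of_rat r) \<omega>\<bar> \<le> real N)"
      proof (rule pred_intros_countable_bounded)
        fix r :: rat assume r: "r \<in> {r. 0 \<le> r \<and> of_rat r < s}"
        then have [measurable]: "X (of_rat r) \<in> borel_measurable (F s)"
          using s by (intro measurable_F_mono[OF _ X_meas]) auto
        show "Measurable.pred (F s) (\<lambda>\<omega>. \<bar>X (of_rat r) \<omega>\<bar> \<le> real N)" by measurable
      qed
      then have A: "{\<omega> \<in> space (F s). \<forall>r\<in>{r::rat. 0 \<le> r \<and> of_rat r < s}. \<bar>X (of_rat r) \<omega>\<bar> \<le> real N} \<in> sets (F s)"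
        (is "?A \<in> _") by (rule predE)
      have B: "{\<omega> \<in> space (F s). \<bar>X 0 \<omega>\<bar> \<le> real N} \<in> sets (F s)" (is "?B \<in> _") by measurable
      have eq: "E N s = ?A \<inter> ?B" unfolding E_def space_F by blast
      show ?thesis unfolding eq by (rule sets.Int[OF A B])
    qed
    have E_anti: "E N s \<subseteq> E N r" if "r \<le> s" for N r s
      using that by (auto simp: E_def)
    have E_left: "\<omega> \<in> E N s" if s: "0 < s" and mem: "\<And>r. 0 \<le> r \<Longrightarrow> r < s \<Longrightarrow> \<omega> \<in> E N r" for N s \<omega>
    proof -
      have "\<omega> \<in> space M" "\<bar>X 0 \<omega>\<bar> \<le> real N" using mem[of 0] s by (auto simp: E_def)
      moreover have "\<bar>X (of_rat r) \<omega>\<bar> \<le> real N" if r: "0 \<le> r" "of_rat r < s" for r :: rat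
      proof -
        have "0 \<le> (of_rat r :: real)" using r by simp
        \<comment> \<open>An event controls only times strictly before its index, hence the midpoint
          between \<open>r\<close> and \<open>s\<close>.\<close>
        then have "\<omega> \<in> E N ((of_rat r + s) / 2)" using r s by (intro mem) auto
        moreover have "of_rat r < (of_rat r + s) / 2" using r by simp
        ultimately show ?thesis using r(1) unfolding E_def by blast
      qed
      ultimately show ?thesis by (auto simp: E_def)
    qed
    \<comment> \<open>The time \<open>s\<close> itself is reached from earlier rational times by
      continuity of the path, so the bound holds almost surely.\<close>
    have E_bound: "AE \<omega> in M. \<omega> \<in> E N s \<longrightarrow> \<bar>X s \<omega>\<bar> \<le> real N" if s: "s \<in> {0..T}" for N s
      using cont
    proof eventually_elim
      case (elim \<omega>)
      show ?case
      proof
        assume E: "\<omega> \<in> E N s"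
        show "\<bar>X s \<omega>\<bar> \<le> real N"
        proof (cases "s = 0")
          case False
          then have s0: "0 < s" using s by simp
          have "\<exists>r::rat. max 0 (s - 1 / real (Suc k)) < of_rat r \<and> of_rat r < s" for k
            using s0 by (intro of_rat_dense) auto
          then obtain r :: "nat \<Rightarrow> rat" where r: "\<And>k. max 0 (s - 1 / real (Suc k)) < of_rat (r k)" "\<And>k. of_rat (r k) < s"
            by metis
          have lim: "(\<lambda>k. s - 1 / real (Suc k)) \<longlonglongrightarrow> s"
            using tendsto_diff[OF tendsto_const LIMSEQ_Suc[OF lim_const_over_n[of 1]], of s] by simp
          have lo: "s - 1 / real (Suc k) \<le> of_rat (r k)" and hi: "of_rat (r k) \<le> s" for k
            using r[of k] by linarith+
          have "(\<lambda>k. of_rat (r k)) \<longlonglongrightarrow> s"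
            by (rule tendsto_sandwich[OF always_eventually always_eventually lim tendsto_const])
               (intro allI lo hi)+
          moreover have r_range: "of_rat (r k) \<in> {0..T}" for k
            using r[of k] s unfolding atLeastAtMost_iff by linarith
          ultimately have "(\<lambda>k. X (of_rat (r k)) \<omega>) \<longlonglongrightarrow> X s \<omega>"
            using elim s by (intro continuous_on_tendsto_compose[of "{0..T}" "\<lambda>t. X t \<omega>"]) auto
          then have "(\<lambda>k. \<bar>X (of_rat (r k)) \<omega>\<bar>) \<longlonglongrightarrow> \<bar>X s \<omega>\<bar>" by (rule tendsto_rabs)
          moreover have "\<bar>X (of_rat (r k)) \<omega>\<bar> \<le> real N" for k
            using E r[of k] by (auto simp: E_def)
          ultimately show ?thesis by (intro LIMSEQ_le_const2) auto
        qed (use E in \<open>auto simp: E_def\<close>)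
      qed
    qed
    define f where "f N s = (\<integral>\<^sup>+\<omega>. ennreal (X s \<omega> ^ q) * indicator (E N s) \<omega> \<partial>M)" for N s
    have f_bdd: "f N s \<le> ennreal (real N ^ q)" if s: "s \<in> {0..T}" for N s
    proof -
      have "f N s \<le> (\<integral>\<^sup>+\<omega>. ennreal (real N ^ q) \<partial>M)"
        unfolding f_def
      proof (rule nn_integral_mono_AE)
        show "AE \<omega> in M. ennreal (X s \<omega> ^ q) * indicator (E N s) \<omega> \<le> ennreal (real N ^ q)"
          using E_bound[OF s, of N]
        proof eventually_elim
          case (elim \<omega>)
          have "X s \<omega> ^ q \<le> real N ^ q" if "\<bar>X s \<omega>\<bar> \<le> real N"
            using power_mono[OF that, of q] q by (simp add: power_even_abs)
          then show ?case using elim by (auto simp: indicator_def intro!: ennreal_leI)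
        qed
      qed
      then show ?thesis by (simp add: emeasure_space_1)
    qed
    \<comment> \<open>Adding 1 removes the affine part: by linear growth the moment of \<sigma> at
      \<open>X s\<close> is at most a multiple of \<open>1 + f N s\<close>, so the same quantity
      stands on both sides.\<close>
    have f_le: "1 + f N t \<le> ennreal a + ennreal b * (\<integral>\<^sup>+s\<in>{0..t}. ennreal ((K (t - s))\<^sup>2) * (1 + f N s) \<partial>lborel)"
      if t: "t \<in> {0..T}" for N t
    proof -
      let ?\<kappa> = "sq_int t (\<lambda>s. K (t - s))"
      let ?J = "\<integral>\<^sup>+s\<in>{0..t}. ennreal ((K (t - s))\<^sup>2) * (1 + f N s) \<partial>lborel"
      have [measurable]: "E N t \<in> sets M" "X t \<in> borel_measurable M"
        using E_meas[of t N] t sets_F_M X_M by auto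
      have "(\<integral>\<^sup>+\<omega>. ennreal ((X t \<omega> - x0 t) ^ (2 * Suc n)) * indicator (E N t) \<omega> \<partial>M) \<le> ennreal (conv_const n) *
        (?\<kappa> ^ n * (\<integral>\<^sup>+s\<in>{0..t}. ennreal ((K (t - s))\<^sup>2) *
            (\<integral>\<^sup>+\<omega>. ennreal (\<sigma> (X s \<omega>) ^ (2 * Suc n)) * indicator (E N s) \<omega> \<partial>M) \<partial>lborel)
        + (\<integral>\<^sup>+s\<in>{0..t}. ennreal (0\<^sup>2) \<partial>lborel) ^ n * (\<integral>\<^sup>+s\<in>{0..t}. ennreal (0\<^sup>2) *
            (\<integral>\<^sup>+\<omega>. ennreal (0 ^ (2 * Suc n)) * indicator (E N s) \<omega> \<partial>M) \<partial>lborel))"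
      proof (rule ito_convolution_moment_bound)
        show "has_ito_integral M F W (\<lambda>s \<omega>. K (t - s) * \<sigma> (X s \<omega>) + 0 * 0) t (\<lambda>\<omega>. X t \<omega> - x0 t)"
          using ito[OF t] by simp
        show "progressive F t (\<lambda>s \<omega>. \<sigma> (X s \<omega>))"
          by (rule progressive_compose[OF progressive_mono[OF prog] \<sigma>]) (use t in simp)
        show "(\<lambda>s. ennreal ((K (t - s))\<^sup>2) * indicator {0..t} s) \<in> borel_measurable borel"
          using reflected_kernel_measurable[OF K(1)] t by simp
      qed (use t progressive_zero E_meas E_anti E_left in auto)
      also have "\<dots> = ennreal (conv_const n) * (?\<kappa> ^ n * (\<integral>\<^sup>+s\<in>{0..t}. ennreal ((K (t - s))\<^sup>2) *
            (\<integral>\<^sup>+\<omega>. ennreal (\<sigma> (X s \<omega>) ^ q) * indicator (E N s) \<omega> \<partial>M) \<partial>lborel))"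
        by (simp add: q_def)
      also have "\<dots> \<le> ennreal (conv_const n) * (ennreal Q ^ n * (ennreal ((2 * \<bar>G\<bar>) ^ q) * ?J))"
      proof (intro mult_left_mono mult_mono power_mono)
        show "?\<kappa> \<le> ennreal Q"
          unfolding Q_def using K R' by (intro reflected_kernel_integral_le \<gamma> t T) auto
        have inner: "(\<integral>\<^sup>+\<omega>. ennreal (\<sigma> (X s \<omega>) ^ q) * indicator (E N s) \<omega> \<partial>M) \<le> ennreal ((2 * \<bar>G\<bar>) ^ q) * (1 + f N s)"
          if s: "s \<in> {0..t}" for s
        proof -
          have [measurable]: "E N s \<in> sets M" "X s \<in> borel_measurable M"
            using E_meas[of s N] s t sets_F_M X_M by auto
          have "(\<integral>\<^sup>+\<omega>. ennreal (\<sigma> (X s \<omega>) ^ q) * indicator (E N s) \<omega> \<partial>M)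
            \<le> (\<integral>\<^sup>+\<omega>. ennreal ((2 * \<bar>G\<bar>) ^ q) * (1 + ennreal (X s \<omega> ^ q) * indicator (E N s) \<omega>) \<partial>M)"
          proof (rule nn_integral_mono)
            fix \<omega>
            have "ennreal (\<sigma> (X s \<omega>) ^ q) \<le> ennreal ((2 * \<bar>G\<bar>) ^ q * (1 + X s \<omega> ^ q))"
              unfolding q_def by (intro ennreal_leI linear_growth_power_le growth)
            also have "\<dots> = ennreal ((2 * \<bar>G\<bar>) ^ q) * (1 + ennreal (X s \<omega> ^ q))"
              using q by (simp add: ennreal_mult ennreal_plus zero_le_even_power)
            finally show "ennreal (\<sigma> (X s \<omega>) ^ q) * indicator (E N s) \<omega>
              \<le> ennreal ((2 * \<bar>G\<bar>) ^ q) * (1 + ennreal (X s \<omega> ^ q) * indicator (E N s) \<omega>)"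
              by (auto simp: indicator_def)
          qed
          also have "\<dots> = ennreal ((2 * \<bar>G\<bar>) ^ q) * (1 + f N s)"
            unfolding f_def by (simp add: nn_integral_cmult nn_integral_add emeasure_space_1)
          finally show ?thesis .
        qed
        have "(\<integral>\<^sup>+s\<in>{0..t}. ennreal ((K (t - s))\<^sup>2) *
            (\<integral>\<^sup>+\<omega>. ennreal (\<sigma> (X s \<omega>) ^ q) * indicator (E N s) \<omega> \<partial>M) \<partial>lborel)
          \<le> (\<integral>\<^sup>+s. ennreal ((2 * \<bar>G\<bar>) ^ q) * (ennreal ((K (t - s))\<^sup>2) * (1 + f N s) * indicator {0..t} s) \<partial>lborel)"
        proof (rule nn_integral_mono)
          fix s :: real
          have "ennreal ((K (t - s))\<^sup>2) * (\<integral>\<^sup>+\<omega>. ennreal (\<sigma> (X s \<omega>) ^ q) * indicator (E N s) \<omega> \<partial>M)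
            \<le> ennreal ((K (t - s))\<^sup>2) * (ennreal ((2 * \<bar>G\<bar>) ^ q) * (1 + f N s))" if "s \<in> {0..t}"
            by (intro mult_left_mono inner that) auto
          then show "ennreal ((K (t - s))\<^sup>2) * (\<integral>\<^sup>+\<omega>. ennreal (\<sigma> (X s \<omega>) ^ q) * indicator (E N s) \<omega> \<partial>M) * indicator {0..t} s
            \<le> ennreal ((2 * \<bar>G\<bar>) ^ q) * (ennreal ((K (t - s))\<^sup>2) * (1 + f N s) * indicator {0..t} s)"
            by (cases "s \<in> {0..t}") (simp_all add: mult_ac)
        qed
        also have "\<dots> = ennreal ((2 * \<bar>G\<bar>) ^ q) * ?J"
        proof (rule nn_integral_cmult)
          define cl where "cl s = max 0 (min s T)" for s
          have [measurable]: "(\<lambda>p. X (cl (snd p)) (fst p)) \<in> borel_measurable (M \<Otimes>\<^sub>M lborel)"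
            unfolding cl_def by (rule progressive_measurable[OF prog]) (use T in auto)
          have [measurable]: "(\<lambda>p. X (cl (fst p)) (snd p)) \<in> borel_measurable (lborel \<Otimes>\<^sub>M M)"
            unfolding cl_def by (rule progressive_measurable[OF prog]) (use T in auto)
          have [measurable]: "(\<lambda>p. indicator (E N (cl (fst p))) (snd p) :: ennreal) \<in> borel_measurable (lborel \<Otimes>\<^sub>M M)"
            unfolding cl_def
            by (rule decreasing_events_measurable) (use T E_meas E_anti E_left in auto)
          have [measurable]: "(\<lambda>s. f N (cl s)) \<in> borel_measurable lborel"
            unfolding f_def by (intro borel_measurable_nn_integral) (simp add: split_beta', measurable)
          note [measurable] = reflected_kernel_measurable[OF K(1), of t]
          have "(\<lambda>s. (ennreal ((K (t - s))\<^sup>2) * indicator {0..t} s) * (1 + f N (cl s))) \<in> borel_measurable lborel"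
            using t by simp
          also have "(\<lambda>s. (ennreal ((K (t - s))\<^sup>2) * indicator {0..t} s) * (1 + f N (cl s)))
            = (\<lambda>s. ennreal ((K (t - s))\<^sup>2) * (1 + f N s) * indicator {0..t} s)"
            using t by (auto simp: fun_eq_iff indicator_def cl_def)
          finally show "(\<lambda>s. ennreal ((K (t - s))\<^sup>2) * (1 + f N s) * indicator {0..t} s) \<in> borel_measurable lborel" .
        qed
        finally show "(\<integral>\<^sup>+s\<in>{0..t}. ennreal ((K (t - s))\<^sup>2) *
            (\<integral>\<^sup>+\<omega>. ennreal (\<sigma> (X s \<omega>) ^ q) * indicator (E N s) \<omega> \<partial>M) \<partial>lborel) \<le> ennreal ((2 * \<bar>G\<bar>) ^ q) * ?J" .
      qed auto
      finally have I_le: "(\<integral>\<^sup>+\<omega>. ennreal ((X t \<omega> - x0 t) ^ q) * indicator (E N t) \<omega> \<partial>M)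
        \<le> ennreal (conv_const n) * (ennreal Q ^ n * (ennreal ((2 * \<bar>G\<bar>) ^ q) * ?J))"
        by (simp only: q_def)
      have "f N t \<le> (\<integral>\<^sup>+\<omega>. ennreal (2 ^ q * \<bar>B\<bar> ^ q) + ennreal (2 ^ q) * (ennreal ((X t \<omega> - x0 t) ^ q) * indicator (E N t) \<omega>) \<partial>M)"
        unfolding f_def
      proof (rule nn_integral_mono)
        fix \<omega>
        have "\<bar>X t \<omega>\<bar> ^ q \<le> (\<bar>B\<bar> + \<bar>X t \<omega> - x0 t\<bar>) ^ q"
          using x0[OF t] by (intro power_mono) auto
        also have "\<dots> \<le> 2 ^ q * (\<bar>B\<bar> ^ q + \<bar>X t \<omega> - x0 t\<bar> ^ q)" by (intro abs_add_power_le) auto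
        finally have "X t \<omega> ^ q \<le> 2 ^ q * \<bar>B\<bar> ^ q + 2 ^ q * (X t \<omega> - x0 t) ^ q"
          using q by (simp add: power_even_abs distrib_left)
        then have "ennreal (X t \<omega> ^ q) \<le> ennreal (2 ^ q * \<bar>B\<bar> ^ q + 2 ^ q * (X t \<omega> - x0 t) ^ q)"
          by (rule ennreal_leI)
        also have "\<dots> = ennreal (2 ^ q * \<bar>B\<bar> ^ q) + ennreal (2 ^ q) * ennreal ((X t \<omega> - x0 t) ^ q)"
          using q by (simp add: ennreal_plus ennreal_mult zero_le_even_power)
        finally show "ennreal (X t \<omega> ^ q) * indicator (E N t) \<omega>
          \<le> ennreal (2 ^ q * \<bar>B\<bar> ^ q) + ennreal (2 ^ q) * (ennreal ((X t \<omega> - x0 t) ^ q) * indicator (E N t) \<omega>)"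
          by (auto simp: indicator_def)
      qed
      also have "\<dots> = ennreal (2 ^ q * \<bar>B\<bar> ^ q) + ennreal (2 ^ q) *
          (\<integral>\<^sup>+\<omega>. ennreal ((X t \<omega> - x0 t) ^ q) * indicator (E N t) \<omega> \<partial>M)"
        by (simp add: nn_integral_add nn_integral_cmult emeasure_space_1)
      also have "\<dots> \<le> ennreal (2 ^ q * \<bar>B\<bar> ^ q) + ennreal (2 ^ q) *
          (ennreal (conv_const n) * (ennreal Q ^ n * (ennreal ((2 * \<bar>G\<bar>) ^ q) * ?J)))"
        by (intro add_left_mono mult_left_mono I_le) auto
      also have "ennreal (2 ^ q) * (ennreal (conv_const n) * (ennreal Q ^ n * (ennreal ((2 * \<bar>G\<bar>) ^ q) * ?J))) = ennreal b * ?J"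
        unfolding b_def using Q by (simp add: ennreal_mult ennreal_power conv_const_nonneg mult.assoc)
      finally have "1 + f N t \<le> 1 + (ennreal (2 ^ q * \<bar>B\<bar> ^ q) + ennreal b * ?J)"
        by (rule add_left_mono)
      also have "\<dots> = ennreal a + ennreal b * ?J"
        by (simp add: a_def ennreal_plus add.assoc)
      finally show ?thesis .
    qed
    have f_C: "f N t \<le> ennreal C" for N
    proof -
      have "1 + f N t \<le> 2 * ennreal a * ennreal (exp (\<theta> * T))"
      proof (rule volterra_gronwall[OF K(1) b \<theta> _ _ _ _ t, where f="\<lambda>t. 1 + f N t" and N="1 + ennreal (real N ^ q)"])
        have "ennreal b * (\<integral>\<^sup>+u\<in>{0..T}. ennreal (exp (- \<theta> * u)) * ennreal ((K u)\<^sup>2) \<partial>lborel)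
          \<le> ennreal b * ennreal \<eta>" by (intro mult_left_mono small K) auto
        also have "\<dots> = ennreal (b * \<eta>)"
          by (rule ennreal_mult[symmetric]) (use b \<eta> in auto)
        also have "\<dots> \<le> ennreal (1 / 2)" by (rule ennreal_leI[OF \<eta>(2)])
        finally show "ennreal b * (\<integral>\<^sup>+u\<in>{0..T}. ennreal (exp (- \<theta> * u)) * ennreal ((K u)\<^sup>2) \<partial>lborel) \<le> ennreal (1 / 2)" .
      qed (use f_bdd f_le in \<open>auto intro!: add_left_mono simp: less_top\<close>)
      also have "\<dots> = ennreal C" unfolding C_def using a by (simp add: ennreal_mult)
      finally show ?thesis by (rule order_trans[rotated]) simp
    qed
    have [measurable]: "E N t \<in> sets M" for N using E_meas[of t N] t sets_F_M by auto
    have [measurable]: "X t \<in> borel_measurable M" using X_M t by blast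
    have "(\<integral>\<^sup>+\<omega>. ennreal (X t \<omega> ^ q) \<partial>M) \<le> (\<integral>\<^sup>+\<omega>. (SUP N. ennreal (X t \<omega> ^ q) * indicator (E N t) \<omega>) \<partial>M)"
    proof (rule nn_integral_mono_AE)
      show "AE \<omega> in M. ennreal (X t \<omega> ^ q) \<le> (SUP N. ennreal (X t \<omega> ^ q) * indicator (E N t) \<omega>)"
        using cont AE_space
      proof eventually_elim
        case (elim \<omega>)
        \<comment> \<open>A continuous path is bounded on [0, T], so it lies in the localising event
          from some level on.\<close>
        have "compact ((\<lambda>t. X t \<omega>) ` {0..T})" using elim by (intro compact_continuous_image) auto
        then have "bounded ((\<lambda>t. X t \<omega>) ` {0..T})" by (rule compact_imp_bounded)
        then obtain c where c: "\<And>t. t \<in> {0..T} \<Longrightarrow> \<bar>X t \<omega>\<bar> \<le> c"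
          unfolding bounded_iff real_norm_def by blast
        obtain N :: nat where N: "c \<le> real N" using real_arch_simple by blast
        then have "\<bar>X s \<omega>\<bar> \<le> real N" if "s \<in> {0..T}" for s using c[OF that] by simp
        then have "\<omega> \<in> E N t" using t elim by (auto simp: E_def)
        then have "ennreal (X t \<omega> ^ q) = ennreal (X t \<omega> ^ q) * indicator (E N t) \<omega>" by simp
        also have "\<dots> \<le> (SUP N. ennreal (X t \<omega> ^ q) * indicator (E N t) \<omega>)" by (rule SUP_upper) simp
        finally show ?case .
      qed
    qed
    also have "\<dots> = (SUP N. f N t)"
      unfolding f_def
    proof (rule nn_integral_monotone_convergence_SUP_AE)
      show "AE \<omega> in M. ennreal (X t \<omega> ^ q) * indicator (E N t) \<omega> \<le> ennreal (X t \<omega> ^ q) * indicator (E (Suc N) t) \<omega>" for N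
      proof (intro AE_I2 mult_left_mono)
        fix \<omega>
        have "E N t \<subseteq> E (Suc N) t" unfolding E_def by fastforce
        then show "indicator (E N t) \<omega> \<le> (indicator (E (Suc N) t) \<omega> :: ennreal)" by (auto simp: indicator_def)
      qed simp
    qed measurable
    also have "\<dots> \<le> ennreal C" by (intro SUP_least f_C)
    finally show "(\<integral>\<^sup>+\<omega>. ennreal (X t \<omega> ^ (2 * Suc n)) \<partial>M) \<le> ennreal C" by (simp only: q_def)
  qed
qed

end

section \<open>Stability of Volterra equations\<close>

lemma weighted_moment_le:
  fixes k :: "real \<Rightarrow> real" and \<phi> :: "real \<Rightarrow> ennreal"
  assumes meas: "(\<lambda>s. ennreal ((k s)\<^sup>2) * indicator {0..t} s) \<in> borel_measurable borel"
    and k: "(sq_int t k) \<le> ennreal c" "0 \<le> c"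
    and \<phi>: "\<And>s. s \<in> {0..t} \<Longrightarrow> \<phi> s \<le> ennreal A" "0 \<le> A"
  shows "(sq_int t k) ^ n * (\<integral>\<^sup>+s\<in>{0..t}. ennreal ((k s)\<^sup>2) * \<phi> s \<partial>lborel)
    \<le> ennreal (c ^ Suc n * A)"
proof -
  have "(\<integral>\<^sup>+s\<in>{0..t}. ennreal ((k s)\<^sup>2) * \<phi> s \<partial>lborel)
      \<le> (\<integral>\<^sup>+s. (ennreal ((k s)\<^sup>2) * indicator {0..t} s) * ennreal A \<partial>lborel)"
  proof (rule nn_integral_mono)
    fix s :: real
    show "ennreal ((k s)\<^sup>2) * \<phi> s * indicator {0..t} s \<le> (ennreal ((k s)\<^sup>2) * indicator {0..t} s) * ennreal A"
      using \<phi>(1)[of s] by (cases "s \<in> {0..t}") (simp_all add: mult_left_mono)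
  qed
  also have "\<dots> = (sq_int t k) * ennreal A"
    using meas by (intro nn_integral_multc) simp
  finally have "(\<integral>\<^sup>+s\<in>{0..t}. ennreal ((k s)\<^sup>2) * \<phi> s \<partial>lborel) \<le> ennreal c * ennreal A"
    using k(1) by (meson mult_right_mono order_trans zero_le)
  then have "(sq_int t k) ^ n * (\<integral>\<^sup>+s\<in>{0..t}. ennreal ((k s)\<^sup>2) * \<phi> s \<partial>lborel)
      \<le> ennreal c ^ n * (ennreal c * ennreal A)"
    by (intro mult_mono power_mono k(1)) auto
  also have "\<dots> = ennreal (c ^ Suc n * A)"
    using k(2) \<phi>(2) by (simp add: ennreal_mult ennreal_power mult_ac)
  finally show ?thesis .
qed

context brownian_space
begin

lemma ito_convolution_moment:
  fixes k1 k2 :: "real \<Rightarrow> real"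
  assumes ito: "has_ito_integral M F W (\<lambda>s \<omega>. k1 s * \<alpha> s \<omega> + k2 s * \<beta> s \<omega>) t I" and t: "0 \<le> t"
    and \<alpha>: "progressive F t \<alpha>" and \<beta>: "progressive F t \<beta>"
    and k1: "(\<lambda>s. ennreal ((k1 s)\<^sup>2) * indicator {0..t} s) \<in> borel_measurable borel"
    and k2: "(\<lambda>s. ennreal ((k2 s)\<^sup>2) * indicator {0..t} s) \<in> borel_measurable borel"
  shows "(\<integral>\<^sup>+\<omega>. ennreal (I \<omega> ^ (2 * Suc n)) \<partial>M) \<le> ennreal (conv_const n) *
    ((sq_int t k1) ^ n *
       (\<integral>\<^sup>+s\<in>{0..t}. ennreal ((k1 s)\<^sup>2) * (\<integral>\<^sup>+\<omega>. ennreal (\<alpha> s \<omega> ^ (2 * Suc n)) \<partial>M) \<partial>lborel)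
     + (sq_int t k2) ^ n *
       (\<integral>\<^sup>+s\<in>{0..t}. ennreal ((k2 s)\<^sup>2) * (\<integral>\<^sup>+\<omega>. ennreal (\<beta> s \<omega> ^ (2 * Suc n)) \<partial>M) \<partial>lborel))"
proof -
  have eq: "(\<integral>\<^sup>+\<omega>. f \<omega> * indicator (space M) \<omega> \<partial>M) = (\<integral>\<^sup>+\<omega>. f \<omega> \<partial>M)" for f :: "'a \<Rightarrow> ennreal"
    by (intro nn_integral_cong) simp
  have top: "space M \<in> sets (F s)" for s
    using sets.top[of "F s"] by (simp add: space_F)
  have left: "\<omega> \<in> space M" if "0 < s" "s \<le> t" "\<And>r. 0 \<le> r \<Longrightarrow> r < s \<Longrightarrow> \<omega> \<in> space M" for s :: real and \<omega>
    using that(3)[of 0] that(1) by simp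
  show ?thesis
    by (rule ito_convolution_moment_bound[where G="\<lambda>_. space M" and n=n,
          OF ito t \<alpha> \<beta> k1 k2 top subset_refl left, unfolded eq])
qed

lemma moment_measurable:
  assumes "progressive F T D" "0 \<le> T"
  shows "(\<lambda>s. \<integral>\<^sup>+\<omega>. ennreal (D (max 0 (min s T)) \<omega> ^ q) \<partial>M) \<in> borel_measurable borel"
proof -
  have [measurable]: "(\<lambda>p. D (max 0 (min (fst p) T)) (snd p)) \<in> borel_measurable (borel \<Otimes>\<^sub>M M)"
    by (rule progressive_measurable[OF assms]) measurable
  show ?thesis
    by (intro borel_measurable_nn_integral) (simp add: split_beta', measurable)
qed

text \<open>The condition on \<open>n\<close> raises the exponent of the time increment to at least
  two, as chaining requires. The constant is fixed before coefficients, kernels and solutions, so it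
  depends on them only through the bounds \<open>L\<close>, \<open>G\<close>, \<open>B\<close>,
  \<open>R\<close>.\<close>

lemma volterra_difference_sup_bound:
  fixes T \<gamma> G B R L :: real and n :: nat
  assumes T: "0 < T" and \<gamma>: "2 < \<gamma>" and n: "2 \<le> (1 - 2 / \<gamma>) * real (Suc n)"
  obtains C where "0 \<le> C" "\<And>\<sigma> x0 K1 K2 X Y \<Lambda>. L-lipschitz_on UNIV \<sigma> \<Longrightarrow> (\<And>x. \<bar>\<sigma> x\<bar> \<le> G * (1 + \<bar>x\<bar>)) \<Longrightarrow>
    (\<And>t. t \<in> {0..T} \<Longrightarrow> \<bar>x0 t\<bar> \<le> B) \<Longrightarrow>
    in_L \<gamma> T K1 \<Longrightarrow> L_norm \<gamma> T K1 \<le> R \<Longrightarrow> in_L \<gamma> T K2 \<Longrightarrow> L_norm \<gamma> T K2 \<le> R \<Longrightarrow>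
    square_superadditive K2 \<Longrightarrow> square_superadditive (\<lambda>u. K1 u - K2 u) \<Longrightarrow>
    volterra_solution M F W T x0 K1 \<sigma> X \<Longrightarrow> volterra_solution M F W T x0 K2 \<sigma> Y \<Longrightarrow>
    0 < \<Lambda> \<Longrightarrow> L_norm \<gamma> T (\<lambda>u. K1 u - K2 u) \<le> \<Lambda> \<Longrightarrow>
    \<exists>U. U \<in> borel_measurable M \<and> (AE \<omega> in M. \<forall>t\<in>{0..T}. ennreal ((X t \<omega> - Y t \<omega>) ^ (2 * Suc n)) \<le> U \<omega>) \<and>
      (\<integral>\<^sup>+\<omega>. U \<omega> \<partial>M) \<le> ennreal (C * \<Lambda> ^ (2 * Suc n))"
proof -
  define q where "q = 2 * Suc n"
  have q: "even q" by (simp add: q_def)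
  define \<kappa> where "\<kappa> = 1 - 2 / \<gamma>"
  define R' where "R' = max R 1"
  have R': "R \<le> R'" "0 < R'" by (auto simp: R'_def)
  define Q where "Q = 2 * R'\<^sup>2 * T powr \<kappa>"
  have Q: "0 \<le> Q" by (simp add: Q_def)
  obtain C1 where C1: "0 \<le> C1" and moment: "\<And>\<sigma> x0 K X t. \<sigma> \<in> borel_measurable borel \<Longrightarrow> (\<And>x. \<bar>\<sigma> x\<bar> \<le> G * (1 + \<bar>x\<bar>)) \<Longrightarrow>
    (\<And>t. t \<in> {0..T} \<Longrightarrow> \<bar>x0 t\<bar> \<le> B) \<Longrightarrow> in_L \<gamma> T K \<Longrightarrow> L_norm \<gamma> T K \<le> R \<Longrightarrow>
    volterra_solution M F W T x0 K \<sigma> X \<Longrightarrow> t \<in> {0..T} \<Longrightarrow>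
    (\<integral>\<^sup>+\<omega>. ennreal (X t \<omega> ^ q) \<partial>M) \<le> ennreal C1"
    
  proof (rule volterra_moment_bound[OF T \<gamma>, where n=n and G=G and B=B and R=R, folded q_def], goal_cases)
    case (1 C)
    show ?case by (rule 1(1)[OF 1(2)]) (fact 1(3))
  qed
  define A where "A = (2 * \<bar>G\<bar>) ^ q * (1 + C1)"
  have A: "0 \<le> A" using C1 by (simp add: A_def)
  define c where "c = conv_const n"
  have c: "0 \<le> c" by (simp add: c_def conv_const_nonneg)
  \<comment> \<open>\<open>a * \<Lambda> ^ q\<close> will bound the contribution of the kernel
    \<open>K1 - K2\<close>, and \<open>b\<close> is the feedback coefficient of the Lipschitz
    part.\<close>
  define a where "a = c * (2 * T powr \<kappa>) ^ Suc n * A"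
  have a: "0 \<le> a" using c A by (simp add: a_def)
  define b where "b = c * Q ^ n * \<bar>L\<bar> ^ q"
  have b: "0 \<le> b" using c Q by (simp add: b_def)
  define \<eta> where "\<eta> = 1 / (2 * (b + 1))"
  have \<eta>: "0 < \<eta>" "b * \<eta> \<le> 1 / 2" using b by (auto simp: \<eta>_def field_simps)
  obtain \<theta> where \<theta>: "0 < \<theta>" and small: "\<And>K. in_L \<gamma> T K \<Longrightarrow> L_norm \<gamma> T K \<le> R \<Longrightarrow>
    (\<integral>\<^sup>+u\<in>{0..T}. ennreal (exp (- \<theta> * u)) * ennreal ((K u)\<^sup>2) \<partial>lborel) \<le> ennreal \<eta>"
    using weighted_kernel_square_small[OF \<gamma> \<eta>(1) T] by blast
  define C2 where "C2 = 2 * a * exp (\<theta> * T)"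
  have C2: "0 \<le> C2" using a by (simp add: C2_def)
  \<comment> \<open>Constant of the increment bound; the power of \<open>T\<close> absorbs the part
    of the exponent of \<open>t - s\<close> in excess of two.\<close>
  define C3 where "C3 = c * 4 ^ Suc n * (A + R' ^ q * \<bar>L\<bar> ^ q * C2) * T powr (\<kappa> * real (Suc n) - 2)"
  define C4 where "C4 = max C2 C3"
  have C4: "0 \<le> C4" "C2 \<le> C4" "C3 \<le> C4" using C2 by (auto simp: C4_def)
  show thesis
  proof (rule that[of "chaining_const (Suc n) T * C4"])
    have "root (2 * Suc n) (3 / 4) < 1" using real_root_lt_1_iff[of "2 * Suc n" "3 / 4"] by simp
    then show "0 \<le> chaining_const (Suc n) T * C4"
      using C4 T unfolding chaining_const_def
      by (intro mult_nonneg_nonneg add_nonneg_nonneg divide_nonneg_nonneg zero_le_power) auto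
    fix \<sigma> x0 K1 K2 X Y \<Lambda>
    assume lip: "L-lipschitz_on UNIV \<sigma>" and growth: "\<And>x. \<bar>\<sigma> x\<bar> \<le> G * (1 + \<bar>x\<bar>)"
      and x0: "\<And>t. t \<in> {0..T} \<Longrightarrow> \<bar>x0 t\<bar> \<le> B"
      and K1: "in_L \<gamma> T K1" "L_norm \<gamma> T K1 \<le> R" and K2: "in_L \<gamma> T K2" "L_norm \<gamma> T K2 \<le> R"
      and sq: "square_superadditive K2" "square_superadditive (\<lambda>u. K1 u - K2 u)"
      and solX: "volterra_solution M F W T x0 K1 \<sigma> X" and solY: "volterra_solution M F W T x0 K2 \<sigma> Y"
      and \<Lambda>: "0 < \<Lambda>" "L_norm \<gamma> T (\<lambda>u. K1 u - K2 u) \<le> \<Lambda>"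
    define K where "K u = K1 u - K2 u" for u
    have K: "in_L \<gamma> T K" "L_norm \<gamma> T K \<le> \<Lambda>" "square_superadditive K"
      using in_L_diff[OF K1(1) K2(1)] \<gamma> \<Lambda> sq unfolding K_def by auto
    have "continuous_on UNIV \<sigma>" using lip by (rule lipschitz_on_continuous_on)
    then have \<sigma>: "\<sigma> \<in> borel_measurable borel" by (rule borel_measurable_continuous_onI)
    have progX: "progressive F T X" and progY: "progressive F T Y"
      and itoX: "\<And>t. t \<in> {0..T} \<Longrightarrow> has_ito_integral M F W (\<lambda>s \<omega>. K1 (t - s) * \<sigma> (X s \<omega>)) t (\<lambda>\<omega>. X t \<omega> - x0 t)"
      and itoY: "\<And>t. t \<in> {0..T} \<Longrightarrow> has_ito_integral M F W (\<lambda>s \<omega>. K2 (t - s) * \<sigma> (Y s \<omega>)) t (\<lambda>\<omega>. Y t \<omega> - x0 t)"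
      using solX solY by (auto simp: volterra_solution_def)
    define D where "D t \<omega> = X t \<omega> - Y t \<omega>" for t \<omega>
    define \<alpha> where "\<alpha> s \<omega> = \<sigma> (X s \<omega>)" for s \<omega>
    define \<beta> where "\<beta> s \<omega> = \<sigma> (X s \<omega>) - \<sigma> (Y s \<omega>)" for s \<omega>
    have prog: "progressive F T D" "progressive F T \<alpha>" "progressive F T \<beta>"
      unfolding D_def[abs_def] \<alpha>_def[abs_def] \<beta>_def[abs_def]
      by (rule progressive_diff[OF progX progY], rule progressive_compose[OF progX \<sigma>],
          rule progressive_diff[OF progressive_compose[OF progX \<sigma>] progressive_compose[OF progY \<sigma>]])
    have X_meas[measurable]: "t \<in> {0..T} \<Longrightarrow> X t \<in> borel_measurable M"
      and Y_meas[measurable]: "t \<in> {0..T} \<Longrightarrow> Y t \<in> borel_measurable M"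
      and D_meas: "t \<in> {0..T} \<Longrightarrow> D t \<in> borel_measurable M" for t
      using progressive_adapted measurable_F_M progX progY prog(1) by blast+
    define g where "g t = (\<integral>\<^sup>+\<omega>. ennreal (D t \<omega> ^ q) \<partial>M)" for t
    have \<alpha>_moment: "(\<integral>\<^sup>+\<omega>. ennreal (\<alpha> s \<omega> ^ q) \<partial>M) \<le> ennreal A" if s: "s \<in> {0..T}" for s
    proof -
      have [measurable]: "X s \<in> borel_measurable M" using X_meas[OF s] .
      have "(\<integral>\<^sup>+\<omega>. ennreal (\<alpha> s \<omega> ^ q) \<partial>M) \<le> (\<integral>\<^sup>+\<omega>. ennreal ((2 * \<bar>G\<bar>) ^ q) * (1 + ennreal (X s \<omega> ^ q)) \<partial>M)"
      proof (rule nn_integral_mono)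
        fix \<omega>
        have "ennreal (\<alpha> s \<omega> ^ q) \<le> ennreal ((2 * \<bar>G\<bar>) ^ q * (1 + X s \<omega> ^ q))"
          unfolding q_def \<alpha>_def by (intro ennreal_leI linear_growth_power_le growth)
        then show "ennreal (\<alpha> s \<omega> ^ q) \<le> ennreal ((2 * \<bar>G\<bar>) ^ q) * (1 + ennreal (X s \<omega> ^ q))"
          using q by (simp add: ennreal_mult ennreal_plus zero_le_even_power)
      qed
      also have "\<dots> = ennreal ((2 * \<bar>G\<bar>) ^ q) * (1 + (\<integral>\<^sup>+\<omega>. ennreal (X s \<omega> ^ q) \<partial>M))"
        by (simp add: nn_integral_cmult nn_integral_add emeasure_space_1)
      also have "\<dots> \<le> ennreal ((2 * \<bar>G\<bar>) ^ q) * (1 + ennreal C1)"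
        by (intro mult_left_mono add_left_mono moment[OF \<sigma> growth x0 K1 solX s]) auto
      also have "\<dots> = ennreal A" unfolding A_def using C1 by (simp add: ennreal_mult ennreal_plus)
      finally show ?thesis .
    qed
    have \<beta>_moment: "(\<integral>\<^sup>+\<omega>. ennreal (\<beta> s \<omega> ^ q) \<partial>M) \<le> ennreal (\<bar>L\<bar> ^ q) * g s" if s: "s \<in> {0..T}" for s
    proof -
      have [measurable]: "D s \<in> borel_measurable M" using D_meas[OF s] .
      have "(\<integral>\<^sup>+\<omega>. ennreal (\<beta> s \<omega> ^ q) \<partial>M) \<le> (\<integral>\<^sup>+\<omega>. ennreal (\<bar>L\<bar> ^ q) * ennreal (D s \<omega> ^ q) \<partial>M)"
      proof (rule nn_integral_mono)
        fix \<omega>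
        have "\<bar>\<beta> s \<omega>\<bar> \<le> L * \<bar>D s \<omega>\<bar>"
          using lipschitz_onD[OF lip, of "X s \<omega>" "Y s \<omega>"] by (simp add: \<beta>_def D_def dist_real_def)
        also have "\<dots> \<le> \<bar>L\<bar> * \<bar>D s \<omega>\<bar>" by (intro mult_right_mono) auto
        finally have "\<bar>\<beta> s \<omega>\<bar> ^ q \<le> (\<bar>L\<bar> * \<bar>D s \<omega>\<bar>) ^ q" by (intro power_mono) auto
        then have "\<beta> s \<omega> ^ q \<le> \<bar>L\<bar> ^ q * D s \<omega> ^ q" using q by (simp add: power_mult_distrib power_even_abs)
        then have "ennreal (\<beta> s \<omega> ^ q) \<le> ennreal (\<bar>L\<bar> ^ q * D s \<omega> ^ q)" by (rule ennreal_leI)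
        then show "ennreal (\<beta> s \<omega> ^ q) \<le> ennreal (\<bar>L\<bar> ^ q) * ennreal (D s \<omega> ^ q)"
          using q by (simp add: ennreal_mult zero_le_even_power)
      qed
      also have "\<dots> = ennreal (\<bar>L\<bar> ^ q) * g s" unfolding g_def by (rule nn_integral_cmult) measurable
      finally show ?thesis .
    qed
    \<comment> \<open>This bound carries no factor \<Lambda>; it only supplies the finiteness on
      which the Gronwall argument relies.\<close>
    have g_bdd: "g t \<le> ennreal (2 ^ q * (C1 + C1))" if t: "t \<in> {0..T}" for t
    proof -
      have [measurable]: "X t \<in> borel_measurable M" "Y t \<in> borel_measurable M" using X_meas[OF t] Y_meas[OF t] .
      have "g t \<le> (\<integral>\<^sup>+\<omega>. ennreal (2 ^ q) * (ennreal (X t \<omega> ^ q) + ennreal (Y t \<omega> ^ q)) \<partial>M)"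
        unfolding g_def
      proof (rule nn_integral_mono)
        fix \<omega>
        have "\<bar>D t \<omega>\<bar> ^ q \<le> (\<bar>X t \<omega>\<bar> + \<bar>Y t \<omega>\<bar>) ^ q" unfolding D_def by (intro power_mono) auto
        also have "\<dots> \<le> 2 ^ q * (\<bar>X t \<omega>\<bar> ^ q + \<bar>Y t \<omega>\<bar> ^ q)" by (intro abs_add_power_le) auto
        finally have "D t \<omega> ^ q \<le> 2 ^ q * (X t \<omega> ^ q + Y t \<omega> ^ q)" using q by (simp add: power_even_abs)
        then have "ennreal (D t \<omega> ^ q) \<le> ennreal (2 ^ q * (X t \<omega> ^ q + Y t \<omega> ^ q))" by (rule ennreal_leI)
        then show "ennreal (D t \<omega> ^ q) \<le> ennreal (2 ^ q) * (ennreal (X t \<omega> ^ q) + ennreal (Y t \<omega> ^ q))"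
          using q by (simp add: ennreal_mult ennreal_plus zero_le_even_power)
      qed
      also have "\<dots> = ennreal (2 ^ q) * ((\<integral>\<^sup>+\<omega>. ennreal (X t \<omega> ^ q) \<partial>M) + (\<integral>\<^sup>+\<omega>. ennreal (Y t \<omega> ^ q) \<partial>M))"
        by (simp add: nn_integral_cmult nn_integral_add)
      also have "\<dots> \<le> ennreal (2 ^ q) * (ennreal C1 + ennreal C1)"
        by (intro mult_left_mono add_mono moment[OF \<sigma> growth x0 K1 solX t] moment[OF \<sigma> growth x0 K2 solY t]) auto
      also have "ennreal C1 + ennreal C1 = ennreal (C1 + C1)"
        by (rule ennreal_plus[symmetric]) (use C1 in auto)
      also have "ennreal (2 ^ q) * ennreal (C1 + C1) = ennreal (2 ^ q * (C1 + C1))"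
        by (rule ennreal_mult[symmetric]) (use C1 in auto)
      finally show ?thesis .
    qed
    have itoD: "has_ito_integral M F W (\<lambda>s \<omega>. K (t - s) * \<alpha> s \<omega> + K2 (t - s) * \<beta> s \<omega>) t (D t)"
      if t: "t \<in> {0..T}" for t
    proof -
      have "has_ito_integral M F W (\<lambda>s \<omega>. K1 (t - s) * \<sigma> (X s \<omega>) - K2 (t - s) * \<sigma> (Y s \<omega>)) t
          (\<lambda>\<omega>. (X t \<omega> - x0 t) - (Y t \<omega> - x0 t))"
        using t by (intro has_ito_integral_diff itoX itoY) auto
      also have "(\<lambda>s \<omega>. K1 (t - s) * \<sigma> (X s \<omega>) - K2 (t - s) * \<sigma> (Y s \<omega>))
          = (\<lambda>s \<omega>. K (t - s) * \<alpha> s \<omega> + K2 (t - s) * \<beta> s \<omega>)"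
        by (simp add: K_def \<alpha>_def \<beta>_def fun_eq_iff algebra_simps)
      also have "(\<lambda>\<omega>. (X t \<omega> - x0 t) - (Y t \<omega> - x0 t)) = D t"
        by (simp add: D_def fun_eq_iff)
      finally show ?thesis .
    qed
    have g_le: "g t \<le> ennreal (a * \<Lambda> ^ q) + ennreal b * (\<integral>\<^sup>+s\<in>{0..t}. ennreal ((K2 (t - s))\<^sup>2) * g s \<partial>lborel)"
      if t: "t \<in> {0..T}" for t
    proof -
      have meas: "(\<lambda>s. ennreal ((K (t - s))\<^sup>2) * indicator {0..t} s) \<in> borel_measurable borel"
        "(\<lambda>s. ennreal ((K2 (t - s))\<^sup>2) * indicator {0..t} s) \<in> borel_measurable borel"
        using reflected_kernel_measurable[OF K(1)] reflected_kernel_measurable[OF K2(1)] t by auto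
      let ?J = "\<integral>\<^sup>+s\<in>{0..t}. ennreal ((K2 (t - s))\<^sup>2) * g s \<partial>lborel"
      have "g t \<le> ennreal c *
        ((sq_int t (\<lambda>s. K (t - s))) ^ n *
           (\<integral>\<^sup>+s\<in>{0..t}. ennreal ((K (t - s))\<^sup>2) * (\<integral>\<^sup>+\<omega>. ennreal (\<alpha> s \<omega> ^ q) \<partial>M) \<partial>lborel)
         + (sq_int t (\<lambda>s. K2 (t - s))) ^ n *
           (\<integral>\<^sup>+s\<in>{0..t}. ennreal ((K2 (t - s))\<^sup>2) * (\<integral>\<^sup>+\<omega>. ennreal (\<beta> s \<omega> ^ q) \<partial>M) \<partial>lborel))"
        unfolding g_def q_def c_def using t
        by (intro ito_convolution_moment itoD meas progressive_mono[OF prog(2)] progressive_mono[OF prog(3)]) auto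
      also have "\<dots> \<le> ennreal c * (ennreal ((2 * \<Lambda>\<^sup>2 * T powr \<kappa>) ^ Suc n * A) + ennreal Q ^ n * (ennreal (\<bar>L\<bar> ^ q) * ?J))"
      proof (rule mult_left_mono[OF add_mono])
        show "(sq_int t (\<lambda>s. K (t - s))) ^ n *
           (\<integral>\<^sup>+s\<in>{0..t}. ennreal ((K (t - s))\<^sup>2) * (\<integral>\<^sup>+\<omega>. ennreal (\<alpha> s \<omega> ^ q) \<partial>M) \<partial>lborel)
          \<le> ennreal ((2 * \<Lambda>\<^sup>2 * T powr \<kappa>) ^ Suc n * A)"
        proof (rule weighted_moment_le[OF meas(1)])
          show "(sq_int t (\<lambda>s. K (t - s))) \<le> ennreal (2 * \<Lambda>\<^sup>2 * T powr \<kappa>)"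
            unfolding \<kappa>_def using \<Lambda> K by (intro reflected_kernel_integral_le \<gamma> t T) auto
        qed (use \<alpha>_moment t A in auto)
        show "(sq_int t (\<lambda>s. K2 (t - s))) ^ n *
           (\<integral>\<^sup>+s\<in>{0..t}. ennreal ((K2 (t - s))\<^sup>2) * (\<integral>\<^sup>+\<omega>. ennreal (\<beta> s \<omega> ^ q) \<partial>M) \<partial>lborel)
          \<le> ennreal Q ^ n * (ennreal (\<bar>L\<bar> ^ q) * ?J)"
        proof (rule mult_mono[OF power_mono])
          show "(sq_int t (\<lambda>s. K2 (t - s))) \<le> ennreal Q"
            unfolding Q_def \<kappa>_def using R' K2 by (intro reflected_kernel_integral_le \<gamma> t T) auto
          have "(\<integral>\<^sup>+s\<in>{0..t}. ennreal ((K2 (t - s))\<^sup>2) * (\<integral>\<^sup>+\<omega>. ennreal (\<beta> s \<omega> ^ q) \<partial>M) \<partial>lborel)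
            \<le> (\<integral>\<^sup>+s. ennreal (\<bar>L\<bar> ^ q) * (ennreal ((K2 (t - s))\<^sup>2) * g s * indicator {0..t} s) \<partial>lborel)"
          proof (rule nn_integral_mono)
            fix s :: real
            have "ennreal ((K2 (t - s))\<^sup>2) * (\<integral>\<^sup>+\<omega>. ennreal (\<beta> s \<omega> ^ q) \<partial>M)
                \<le> ennreal ((K2 (t - s))\<^sup>2) * (ennreal (\<bar>L\<bar> ^ q) * g s)" if "s \<in> {0..t}"
              using that t by (intro mult_left_mono \<beta>_moment) auto
            then show "ennreal ((K2 (t - s))\<^sup>2) * (\<integral>\<^sup>+\<omega>. ennreal (\<beta> s \<omega> ^ q) \<partial>M) * indicator {0..t} s
                \<le> ennreal (\<bar>L\<bar> ^ q) * (ennreal ((K2 (t - s))\<^sup>2) * g s * indicator {0..t} s)"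
              by (cases "s \<in> {0..t}") (simp_all add: mult_ac)
          qed
          also have "\<dots> = ennreal (\<bar>L\<bar> ^ q) * ?J"
          proof (rule nn_integral_cmult)
            have "(\<lambda>s. g (max 0 (min s T))) \<in> borel_measurable borel"
              unfolding g_def using T by (intro moment_measurable prog) simp
            then have "(\<lambda>s. (ennreal ((K2 (t - s))\<^sup>2) * indicator {0..t} s) * g (max 0 (min s T))) \<in> borel_measurable lborel"
              using borel_measurable_times_ennreal[OF meas(2)] by simp
            also have "(\<lambda>s. (ennreal ((K2 (t - s))\<^sup>2) * indicator {0..t} s) * g (max 0 (min s T)))
                = (\<lambda>s. ennreal ((K2 (t - s))\<^sup>2) * g s * indicator {0..t} s)"
              using t by (auto simp: fun_eq_iff indicator_def)
            finally show "(\<lambda>s. ennreal ((K2 (t - s))\<^sup>2) * g s * indicator {0..t} s) \<in> borel_measurable lborel" .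
          qed
          finally show "(\<integral>\<^sup>+s\<in>{0..t}. ennreal ((K2 (t - s))\<^sup>2) * (\<integral>\<^sup>+\<omega>. ennreal (\<beta> s \<omega> ^ q) \<partial>M) \<partial>lborel)
            \<le> ennreal (\<bar>L\<bar> ^ q) * ?J" .
        qed auto
      qed auto
      also have "\<dots> = ennreal c * ennreal ((2 * \<Lambda>\<^sup>2 * T powr \<kappa>) ^ Suc n * A) + ennreal c * (ennreal Q ^ n * (ennreal (\<bar>L\<bar> ^ q) * ?J))"
        by (rule distrib_left)
      also have "ennreal c * (ennreal Q ^ n * (ennreal (\<bar>L\<bar> ^ q) * ?J)) = ennreal b * ?J"
        unfolding b_def using Q c by (simp add: ennreal_mult ennreal_power mult.assoc)
      also have "ennreal c * ennreal ((2 * \<Lambda>\<^sup>2 * T powr \<kappa>) ^ Suc n * A) = ennreal (c * ((2 * \<Lambda>\<^sup>2 * T powr \<kappa>) ^ Suc n * A))"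
        by (rule ennreal_mult[symmetric]) (use c A in auto)
      also have "c * ((2 * \<Lambda>\<^sup>2 * T powr \<kappa>) ^ Suc n * A) = a * \<Lambda> ^ q"
        unfolding a_def q_def power_mult by (simp only: power_mult_distrib mult_ac)
      finally show ?thesis .
    qed
    have g_bound: "g t \<le> ennreal (C2 * \<Lambda> ^ q)" if t: "t \<in> {0..T}" for t
    proof -
      have "g t \<le> 2 * ennreal (a * \<Lambda> ^ q) * ennreal (exp (\<theta> * T))"
      proof (rule volterra_gronwall[OF K2(1) b \<theta> _ g_bdd _ g_le t])
        have "ennreal b * (\<integral>\<^sup>+u\<in>{0..T}. ennreal (exp (- \<theta> * u)) * ennreal ((K2 u)\<^sup>2) \<partial>lborel)
          \<le> ennreal b * ennreal \<eta>" by (intro mult_left_mono small K2) auto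
        also have "\<dots> = ennreal (b * \<eta>)"
          by (rule ennreal_mult[symmetric]) (use b \<eta> in auto)
        also have "\<dots> \<le> ennreal (1 / 2)" by (rule ennreal_leI[OF \<eta>(2)])
        finally show "ennreal b * (\<integral>\<^sup>+u\<in>{0..T}. ennreal (exp (- \<theta> * u)) * ennreal ((K2 u)\<^sup>2) \<partial>lborel) \<le> ennreal (1 / 2)" .
      qed auto
      also have "\<dots> = ennreal (2 * (a * \<Lambda> ^ q) * exp (\<theta> * T))"
        using a \<Lambda> by (simp add: ennreal_mult)
      also have "2 * (a * \<Lambda> ^ q) * exp (\<theta> * T) = C2 * \<Lambda> ^ q" by (simp add: C2_def)
      finally show ?thesis .
    qed
    have incr: "(\<integral>\<^sup>+\<omega>. ennreal ((D t \<omega> - D s \<omega>) ^ q) \<partial>M) \<le> ennreal (C4 * \<Lambda> ^ q * (t - s)\<^sup>2)"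
      if st: "0 \<le> s" "s < t" "t \<le> T" for s t
    proof -
      have mem: "s \<in> {0..T}" "t \<in> {0..T}" using st by auto
      define h where "h = t - s"
      have h: "0 < h" "h \<le> T" using st by (auto simp: h_def)
      define \<delta> where "\<delta> k r = k (t - r) - k (s - r) * indicator {..s} r" for k :: "real \<Rightarrow> real" and r
      have meas: "(\<lambda>r. ennreal ((\<delta> K r)\<^sup>2) * indicator {0..t} r) \<in> borel_measurable borel"
        "(\<lambda>r. ennreal ((\<delta> K2 r)\<^sup>2) * indicator {0..t} r) \<in> borel_measurable borel"
        unfolding \<delta>_def using st by (intro kernel_increment_measurable[OF K(1)] kernel_increment_measurable[OF K2(1)]; simp)+
      \<comment> \<open>Applied to \<open>K\<close> with \<open>l = \<Lambda>\<close> and to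
        \<open>K2\<close> with \<open>l = R'\<close>. Only the first kernel is small; in the second
        summand the factor \<Lambda>^q comes from the moments of \<open>\<beta>\<close>.\<close>
      have \<delta>_le: "(sq_int t (\<lambda>r. \<delta> k r)) \<le> ennreal (4 * l\<^sup>2 * h powr \<kappa>)"
        if k: "in_L \<gamma> T k" "square_superadditive k" "L_norm \<gamma> T k \<le> l" "0 < l" for k l
      proof -
        have "(sq_int t (\<lambda>r. \<delta> k r)) \<le> 2 * (sq_int h k)"
          unfolding \<delta>_def h_def by (rule kernel_increment_le[OF k(1) \<gamma> k(2) st])
        also have "\<dots> \<le> 2 * ennreal (2 * l\<^sup>2 * h powr \<kappa>)"
          unfolding \<kappa>_def by (intro mult_left_mono kernel_square_le[OF k(1) \<gamma> h k(3,4)]) auto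
        also have "\<dots> = ennreal 2 * ennreal (2 * l\<^sup>2 * h powr \<kappa>)" by simp
        also have "\<dots> = ennreal (2 * (2 * l\<^sup>2 * h powr \<kappa>))" by (rule ennreal_mult[symmetric]) auto
        finally show ?thesis by (simp add: mult.assoc)
      qed
      have ito: "has_ito_integral M F W (\<lambda>r \<omega>. \<delta> K r * \<alpha> r \<omega> + \<delta> K2 r * \<beta> r \<omega>) t (\<lambda>\<omega>. D t \<omega> - D s \<omega>)"
      proof -
        have "has_ito_integral M F W (\<lambda>r \<omega>. (K (t - r) * \<alpha> r \<omega> + K2 (t - r) * \<beta> r \<omega>)
            - (K (s - r) * \<alpha> r \<omega> + K2 (s - r) * \<beta> r \<omega>) * indicator {..s} r) t (\<lambda>\<omega>. D t \<omega> - D s \<omega>)"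
          using st mem by (intro has_ito_integral_diff has_ito_integral_stop itoD) auto
        also have "(\<lambda>r \<omega>. (K (t - r) * \<alpha> r \<omega> + K2 (t - r) * \<beta> r \<omega>)
            - (K (s - r) * \<alpha> r \<omega> + K2 (s - r) * \<beta> r \<omega>) * indicator {..s} r)
          = (\<lambda>r \<omega>. \<delta> K r * \<alpha> r \<omega> + \<delta> K2 r * \<beta> r \<omega>)"
          by (simp add: \<delta>_def fun_eq_iff algebra_simps)
        finally show ?thesis .
      qed
      have "(\<integral>\<^sup>+\<omega>. ennreal ((D t \<omega> - D s \<omega>) ^ q) \<partial>M) \<le> ennreal c *
        ((sq_int t (\<lambda>r. \<delta> K r)) ^ n *
           (\<integral>\<^sup>+r\<in>{0..t}. ennreal ((\<delta> K r)\<^sup>2) * (\<integral>\<^sup>+\<omega>. ennreal (\<alpha> r \<omega> ^ q) \<partial>M) \<partial>lborel)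
         + (sq_int t (\<lambda>r. \<delta> K2 r)) ^ n *
           (\<integral>\<^sup>+r\<in>{0..t}. ennreal ((\<delta> K2 r)\<^sup>2) * (\<integral>\<^sup>+\<omega>. ennreal (\<beta> r \<omega> ^ q) \<partial>M) \<partial>lborel))"
        unfolding q_def c_def using st
        by (intro ito_convolution_moment ito meas progressive_mono[OF prog(2)] progressive_mono[OF prog(3)]) auto
      also have "\<dots> \<le> ennreal c * (ennreal ((4 * \<Lambda>\<^sup>2 * h powr \<kappa>) ^ Suc n * A)
          + ennreal ((4 * R'\<^sup>2 * h powr \<kappa>) ^ Suc n * (\<bar>L\<bar> ^ q * (C2 * \<Lambda> ^ q))))"
      proof (rule mult_left_mono[OF add_mono])
        show "(sq_int t (\<lambda>r. \<delta> K r)) ^ n *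
           (\<integral>\<^sup>+r\<in>{0..t}. ennreal ((\<delta> K r)\<^sup>2) * (\<integral>\<^sup>+\<omega>. ennreal (\<alpha> r \<omega> ^ q) \<partial>M) \<partial>lborel)
          \<le> ennreal ((4 * \<Lambda>\<^sup>2 * h powr \<kappa>) ^ Suc n * A)"
          by (rule weighted_moment_le[OF meas(1) \<delta>_le[OF K(1,3,2) \<Lambda>(1)]]) (use \<alpha>_moment st A in auto)
        show "(sq_int t (\<lambda>r. \<delta> K2 r)) ^ n *
           (\<integral>\<^sup>+r\<in>{0..t}. ennreal ((\<delta> K2 r)\<^sup>2) * (\<integral>\<^sup>+\<omega>. ennreal (\<beta> r \<omega> ^ q) \<partial>M) \<partial>lborel)
          \<le> ennreal ((4 * R'\<^sup>2 * h powr \<kappa>) ^ Suc n * (\<bar>L\<bar> ^ q * (C2 * \<Lambda> ^ q)))"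
        proof (rule weighted_moment_le[OF meas(2) \<delta>_le[OF K2(1) sq(1) _ R'(2)]])
          fix r assume "r \<in> {0..t}"
          then have r: "r \<in> {0..T}" using st by auto
          have "(\<integral>\<^sup>+\<omega>. ennreal (\<beta> r \<omega> ^ q) \<partial>M) \<le> ennreal (\<bar>L\<bar> ^ q) * ennreal (C2 * \<Lambda> ^ q)"
            by (intro order_trans[OF \<beta>_moment[OF r]] mult_left_mono g_bound r) auto
          also have "\<dots> = ennreal (\<bar>L\<bar> ^ q * (C2 * \<Lambda> ^ q))"
            by (rule ennreal_mult[symmetric]) (use C2 \<Lambda> in auto)
          finally show "(\<integral>\<^sup>+\<omega>. ennreal (\<beta> r \<omega> ^ q) \<partial>M) \<le> ennreal (\<bar>L\<bar> ^ q * (C2 * \<Lambda> ^ q))" .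
        qed (use K2 R' C2 \<Lambda> in auto)
      qed auto
      also have "\<dots> = ennreal (c * ((4 * \<Lambda>\<^sup>2 * h powr \<kappa>) ^ Suc n * A
          + (4 * R'\<^sup>2 * h powr \<kappa>) ^ Suc n * (\<bar>L\<bar> ^ q * (C2 * \<Lambda> ^ q))))"
        using c A C2 \<Lambda> by (subst ennreal_plus[symmetric]; (subst ennreal_mult[symmetric])?) (auto simp del: power_Suc)
      also have "\<dots> \<le> ennreal (C4 * \<Lambda> ^ q * (t - s)\<^sup>2)"
      proof (rule ennreal_leI)
        have split: "(4 * l\<^sup>2 * h powr \<kappa>) ^ Suc n = 4 ^ Suc n * l ^ q * (h powr \<kappa>) ^ Suc n" for l :: real
          unfolding q_def power_mult by (simp only: power_mult_distrib)
        have hp: "(h powr \<kappa>) ^ Suc n \<le> h\<^sup>2 * T powr (\<kappa> * real (Suc n) - 2)"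
        proof -
          have "(h powr \<kappa>) ^ Suc n = h powr (\<kappa> * real (Suc n))"
            using h by (simp add: powr_realpow[symmetric] powr_powr del: of_nat_Suc power_Suc)
          also have "\<dots> = h powr 2 * h powr (\<kappa> * real (Suc n) - 2)"
            unfolding powr_add[symmetric] by simp
          also have "\<dots> \<le> h\<^sup>2 * T powr (\<kappa> * real (Suc n) - 2)"
            using h n by (intro mult_mono powr_mono2) (auto simp: \<kappa>_def powr_numeral)
          finally show ?thesis .
        qed
        have "c * ((4 * \<Lambda>\<^sup>2 * h powr \<kappa>) ^ Suc n * A + (4 * R'\<^sup>2 * h powr \<kappa>) ^ Suc n * (\<bar>L\<bar> ^ q * (C2 * \<Lambda> ^ q)))
            = (c * 4 ^ Suc n * (A + R' ^ q * \<bar>L\<bar> ^ q * C2) * \<Lambda> ^ q) * (h powr \<kappa>) ^ Suc n"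
          unfolding split by (simp only: distrib_left distrib_right mult_ac)
        also have "\<dots> \<le> (c * 4 ^ Suc n * (A + R' ^ q * \<bar>L\<bar> ^ q * C2) * \<Lambda> ^ q) * (h\<^sup>2 * T powr (\<kappa> * real (Suc n) - 2))"
          using c A C2 \<Lambda> R' by (intro mult_left_mono[OF hp]) auto
        also have "\<dots> = C3 * \<Lambda> ^ q * h\<^sup>2" unfolding C3_def by (simp only: mult_ac)
        also have "\<dots> \<le> C4 * \<Lambda> ^ q * h\<^sup>2" using C4 \<Lambda> by (intro mult_right_mono) auto
        finally show "c * ((4 * \<Lambda>\<^sup>2 * h powr \<kappa>) ^ Suc n * A + (4 * R'\<^sup>2 * h powr \<kappa>) ^ Suc n * (\<bar>L\<bar> ^ q * (C2 * \<Lambda> ^ q)))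
            \<le> C4 * \<Lambda> ^ q * (t - s)\<^sup>2" by (simp only: h_def)
      qed
      finally show ?thesis .
    qed
    have cont: "AE \<omega> in M. continuous_on {0..T} (\<lambda>t. D t \<omega>)"
    proof -
      have "AE \<omega> in M. continuous_on {0..T} (\<lambda>t. X t \<omega>)" "AE \<omega> in M. continuous_on {0..T} (\<lambda>t. Y t \<omega>)"
        using solX solY by (auto simp: volterra_solution_def)
      then show ?thesis unfolding D_def by eventually_elim (rule continuous_on_diff)
    qed
    have init: "(\<integral>\<^sup>+\<omega>. ennreal (D 0 \<omega> ^ (2 * Suc n)) \<partial>M) \<le> ennreal (C4 * \<Lambda> ^ q)"
      using order_trans[OF g_bound[of 0] ennreal_leI[OF mult_right_mono[OF C4(2)]]] T \<Lambda>
      by (simp add: g_def q_def del: mult_Suc_right power_Suc)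
    have one: "1 \<le> Suc n" and nonneg: "0 \<le> C4 * \<Lambda> ^ (2 * Suc n)" using C4 \<Lambda> by auto
    obtain U where U: "U \<in> borel_measurable M"
      "AE \<omega> in M. \<forall>t\<in>{0..T}. ennreal (D t \<omega> ^ (2 * Suc n)) \<le> U \<omega>"
      "(\<integral>\<^sup>+\<omega>. U \<omega> \<partial>M) \<le> ennreal (chaining_const (Suc n) T * (C4 * \<Lambda> ^ (2 * Suc n)))"
      using sup_moment_bound[OF T one nonneg D_meas cont init[unfolded q_def] incr[unfolded q_def]] by blast
    then show "\<exists>U. U \<in> borel_measurable M \<and> (AE \<omega> in M. \<forall>t\<in>{0..T}. ennreal ((X t \<omega> - Y t \<omega>) ^ (2 * Suc n)) \<le> U \<omega>) \<and>
      (\<integral>\<^sup>+\<omega>. U \<omega> \<partial>M) \<le> ennreal (chaining_const (Suc n) T * C4 * \<Lambda> ^ (2 * Suc n))"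
      unfolding D_def mult.assoc by blast
  qed
qed

end

text \<open>Splitting at the scale \<Lambda> lowers the exponent from \<open>q\<close> to
  \<open>p\<close> pathwise, before any expectation is taken. If the moment of order
  \<open>q\<close> is of order \<Lambda>^q, both terms are of order \<Lambda>^p.\<close>

lemma powr_le_scaled_power:
  fixes x \<Lambda> p :: real
  assumes "0 < \<Lambda>" "0 < p" "p \<le> real q" "even q"
  shows "\<bar>x\<bar> powr p \<le> \<Lambda> powr p + \<Lambda> powr (p - real q) * x ^ q"
proof (cases "\<bar>x\<bar> \<le> \<Lambda>")
  case True
  then have "\<bar>x\<bar> powr p \<le> \<Lambda> powr p" using assms by (intro powr_mono2) auto
  then show ?thesis using assms by (simp add: add_increasing2 zero_le_even_power)
next
  case False
  then have x: "0 < \<bar>x\<bar>" "\<Lambda> \<le> \<bar>x\<bar>" using assms by auto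
  have "\<bar>x\<bar> powr p = \<bar>x\<bar> powr (p - real q) * \<bar>x\<bar> powr real q"
    by (simp add: powr_add[symmetric])
  also have "\<dots> = \<bar>x\<bar> powr (p - real q) * x ^ q"
    using x assms by (simp add: powr_realpow power_even_abs)
  also have "\<dots> \<le> \<Lambda> powr (p - real q) * x ^ q"
    using x assms by (intro mult_right_mono powr_mono2') (auto simp: zero_le_even_power)
  finally show ?thesis by (simp add: add_increasing)
qed

text \<open>The constant is chosen before all data, so it serves every pair of equations that obeys
  the Lipschitz, growth, boundedness and norm bounds \<open>L\<close>, \<open>G\<close>,
  \<open>B\<close>, \<open>R\<close>. The supremum is estimated through a measurable majorant,
  almost surely.\<close>

theorem corollary4p1:
  fixes M :: "'a measure" and F :: "real \<Rightarrow> 'a measure" and W :: "real \<Rightarrow> 'a \<Rightarrow> real"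
    and T \<gamma> p L G B R :: real
  assumes "brownian_space M F W" and "T > 0" and "\<gamma> > 2" and "p > 0"
  shows "\<exists>C>0. \<forall>\<sigma> x0 K1 K2 X Y.
    L-lipschitz_on UNIV \<sigma> \<and> (\<forall>x. \<bar>\<sigma> x\<bar> \<le> G * (1 + \<bar>x\<bar>)) \<and>
    continuous_on {0..T} x0 \<and> (\<forall>t\<in>{0..T}. \<bar>x0 t\<bar> \<le> B) \<and>
    in_L \<gamma> T K1 \<and> in_L \<gamma> T K2 \<and> L_norm \<gamma> T K1 \<le> R \<and> L_norm \<gamma> T K2 \<le> R \<and>
    completely_monotone K2 \<and>
    (completely_monotone (\<lambda>t. K1 t - K2 t) \<or> completely_monotone (\<lambda>t. K2 t - K1 t)) \<and>
    volterra_solution M F W T x0 K1 \<sigma> X \<and> volterra_solution M F W T x0 K2 \<sigma> Y \<longrightarrow>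
    (\<integral>\<^sup>+\<omega>. (SUP t\<in>{0..T}. ennreal (\<bar>X t \<omega> - Y t \<omega>\<bar> powr p)) \<partial>M)
      \<le> ennreal (C * L_norm \<gamma> T (\<lambda>t. K1 t - K2 t) powr p)"
proof -
  interpret brownian_space M F W by fact
  define \<kappa> where "\<kappa> = 1 - 2 / \<gamma>"
  have \<kappa>: "0 < \<kappa>" using assms(3) by (simp add: \<kappa>_def)
  \<comment> \<open>Large enough both for the chaining condition and for the even exponent
    \<open>q\<close> to dominate \<open>p\<close>.\<close>
  obtain n :: nat where "max (2 / \<kappa>) p \<le> real n" using real_arch_simple by blast
  then have "2 / \<kappa> \<le> real (Suc n)" "p \<le> real n" by auto
  then have n: "2 \<le> (1 - 2 / \<gamma>) * real (Suc n)" "p \<le> real (2 * Suc n)"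
    using \<kappa> by (auto simp: \<kappa>_def[symmetric] field_simps)
  define q where "q = 2 * Suc n"
  obtain C where C: "0 \<le> C" and sup_bound: "\<And>\<sigma> x0 K1 K2 X Y \<Lambda>. L-lipschitz_on UNIV \<sigma> \<Longrightarrow> (\<And>x. \<bar>\<sigma> x\<bar> \<le> G * (1 + \<bar>x\<bar>)) \<Longrightarrow>
    (\<And>t. t \<in> {0..T} \<Longrightarrow> \<bar>x0 t\<bar> \<le> B) \<Longrightarrow>
    in_L \<gamma> T K1 \<Longrightarrow> L_norm \<gamma> T K1 \<le> R \<Longrightarrow> in_L \<gamma> T K2 \<Longrightarrow> L_norm \<gamma> T K2 \<le> R \<Longrightarrow>
    square_superadditive K2 \<Longrightarrow> square_superadditive (\<lambda>u. K1 u - K2 u) \<Longrightarrow>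
    volterra_solution M F W T x0 K1 \<sigma> X \<Longrightarrow> volterra_solution M F W T x0 K2 \<sigma> Y \<Longrightarrow>
    0 < \<Lambda> \<Longrightarrow> L_norm \<gamma> T (\<lambda>u. K1 u - K2 u) \<le> \<Lambda> \<Longrightarrow>
    \<exists>U. U \<in> borel_measurable M \<and> (AE \<omega> in M. \<forall>t\<in>{0..T}. ennreal ((X t \<omega> - Y t \<omega>) ^ q) \<le> U \<omega>) \<and>
      (\<integral>\<^sup>+\<omega>. U \<omega> \<partial>M) \<le> ennreal (C * \<Lambda> ^ q)"
    
  proof (rule volterra_difference_sup_bound[OF assms(2,3) n(1), where L=L and G=G and B=B and R=R, folded q_def], goal_cases)
    case (1 C)
    show ?case by (rule 1(1)[OF 1(2)]) (fact 1(3))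
  qed
  show ?thesis
  proof (intro exI[of _ "1 + C"] conjI allI impI; (elim conjE)?)
    show "0 < 1 + C" using C by simp
    fix \<sigma> x0 K1 K2 X Y
    assume lip: "L-lipschitz_on UNIV \<sigma>" and growth: "\<forall>x. \<bar>\<sigma> x\<bar> \<le> G * (1 + \<bar>x\<bar>)"
      and x0: "\<forall>t\<in>{0..T}. \<bar>x0 t\<bar> \<le> B"
      and K: "in_L \<gamma> T K1" "in_L \<gamma> T K2" "L_norm \<gamma> T K1 \<le> R" "L_norm \<gamma> T K2 \<le> R"
      and mono: "completely_monotone K2" "completely_monotone (\<lambda>t. K1 t - K2 t) \<or> completely_monotone (\<lambda>t. K2 t - K1 t)"
      and sol: "volterra_solution M F W T x0 K1 \<sigma> X" "volterra_solution M F W T x0 K2 \<sigma> Y"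
    \<comment> \<open>The case in which \<open>K2 - K1\<close> is completely monotone reduces to the
      other one by a change of sign.\<close>
    have sq: "square_superadditive K2" "square_superadditive (\<lambda>u. K1 u - K2 u)"
      using mono completely_monotone_square_superadditive[of K2]
        completely_monotone_square_superadditive[of "\<lambda>u. K1 u - K2 u"]
        completely_monotone_square_superadditive[of "\<lambda>u. K2 u - K1 u"]
        square_superadditive_uminus[of "\<lambda>u. K1 u - K2 u"] by auto
    let ?E = "\<integral>\<^sup>+\<omega>. (SUP t\<in>{0..T}. ennreal (\<bar>X t \<omega> - Y t \<omega>\<bar> powr p)) \<partial>M"
    let ?N = "L_norm \<gamma> T (\<lambda>t. K1 t - K2 t)"
    have bound: "?E \<le> ennreal ((1 + C) * \<Lambda> powr p)" if \<Lambda>: "0 < \<Lambda>" "?N \<le> \<Lambda>" for \<Lambda>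
    proof -
      obtain U where [measurable]: "U \<in> borel_measurable M"
        and U: "AE \<omega> in M. \<forall>t\<in>{0..T}. ennreal ((X t \<omega> - Y t \<omega>) ^ q) \<le> U \<omega>"
          "(\<integral>\<^sup>+\<omega>. U \<omega> \<partial>M) \<le> ennreal (C * \<Lambda> ^ q)"
        using sup_bound[OF lip _ _ K(1,3,2,4) sq sol \<Lambda>] growth x0 by blast
      have "?E \<le> (\<integral>\<^sup>+\<omega>. ennreal (\<Lambda> powr p) + ennreal (\<Lambda> powr (p - real q)) * U \<omega> \<partial>M)"
      proof (rule nn_integral_mono_AE)
        show "AE \<omega> in M. (SUP t\<in>{0..T}. ennreal (\<bar>X t \<omega> - Y t \<omega>\<bar> powr p))
          \<le> ennreal (\<Lambda> powr p) + ennreal (\<Lambda> powr (p - real q)) * U \<omega>"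
          using U(1)
        proof eventually_elim
          case (elim \<omega>)
          show ?case
          proof (rule SUP_least)
            fix t assume t: "t \<in> {0..T}"
            have "ennreal (\<bar>X t \<omega> - Y t \<omega>\<bar> powr p)
              \<le> ennreal (\<Lambda> powr p + \<Lambda> powr (p - real q) * (X t \<omega> - Y t \<omega>) ^ q)"
              using n(2) assms(4) by (intro ennreal_leI powr_le_scaled_power \<Lambda>) (auto simp: q_def)
            also have "\<dots> = ennreal (\<Lambda> powr p) + ennreal (\<Lambda> powr (p - real q)) * ennreal ((X t \<omega> - Y t \<omega>) ^ q)"
              by (simp add: ennreal_plus ennreal_mult q_def zero_le_even_power del: mult_Suc_right power_Suc)
            also have "\<dots> \<le> ennreal (\<Lambda> powr p) + ennreal (\<Lambda> powr (p - real q)) * U \<omega>"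
              using elim t by (intro add_left_mono mult_left_mono) auto
            finally show "ennreal (\<bar>X t \<omega> - Y t \<omega>\<bar> powr p) \<le> ennreal (\<Lambda> powr p) + ennreal (\<Lambda> powr (p - real q)) * U \<omega>" .
          qed
        qed
      qed
      also have "\<dots> = ennreal (\<Lambda> powr p) + ennreal (\<Lambda> powr (p - real q)) * (\<integral>\<^sup>+\<omega>. U \<omega> \<partial>M)"
        by (simp add: nn_integral_add nn_integral_cmult emeasure_space_1)
      also have "\<dots> \<le> ennreal (\<Lambda> powr p) + ennreal (\<Lambda> powr (p - real q)) * ennreal (C * \<Lambda> ^ q)"
        by (intro add_left_mono mult_left_mono U) auto
      also have "\<dots> = ennreal (\<Lambda> powr p + \<Lambda> powr (p - real q) * (C * \<Lambda> ^ q))"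
        using C \<Lambda> by (simp add: ennreal_plus ennreal_mult)
      also have "\<Lambda> powr (p - real q) * (C * \<Lambda> ^ q) = C * \<Lambda> powr p"
      proof -
        have "\<Lambda> ^ q = \<Lambda> powr real q" using \<Lambda> by (simp add: powr_realpow)
        then have "\<Lambda> powr (p - real q) * (C * \<Lambda> ^ q) = C * (\<Lambda> powr (p - real q) * \<Lambda> powr real q)"
          by (simp only: mult_ac)
        then show ?thesis by (simp add: powr_add[symmetric])
      qed
      finally show ?thesis by (simp add: distrib_right)
    qed
    show "?E \<le> ennreal ((1 + C) * ?N powr p)"
    \<comment> \<open>A vanishing norm cannot serve as \<Lambda>. In that case every positive
      \<Lambda> is admissible, and letting it tend to zero makes the expectation vanish.\<close>
    proof (cases "?N = 0")
      case False
      then show ?thesis using bound[of ?N] L_norm_nonneg[of \<gamma> T "\<lambda>t. K1 t - K2 t"] by simp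
    next
      case True
      have "?E \<le> 0"
      proof (rule ennreal_le_epsilon)
        fix e :: real assume e: "0 < e"
        define \<Lambda> where "\<Lambda> = (e / (1 + C)) powr (1 / p)"
        have "0 < \<Lambda>" using e C by (simp add: \<Lambda>_def)
        moreover have "(1 + C) * \<Lambda> powr p = e"
          using e C assms(4) by (simp add: \<Lambda>_def powr_powr)
        ultimately show "?E \<le> 0 + ennreal e" using bound[of \<Lambda>] True by simp
      qed
      then show ?thesis by simp
    qed
  qed
qed

end
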